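(* Let $a,b,c\in\mathbb R$ satisfy $a,b>-1$, $0<c-a-b-2<1$ and $b+2\le c<a+2$. Then the following hold. (a) Suppose $-a\neq c-a-b-2$. Then: (1) $T_{a,b,c}$ and $S_{a,b,c}$ map $L^p(\mathbb D)$ boundedly into $L^{q,\infty}(\mathbb D)$ for all $1\le p,q\le\infty$ with $\frac1q=\frac1p+c-a-b-2$ and $\frac1p<b+1$. Both $T_{a,b,c}$ and $S_{a,b,c}$ are unbounded from $L^p(\mathbb D)$ to $L^{q,\infty}(\mathbb D)$ if $p=\frac{1}{b+1}$ and $c-1-a\le\frac1q\le1$. (2) $T_{a,b,c}$ and $S_{a,b,c}$ map $L^{p,1}(\mathbb D)$ boundedly into $L^{q,\infty}(\mathbb D)$ if $p=\frac{1}{b+1}$ and $c-1-a\le\frac1q\le1$. (b) Suppose $-a=c-a-b-2$. Then: (1) $T_{a,b,c}$ and $S_{a,b,c}$ map $L^p(\mathbb D)$ boundedly into $L^{q,\infty}(\mathbb D)$ for all $1\le p,q\le\infty$ with $\frac1q=\frac1p+c-a-b-2$, $\frac1p<b+1$ and $p\ne\infty$. Both $T_{a,b,c}$ and $S_{a,b,c}$ are unbounded from $L^p(\mathbb D)$ to $L^{q,\infty}(\mathbb D)$ if either $p=\infty$ and $q=\frac{1}{c-a-b-2}$, or $p=\frac{1}{b+1}$ and $c-1-a\le\frac1q\le1$. (2) $T_{a,b,c}$ and $S_{a,b,c}$ map $L^{p,1}(\mathbb D)$ boundedly into $L^{q,\infty}(\mathbb D)$ if $p=\frac{1}{b+1}$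 and $c-1-a\le\frac1q\le1$. Further, the restricted weak-type estimate at $(p,q)=\left(\infty,\frac{1}{c-a-b-2}\right)$ fails for both $T_{a,b,c}$ and $S_{a,b,c}$.
   Context: $\mathbb D$ is the open unit disc in $\mathbb C$, $dA$ is normalized area measure on $\mathbb D$, and $|E|$ is the $dA$-measure of $E\subseteq\mathbb D$. For $a,b,c\in\mathbb R$, $$T_{a,b,c}f(z):=(1-|z|^2)^a\int_{\mathbb D}\frac{(1-|w|^2)^b}{(1-z\overline w)^c}f(w)\,dA(w),\qquad S_{a,b,c}f(z):=(1-|z|^2)^a\int_{\mathbb D}\frac{(1-|w|^2)^b}{|1-z\overline w|^c}f(w)\,dA(w),$$ with the principal branch of the power. $L^p(\mathbb D)=L^p(\mathbb D,dA)$. For $1\le q<\infty$, $\|f\|_{L^{q,\infty}}=\sup_{\lambda>0}\lambda|\{|f|>\lambda\}|^{1/q}$, and $L^{\infty,\infty}=L^\infty$. For $1\le p<\infty$, $\|f\|_{L^{p,1}}=p\int_0^\infty|\{|f|>\lambda\}|^{1/p}\,d\lambda$. An operator $\mathcal T$ maps $X$ boundedly into $Y$ if for every $f\in X$ the defining integral converges absolutely for a.e. $z$ and $\|\mathcal Tf\|_Y\le C\|f\|_X$ with $C$ independent of $f$; otherwise it is unbounded from $X$ to $Y$. The restricted weak-type estimate at $(\infty,q)$ means that $\|\mathcal T\mathbf 1_E\|_{L^{q,\infty}}\le C$ for all measurable $E\subseteq\mathbb D$. *)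

theory Defs
  imports "HOL-Analysis.Analysis" "HOL-Probability.Essential_Supremum"
begin

text \<open>Normalized area measure on the open unit disc, on the Lebesgue measurable subsets of the disc.\<close>

definition dA :: "complex measure" where
  "dA = density (lebesgue_on (ball 0 1)) (\<lambda>_. ennreal (1 / pi))"

text \<open>
  The \<open>w\<close>-integrands of the two operators without the factor \<open>f w\<close>. In \<open>T_ker\<close> the second
  \<open>powr\<close> is the complex one, \<open>exp (c * Ln x)\<close> with the principal logarithm; the base
  \<open>1 - z * cnj w\<close> has positive real part for \<open>z\<close>, \<open>w\<close> in the disc. All other powers are
  real powers with positive base.
\<close>

definition T_ker :: "real \<Rightarrow> real \<Rightarrow> complex \<Rightarrow> complex \<Rightarrow> complex" where
  "T_ker b c z w =
     complex_of_real ((1 - (cmod w)\<^sup>2) powr b) / (1 - z * cnj w) powr complex_of_real c"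

definition S_ker :: "real \<Rightarrow> real \<Rightarrow> complex \<Rightarrow> complex \<Rightarrow> complex" where
  "S_ker b c z w =
     complex_of_real ((1 - (cmod w)\<^sup>2) powr b / cmod (1 - z * cnj w) powr c)"

text \<open>
  \<open>int_op a (T_ker b c)\<close> is $T_{a,b,c}$ and \<open>int_op a (S_ker b c)\<close> is $S_{a,b,c}$.
  The Bochner integral is \<open>0\<close> where the integrand is not integrable; absolute
  convergence is therefore demanded separately in \<open>maps_boundedly\<close>.
\<close>

definition int_op ::
  "real \<Rightarrow> (complex \<Rightarrow> complex \<Rightarrow> complex) \<Rightarrow> (complex \<Rightarrow> complex) \<Rightarrow> complex \<Rightarrow> complex" where
  "int_op a k f z =
     complex_of_real ((1 - (cmod z)\<^sup>2) powr a) * (\<integral>w. k z w * f w \<partial>dA)"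

text \<open>
  Norms are \<open>ennreal\<close>-valued, so that membership in a space is measurability together with
  finiteness of the norm. Exponents that may be infinite are of type \<open>ereal\<close>, where
  \<open>1 / \<infinity> = 0\<close>.
\<close>

text \<open>Positive real powers on \<open>[0, \<infinity>]\<close>.\<close>

definition ennpowr :: "ennreal \<Rightarrow> real \<Rightarrow> ennreal" where
  "ennpowr x r = (if x = \<infinity> then \<infinity> else ennreal (enn2real x powr r))"

definition Lp_norm :: "ereal \<Rightarrow> (complex \<Rightarrow> complex) \<Rightarrow> ennreal" where
  "Lp_norm p f =
     (if p = \<infinity> then esssup dA (\<lambda>z. ennreal (cmod (f z)))
      else ennpowr (\<integral>\<^sup>+ z. ennreal (cmod (f z) powr real_of_ereal p) \<partial>dA)
             (1 / real_of_ereal p))"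

text \<open>\<open>dA\<close> is finite, so the distribution function can be taken with the real-valued \<open>measure\<close>.\<close>

definition distr_fun :: "(complex \<Rightarrow> complex) \<Rightarrow> real \<Rightarrow> real" where
  "distr_fun f t = measure dA {z \<in> space dA. cmod (f z) > t}"

definition weak_norm :: "ereal \<Rightarrow> (complex \<Rightarrow> complex) \<Rightarrow> ennreal" where
  "weak_norm q f =
     (if q = \<infinity> then Lp_norm \<infinity> f
      else (SUP t\<in>{0<..}. ennreal (t * distr_fun f t powr (1 / real_of_ereal q))))"

text \<open>The norm of the Lorentz space $L^{p,1}$, for finite \<open>p\<close> only.\<close>

definition lorentz1_norm :: "real \<Rightarrow> (complex \<Rightarrow> complex) \<Rightarrow> ennreal" where
  "lorentz1_norm p f =
     ennreal p * (\<integral>\<^sup>+ t\<in>{0<..}. ennreal (distr_fun f t powr (1 / p)) \<partial>lborel)"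

definition maps_boundedly ::
  "real \<Rightarrow> (complex \<Rightarrow> complex \<Rightarrow> complex) \<Rightarrow> ((complex \<Rightarrow> complex) \<Rightarrow> ennreal)
    \<Rightarrow> ((complex \<Rightarrow> complex) \<Rightarrow> ennreal) \<Rightarrow> bool" where
  "maps_boundedly a k NX NY \<longleftrightarrow>
     (\<exists>C\<ge>0::real. \<forall>f \<in> borel_measurable dA. NX f < \<infinity> \<longrightarrow>
        (AE z in dA. integrable dA (\<lambda>w. k z w * f w)) \<and>
        int_op a k f \<in> borel_measurable dA \<and>
        NY (int_op a k f) \<le> ennreal C * NX f)"

definition restricted_weak_type_at_infinity ::
  "real \<Rightarrow> (complex \<Rightarrow> complex \<Rightarrow> complex) \<Rightarrow> ereal \<Rightarrow> bool" where
  "restricted_weak_type_at_infinity a k q \<longleftrightarrow>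
     (\<exists>C\<ge>0::real. \<forall>E \<in> sets dA. weak_norm q (int_op a k (indicator E)) \<le> ennreal C)"

end

theory Submission
  imports Defs "HOL-Probability.Distribution_Functions" "HOL-Complex_Analysis.Cauchy_Integral_Theorem"
begin

text \<open>
  Put \<open>\<delta> = c - a - b - 2\<close> and \<open>\<alpha> = a + \<delta> \<ge> 0\<close>. The kernel of \<open>S\<close> is \<open>(1 - |z|\<^sup>2) powr - \<delta>\<close> times the
  homogeneous kernel \<open>K(z, w) = (1 - |z|\<^sup>2) powr \<alpha> * (1 - |w|\<^sup>2) powr b * |1 - z cnj w| powr - (2 + \<alpha> + b)\<close>.
  The first factor is in weak \<open>L\<^sup>p\<close> for \<open>p = 1 / \<delta>\<close>, and products of weak functions are weak, so upper bounds
  reduce to weak-type bounds for \<open>K\<close>. For \<open>1 / p < b + 1\<close> these come from a Schur test. At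
  \<open>1 / p = b + 1\<close>, cutting \<open>K\<close> at \<open>1 - |w|\<^sup>2 = \<rho> (1 - |z|\<^sup>2)\<close> gives a part bounded by \<open>\<rho> powr (b + 1)\<close>
  on \<open>L\<^sup>\<infinity>\<close> and a part bounded by \<open>\<rho> powr b\<close> on \<open>L\<^sup>1\<close>; optimizing \<open>\<rho>\<close> gives the restricted weak-type
  bound, which extends to the Lorentz space by the layer cake formula.

  Since \<open>S\<close> dominates \<open>T\<close>, only \<open>T\<close> matters for unboundedness. When \<open>\<alpha> = 0\<close>, the function \<open>T f\<close>
  for bounded \<open>f\<close> is \<open>(1 - |z|\<^sup>2) powr - \<delta>\<close> times a Bloch function, and lacunary Bloch functions
  grow like the square root of \<open>log (1 / (1 - |z|))\<close>; randomization produces such functions from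
  indicator functions.
\<close>

section \<open>Area measure on the disc\<close>

text \<open>The condition \<open>c < a + 2\<close> says b + \<delta> < 0. Hence b < 0, every p with
  1 / p \<le> b + 1 exceeds 1, and no L^1 endpoint occurs. On bounded functions the Forelli-Rudin
  exponent of the homogeneous kernel is \<alpha> itself. For \<alpha> = 0 the integral of the kernel
  over the disc grows logarithmically, which rules out S but not T, whose phases may cancel. A lower
  bound for T must therefore come from Fourier coefficients. A single coefficient of the Bloch
  factor stays bounded, so one frequency cannot refute the estimate. With n dyadic frequencies, each
  contributes a fixed amount to the L^1 mean over one thin annulus, and averaging over all 2^n
  unions of the chosen sets keeps at least a multiple of n / sqrt n. Choosing subsets instead of
  signs keeps the inputs indicator functions, as the restricted estimate requires. The L^1 mean is
  controlled from above because \<delta> < 1: a weak L^(1/\<delta>) function is integrable over a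
  set of measure m, with bound a multiple of m^(1-\<delta>).\<close>

abbreviation defect :: "complex \<Rightarrow> real" where
  "defect z \<equiv> 1 - (cmod z)\<^sup>2"

lemma nn_integral_lborel_translate:
  fixes g :: "'a::euclidean_space \<Rightarrow> ennreal"
  assumes [measurable]: "g \<in> borel_measurable borel"
  shows "(\<integral>\<^sup>+ x. g (t + x) \<partial>lborel) = (\<integral>\<^sup>+ x. g x \<partial>lborel)"
proof -
  have "(\<integral>\<^sup>+ x. g x \<partial>lborel) = (\<integral>\<^sup>+ x. g x \<partial>distr lborel borel ((+) t))"
    by (simp add: lborel_distr_plus)
  also have "\<dots> = (\<integral>\<^sup>+ x. g (t + x) \<partial>lborel)"
    by (subst nn_integral_distr) auto
  finally show ?thesis ..
qed

text \<open>Uniqueness of Haar measure in disguise: both sides are multiplied by the volume of the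
  unit ball, written as a convolution integral, and compared by Tonelli.\<close>

lemma nn_integral_lborel_rotate:
  fixes g :: "complex \<Rightarrow> ennreal"
  assumes g[measurable]: "g \<in> borel_measurable borel" and u: "cmod u = 1"
  shows "(\<integral>\<^sup>+ x. g (u * x) \<partial>lborel) = (\<integral>\<^sup>+ x. g x \<partial>lborel)"
proof -
  define h :: "complex \<Rightarrow> ennreal" where "h = indicator (ball 0 1)"
  have [measurable]: "h \<in> borel_measurable borel"
    by (auto simp: h_def intro!: borel_measurable_indicator)
  have u0: "u \<noteq> 0" using u by auto
  define V where "V = (\<integral>\<^sup>+ x. h x \<partial>lborel)"
  have V_eq: "V = emeasure lborel (ball (0::complex) 1)" by (simp add: V_def h_def)
  have V: "V \<noteq> 0" "V \<noteq> top"
    using emeasure_lborel_ball_finite[of "0::complex" 1] content_ball_pos[of 1 "0::complex"]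
    unfolding V_eq by (auto simp: measure_def)
  have hneg: "h (a - b) = h (b - a)" for a b
    by (simp add: h_def indicator_def norm_minus_commute)
  have hrot: "h (u * x) = h x" for x by (simp add: h_def indicator_def norm_mult u)
  have "V * (\<integral>\<^sup>+ x. g (u * x) \<partial>lborel) = (\<integral>\<^sup>+ x. g (u * x) * V \<partial>lborel)"
    by (subst nn_integral_multc) (auto simp: mult.commute)
  also have "\<dots> = (\<integral>\<^sup>+ x. (\<integral>\<^sup>+ y. g (u * x) * h (u * x - y) \<partial>lborel) \<partial>lborel)"
  proof (intro nn_integral_cong)
    fix x
    have "(\<integral>\<^sup>+ y. h (u * x - y) \<partial>lborel) = (\<integral>\<^sup>+ y. h (- (u * x) + y) \<partial>lborel)"
      by (intro nn_integral_cong) (simp add: hneg[of "u * x"])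
    then have "(\<integral>\<^sup>+ y. h (u * x - y) \<partial>lborel) = V"
      using nn_integral_lborel_translate[of h "- (u * x)"] by (simp only: V_def) simp
    then show "g (u * x) * V = (\<integral>\<^sup>+ y. g (u * x) * h (u * x - y) \<partial>lborel)"
      by (subst nn_integral_cmult) auto
  qed
  also have "\<dots> = (\<integral>\<^sup>+ y. (\<integral>\<^sup>+ x. g (u * x) * h (u * x - y) \<partial>lborel) \<partial>lborel)"
    by (rule lborel_pair.Fubini'[symmetric]) measurable
  also have "\<dots> = (\<integral>\<^sup>+ y. (\<integral>\<^sup>+ x. g (u * x + y) * h (u * x) \<partial>lborel) \<partial>lborel)"
  proof (rule nn_integral_cong)
    fix y
    show "(\<integral>\<^sup>+ x. g (u * x) * h (u * x - y) \<partial>lborel) = (\<integral>\<^sup>+ x. g (u * x + y) * h (u * x) \<partial>lborel)"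
      by (subst nn_integral_lborel_translate[of _ "y / u", symmetric])
        (auto simp: distrib_left u0 add.commute)
  qed
  also have "\<dots> = (\<integral>\<^sup>+ x. (\<integral>\<^sup>+ y. g (u * x + y) * h (u * x) \<partial>lborel) \<partial>lborel)"
    by (rule lborel_pair.Fubini') measurable
  also have "\<dots> = (\<integral>\<^sup>+ x. h x * (\<integral>\<^sup>+ y. g y \<partial>lborel) \<partial>lborel)"
  proof (rule nn_integral_cong)
    fix x
    have "(\<integral>\<^sup>+ y. g (u * x + y) * h (u * x) \<partial>lborel) = (\<integral>\<^sup>+ y. g (u * x + y) \<partial>lborel) * h (u * x)"
      by (rule nn_integral_multc) simp
    then show "(\<integral>\<^sup>+ y. g (u * x + y) * h (u * x) \<partial>lborel) = h x * (\<integral>\<^sup>+ y. g y \<partial>lborel)"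
      by (simp only: nn_integral_lborel_translate[OF g] hrot mult.commute)
  qed
  also have "\<dots> = V * (\<integral>\<^sup>+ y. g y \<partial>lborel)"
    by (simp add: nn_integral_multc V_def)
  finally show ?thesis using V by (simp add: ennreal_mult_cancel_left)
qed

lemma space_dA [simp]: "space dA = ball 0 1"
  by (simp add: dA_def)

lemma sets_dA: "sets dA = sets (lebesgue_on (ball 0 1))"
  by (simp add: dA_def)

lemma borel_measurable_dA_cong: "borel_measurable dA = borel_measurable (lebesgue_on (ball 0 1))"
  by (rule measurable_cong_sets) (simp_all add: sets_dA)

lemma borel_imp_measurable_dA: "g \<in> borel_measurable borel \<Longrightarrow> g \<in> borel_measurable dA"
  unfolding borel_measurable_dA_cong
  by (intro measurable_restrict_space1) (simp add: borel_measurable_if_I measurable_completion)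

lemma borel_sets_dA: "A \<in> sets borel \<Longrightarrow> A \<inter> ball 0 1 \<in> sets dA"
  unfolding sets_dA by (auto simp: sets_restrict_space)

lemma id_measurable_dA [measurable]: "(\<lambda>x. x) \<in> measurable dA borel"
  by (rule borel_imp_measurable_dA) simp

lemma nn_integral_dA_borel:
  assumes g[measurable]: "g \<in> borel_measurable borel"
  shows "(\<integral>\<^sup>+ w. g w \<partial>dA) = ennreal (1 / pi) * (\<integral>\<^sup>+ w. g w * indicator (ball 0 1) w \<partial>lborel)"
proof -
  have "g \<in> borel_measurable (lebesgue_on (ball 0 1))"
    using borel_imp_measurable_dA[OF g] by (simp add: borel_measurable_dA_cong)
  then have "(\<integral>\<^sup>+ w. g w \<partial>dA) = ennreal (1 / pi) * (\<integral>\<^sup>+ w. g w \<partial>lebesgue_on (ball 0 1))"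
    unfolding dA_def by (subst nn_integral_density) (auto simp: nn_integral_cmult)
  also have "(\<integral>\<^sup>+ w. g w \<partial>lebesgue_on (ball 0 1)) = (\<integral>\<^sup>+ w. g w * indicator (ball 0 1) w \<partial>lebesgue)"
    by (subst nn_integral_restrict_space) auto
  also have "\<dots> = (\<integral>\<^sup>+ w. g w * indicator (ball 0 1) w \<partial>lborel)"
    by (subst nn_integral_completion) auto
  finally show ?thesis .
qed

lemma nn_integral_dA_rotate:
  fixes g :: "complex \<Rightarrow> ennreal"
  assumes [measurable]: "g \<in> borel_measurable borel" and u: "cmod u = 1"
  shows "(\<integral>\<^sup>+ x. g (u * x) \<partial>dA) = (\<integral>\<^sup>+ x. g x \<partial>dA)"
proof -
  have "indicator (ball 0 1) x = (indicator (ball 0 1) (u * x) :: ennreal)" for x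
    by (simp add: indicator_def norm_mult u)
  then have "(\<integral>\<^sup>+ x. g (u * x) \<partial>dA) =
      ennreal (1 / pi) * (\<integral>\<^sup>+ x. g (u * x) * indicator (ball 0 1) (u * x) \<partial>lborel)"
    by (subst nn_integral_dA_borel) auto
  also have "\<dots> = (\<integral>\<^sup>+ x. g x \<partial>dA)"
    by (subst nn_integral_lborel_rotate[OF _ u, of "\<lambda>x. g x * indicator (ball 0 1) x"])
      (auto simp: nn_integral_dA_borel intro!: borel_measurable_times_ennreal borel_measurable_indicator)
  finally show ?thesis .
qed

lemma emeasure_dA_ball: "0 \<le> r \<Longrightarrow> r \<le> 1 \<Longrightarrow> emeasure dA (ball 0 r) = ennreal (r\<^sup>2)"
proof -
  assume r: "0 \<le> r" "r \<le> 1"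
  have "ball 0 r \<in> sets dA"
    using borel_sets_dA[of "ball 0 r"] r by (simp add: Int_absorb2 subset_ball)
  then have "emeasure dA (ball 0 r) = (\<integral>\<^sup>+ w. indicator (ball 0 r) w \<partial>dA)" by simp
  also have "\<dots> = ennreal (1 / pi) * (\<integral>\<^sup>+ w. indicator (ball (0::complex) r) w \<partial>lborel)"
    using r by (subst nn_integral_dA_borel)
      (auto intro!: borel_measurable_indicator arg_cong[where f = "(*) _"] nn_integral_cong
        simp del: nn_integral_indicator split: split_indicator)
  also have "(\<integral>\<^sup>+ w. indicator (ball (0::complex) r) w \<partial>lborel) = emeasure lborel (ball (0::complex) r)"
    by simp
  also have "\<dots> = ennreal (pi * r\<^sup>2)"
    using r by (simp add: emeasure_ball unit_ball_vol_2 ennreal_mult')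
  finally show ?thesis by (simp add: ennreal_mult'[symmetric])
qed

lemma emeasure_dA_space: "emeasure dA (space dA) = 1"
  using emeasure_dA_ball[of 1] by simp

interpretation dA: prob_space dA
  by standard (rule emeasure_dA_space)

text \<open>Under \<open>dA\<close> the variable \<open>defect\<close> is uniform on (0, 1), because
  the disc of radius r has normalized area r^2. Comparing distribution functions identifies the two
  laws. This is the radial half of polar coordinates.\<close>

lemma nn_integral_dA_radial:
  fixes \<phi> :: "real \<Rightarrow> ennreal"
  assumes [measurable]: "\<phi> \<in> borel_measurable borel"
  shows "(\<integral>\<^sup>+ w. \<phi> (defect w) \<partial>dA) = (\<integral>\<^sup>+ u. \<phi> u * indicator {0<..<1} u \<partial>lborel)"
proof -
  define X :: "complex \<Rightarrow> real" where "X = (\<lambda>w. defect w)"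
  have [measurable]: "X \<in> borel_measurable dA" unfolding X_def by measurable
  define U :: "real measure" where "U = uniform_measure lborel {0<..<1}"
  have pU: "prob_space U" unfolding U_def by (rule prob_space_uniform_measure) auto
  have rU: "real_distribution U"
    using pU by (intro real_distribution.intro real_distribution_axioms.intro) (auto simp: U_def)
  have "distr dA borel X = U"
  proof (rule cdf_unique)
    show "real_distribution (distr dA borel X)" by (rule dA.real_distribution_distr) simp
    show "real_distribution U" by fact
    show "cdf (distr dA borel X) = cdf U"
    proof
      fix x :: real
      have 1: "cdf (distr dA borel X) x = measure dA {w \<in> ball 0 1. X w \<le> x}"
        by (auto simp: cdf_def measure_distr vimage_def intro!: arg_cong[where f = "measure dA"])
      have 2: "cdf U x = measure lborel ({0<..<1} \<inter> {..x})"
        unfolding cdf_def U_def by (subst measure_uniform_measure) auto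
      show "cdf (distr dA borel X) x = cdf U x"
      proof (cases "x \<le> 0")
        case True
        have "{w \<in> ball 0 1. X w \<le> x} = {}"
        proof -
          have "X w > 0" if "w \<in> ball 0 1" for w
            using that by (simp add: X_def abs_square_less_1)
          then show ?thesis using True by fastforce
        qed
        moreover have "{0<..<1} \<inter> {..x} = {}" using True by auto
        ultimately show ?thesis unfolding 1 2 by (metis measure_empty)
      next
        case False
        \<comment> \<open>The \<open>max\<close> covers x \<ge> 1, where r = 0, the ball is empty
          and the sublevel set is the whole disc.\<close>
        define r where "r = sqrt (max 0 (1 - x))"
        have r: "0 \<le> r" "r \<le> 1" "r\<^sup>2 = max 0 (1 - x)"
          using False by (auto simp: r_def)
        have "{w \<in> ball 0 1. X w \<le> x} = space dA - ball 0 r"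
        proof -
          have "X w \<le> x \<longleftrightarrow> r \<le> cmod w" if "w \<in> ball 0 1" for w
          proof -
            have "r \<le> cmod w \<longleftrightarrow> r\<^sup>2 \<le> (cmod w)\<^sup>2" using r(1) by (simp add: power_mono_iff)
            also have "\<dots> \<longleftrightarrow> X w \<le> x" using r(3) zero_le_power2[of "cmod w"]
              by (simp add: X_def max_def split: if_splits del: zero_le_power2; linarith)
            finally show ?thesis by simp
          qed
          then show ?thesis by auto
        qed
        moreover have "ball 0 r \<in> sets dA"
          using borel_sets_dA[of "ball 0 r"] r by (simp add: Int_absorb2 subset_ball)
        moreover have "measure dA (ball 0 r) = r\<^sup>2"
          using emeasure_dA_ball[OF r(1,2)] by (simp add: measure_def)
        ultimately have "measure dA {w \<in> ball 0 1. X w \<le> x} = 1 - r\<^sup>2"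
          by (simp add: dA.prob_compl del: space_dA)
        moreover have "measure lborel ({0<..<1} \<inter> {..x}) = min x 1"
        proof (cases "x < 1")
          case True
          then have "{0<..<1} \<inter> {..x} = {0<..x}" by auto
          then show ?thesis using True False by simp
        next
          case False
          then have "{0<..<1} \<inter> {..x} = {0<..<1}" by auto
          then show ?thesis using False by simp
        qed
        ultimately show ?thesis unfolding 1 2 using r by (auto simp: max_def min_def)
      qed
    qed
  qed
  then have "(\<integral>\<^sup>+ u. \<phi> u \<partial>distr dA borel X) = (\<integral>\<^sup>+ u. \<phi> u \<partial>U)" by simp
  also have "\<dots> = (\<integral>\<^sup>+ u. \<phi> u * indicator {0<..<1} u \<partial>lborel)"
    unfolding U_def by (subst nn_integral_uniform_measure) (auto simp: divide_ennreal_def)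
  finally show ?thesis by (simp add: nn_integral_distr X_def)
qed

section \<open>Power integrals on half-lines and on circles\<close>

lemma nn_integral_powr_0:
  fixes h \<beta> :: real
  assumes "-1 < \<beta>" "0 \<le> h"
  shows "(\<integral>\<^sup>+ u. ennreal (u powr \<beta>) * indicator {0<..<h} u \<partial>lborel) = ennreal (h powr (\<beta> + 1) / (\<beta> + 1))"
proof -
  have "(\<integral>\<^sup>+ u. ennreal (u powr \<beta>) * indicator {0..h} u \<partial>lborel) = ennreal (h powr (\<beta> + 1) / (\<beta> + 1))"
    using assms by (intro nn_integral_has_integral_lebesgue' has_integral_powr_from_0) auto
  moreover have "AE u in lborel. ennreal (u powr \<beta>) * indicator {0<..<h} u = ennreal (u powr \<beta>) * indicator {0..h} u"
    using AE_lborel_singleton[of 0] AE_lborel_singleton[of h]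
    by eventually_elim (auto simp: indicator_def)
  ultimately show ?thesis by (simp cong: nn_integral_cong_AE)
qed

lemma nn_integral_powr_inf:
  fixes v \<gamma> :: real
  assumes "0 < \<gamma>" "0 < v"
  shows "(\<integral>\<^sup>+ u. ennreal (u powr (- 1 - \<gamma>)) * indicator {v..} u \<partial>lborel) = ennreal (v powr (- \<gamma>) / \<gamma>)"
proof -
  have "((\<lambda>u. u powr (- 1 - \<gamma>)) has_integral (v powr (- \<gamma>) / \<gamma>)) {v..}"
    using has_integral_powr_to_inf[of "- 1 - \<gamma>" v] assms by simp
  then show ?thesis
    by (intro nn_integral_has_integral_lebesgue') auto
qed

text \<open>The distance to 1 dominates the sum of the radial and the angular distance. For r < 1 /
  2 the term 1 - r alone is large enough. Otherwise the squared distance is (1 - r)^2 + 4 r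
  sin^2(\<psi> / 2), and the cubic Taylor bound gives sin y \<ge> y / 3 for y = |\<psi>| / 2, as y
  \<le> 2. The constant 12 is chosen to serve both cases and is not sharp.\<close>

lemma norm_one_minus_rcis_ge:
  assumes "0 \<le> r" "r < 1" "\<bar>\<psi>\<bar> \<le> pi"
  shows "cmod (1 - of_real r * cis \<psi>) \<ge> (1 - r + \<bar>\<psi>\<bar>) / 12"
proof (cases "r < 1 / 2")
  case True
  have "cmod (1 - of_real r * cis \<psi>) \<ge> cmod 1 - cmod (of_real r * cis \<psi>)"
    by (rule norm_triangle_ineq2)
  then have "cmod (1 - of_real r * cis \<psi>) \<ge> 1 - r" using assms by (simp add: norm_mult)
  then show ?thesis using True assms pi_less_4 by argo
next
  case False
  define y where "y = \<bar>\<psi>\<bar> / 2"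
  have y: "0 \<le> y" "y \<le> 2" using assms pi_less_4 by (auto simp: y_def)
  have "\<bar>sin y - (\<Sum>m<3. sin_coeff m * y ^ m)\<bar> \<le> inverse (fact 3) * \<bar>y\<bar> ^ 3"
    by (rule Maclaurin_sin_bound)
  then have "\<bar>sin y - y\<bar> \<le> y ^ 3 / 6"
    using y by (simp add: numeral_3_eq_3 sin_coeff_def fact_numeral)
  then have "sin y \<ge> y - y ^ 3 / 6" by linarith
  moreover have "y ^ 3 \<le> 4 * y"
    using mult_right_mono[OF power_mono[OF y(2,1), of 2] y(1)] by (simp add: power3_eq_cube power2_eq_square)
  ultimately have sin_y: "sin y \<ge> y / 3" by simp
  have "(cmod (1 - of_real r * cis \<psi>))\<^sup>2 = (1 - r * cos \<psi>)\<^sup>2 + (r * sin \<psi>)\<^sup>2"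
    by (simp add: cmod_power2 cis.ctr)
  also have "\<dots> = (1 - r)\<^sup>2 + 2 * r * (1 - cos (2 * y))"
  proof -
    have "(r * cos \<psi>)\<^sup>2 + (r * sin \<psi>)\<^sup>2 = r\<^sup>2"
      by (simp add: power_mult_distrib flip: distrib_left)
    moreover have "cos (2 * y) = cos \<psi>" by (simp add: y_def)
    ultimately show ?thesis by (simp add: power2_eq_square algebra_simps)
  qed
  also have "\<dots> = (1 - r)\<^sup>2 + 4 * r * (sin y)\<^sup>2"
    by (subst cos_double_sin) simp
  also have "\<dots> \<ge> (1 - r)\<^sup>2 + 2 * (y / 3)\<^sup>2"
  proof -
    have "(y / 3)\<^sup>2 \<le> (sin y)\<^sup>2" using sin_y y by (intro power_mono) auto
    then show ?thesis using False by (intro add_left_mono mult_mono) auto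
  qed
  also have "(1 - r)\<^sup>2 + 2 * (y / 3)\<^sup>2 \<ge> ((1 - r + \<bar>\<psi>\<bar>) / 12)\<^sup>2"
  proof -
    have "(1 - r + \<bar>\<psi>\<bar>)\<^sup>2 \<le> 2 * (1 - r)\<^sup>2 + 2 * \<bar>\<psi>\<bar>\<^sup>2"
      using sum_squares_bound[of "1 - r" "\<bar>\<psi>\<bar>"] by (simp add: power2_sum)
    moreover have "0 \<le> (1 - r)\<^sup>2" "0 \<le> \<bar>\<psi>\<bar>\<^sup>2" by simp_all
    moreover have "((1 - r + \<bar>\<psi>\<bar>) / 12)\<^sup>2 = (1 - r + \<bar>\<psi>\<bar>)\<^sup>2 / 144" "(y / 3)\<^sup>2 = \<bar>\<psi>\<bar>\<^sup>2 / 36"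
      by (simp_all add: y_def power_divide)
    ultimately show ?thesis by linarith
  qed
  finally show ?thesis by (rule power2_le_imp_le) simp
qed

lemma nn_integral_abs_powr_le:
  fixes e s \<sigma> :: real
  assumes "1 < \<sigma>" "0 < e"
  shows "(\<integral>\<^sup>+ t. ennreal ((e + \<bar>t + s\<bar>) powr - \<sigma>) \<partial>lborel) \<le> ennreal (2 / (\<sigma> - 1) * e powr (1 - \<sigma>))"
proof -
  let ?g = "\<lambda>u. ennreal (u powr (- 1 - (\<sigma> - 1))) * indicator {e..} u"
  have "(\<integral>\<^sup>+ t. ennreal ((e + \<bar>t + s\<bar>) powr - \<sigma>) \<partial>lborel) = (\<integral>\<^sup>+ t. ennreal ((e + \<bar>t\<bar>) powr - \<sigma>) \<partial>lborel)"
    by (subst nn_integral_lborel_translate[of _ "- s", symmetric]) auto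
  also have "\<dots> \<le> (\<integral>\<^sup>+ t. ?g (e + t) + ?g (e - t) \<partial>lborel)"
    by (intro nn_integral_mono) (auto simp: indicator_def abs_if)
  also have "\<dots> = (\<integral>\<^sup>+ t. ?g (e + t) \<partial>lborel) + (\<integral>\<^sup>+ t. ?g (e - t) \<partial>lborel)"
    by (intro nn_integral_add) auto
  also have "(\<integral>\<^sup>+ t. ?g (e + t) \<partial>lborel) = (\<integral>\<^sup>+ t. ?g t \<partial>lborel)"
    by (rule nn_integral_lborel_translate) auto
  also have "(\<integral>\<^sup>+ t. ?g (e - t) \<partial>lborel) = (\<integral>\<^sup>+ t. ?g t \<partial>lborel)"
    using nn_integral_real_affine[of ?g "-1" e] by simp
  also have "(\<integral>\<^sup>+ t. ?g t \<partial>lborel) = ennreal (e powr (- (\<sigma> - 1)) / (\<sigma> - 1))"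
    using assms by (intro nn_integral_powr_inf) auto
  also have "\<dots> + \<dots> = ennreal (2 / (\<sigma> - 1) * e powr (1 - \<sigma>))"
    using assms by (simp add: ennreal_plus[symmetric] del: ennreal_plus)
  finally show ?thesis .
qed

text \<open>The power of 12 is the loss in \<open>norm_one_minus_rcis_ge\<close>. The 4 counts two
  branches of the angle with two half-lines each.\<close>

definition circ_const :: "real \<Rightarrow> real" where
  "circ_const \<sigma> = 12 powr \<sigma> * 4 / (\<sigma> - 1)"

lemma circle_integral_le:
  fixes \<sigma> :: real
  assumes \<sigma>: "1 < \<sigma>" and x: "cmod x < 1"
  shows "(\<integral>\<^sup>+ t. ennreal (cmod (1 - x * cis t) powr - \<sigma>) * indicator {0..2 * pi} t \<partial>lborel)
    \<le> ennreal (circ_const \<sigma> * (1 - cmod x) powr (1 - \<sigma>))"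
proof -
  define r where "r = cmod x"
  define \<tau> where "\<tau> = Arg x"
  have r: "0 \<le> r" "r < 1" using x by (auto simp: r_def)
  have x_eq: "x = of_real r * cis \<tau>" unfolding r_def \<tau>_def by (metis rcis_cmod_Arg rcis_def)
  have \<tau>: "- pi < \<tau>" "\<tau> \<le> pi" unfolding \<tau>_def by (auto simp: mpi_less_Arg Arg_le_pi)
  \<comment> \<open>For t in [0, 2 pi] the angle t + \<tau> may exceed pi, outside the range of the
    lower bound, and is then shifted by 2 pi. Adding the majorants for both shifts avoids splitting
    the integral.\<close>
  let ?b = "\<lambda>s t. 12 powr \<sigma> * (1 - r + \<bar>t + s\<bar>) powr - \<sigma>"
  have pt: "cmod (1 - of_real r * cis \<psi>) powr - \<sigma> \<le> 12 powr \<sigma> * (1 - r + \<bar>\<psi>\<bar>) powr - \<sigma>" if "\<bar>\<psi>\<bar> \<le> pi" for \<psi>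
  proof -
    have "cmod (1 - of_real r * cis \<psi>) powr - \<sigma> \<le> ((1 - r + \<bar>\<psi>\<bar>) / 12) powr - \<sigma>"
      using norm_one_minus_rcis_ge[OF r that] r \<sigma> by (intro powr_mono2') auto
    also have "\<dots> = 12 powr \<sigma> * (1 - r + \<bar>\<psi>\<bar>) powr - \<sigma>"
      using r by (simp add: powr_divide powr_minus divide_simps)
    finally show ?thesis .
  qed
  have "(\<integral>\<^sup>+ t. ennreal (cmod (1 - x * cis t) powr - \<sigma>) * indicator {0..2 * pi} t \<partial>lborel)
      \<le> (\<integral>\<^sup>+ t. ennreal (?b \<tau> t) + ennreal (?b (\<tau> - 2 * pi) t) \<partial>lborel)"
  proof (intro nn_integral_mono)
    fix t :: real
    show "ennreal (cmod (1 - x * cis t) powr - \<sigma>) * indicator {0..2 * pi} t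
      \<le> ennreal (?b \<tau> t) + ennreal (?b (\<tau> - 2 * pi) t)"
    proof (cases "t \<in> {0..2 * pi}")
      case True
      have eq: "x * cis t = of_real r * cis (t + \<tau>)" by (simp add: x_eq cis_mult add.commute)
      have eq2: "x * cis t = of_real r * cis (t + (\<tau> - 2 * pi))"
        unfolding eq by (simp add: cis.ctr algebra_simps sin_diff cos_diff complex_eq_iff sin_add cos_add)
      show ?thesis
      proof (cases "t + \<tau> \<le> pi")
        case True
        then have "cmod (1 - x * cis t) powr - \<sigma> \<le> ?b \<tau> t"
          using pt[of "t + \<tau>"] \<tau> \<open>t \<in> _\<close> unfolding eq by auto
        then show ?thesis
          using \<open>t \<in> _\<close> by (simp add: add_increasing2 ennreal_leI)
      next
        case False
        then have "cmod (1 - x * cis t) powr - \<sigma> \<le> ?b (\<tau> - 2 * pi) t"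
          using pt[of "t + (\<tau> - 2 * pi)"] \<tau> \<open>t \<in> _\<close> unfolding eq2 by auto
        then show ?thesis
          using \<open>t \<in> _\<close> by (simp add: add_increasing ennreal_leI)
      qed
    qed simp
  qed
  also have "\<dots> = (\<integral>\<^sup>+ t. ennreal (?b \<tau> t) \<partial>lborel) + (\<integral>\<^sup>+ t. ennreal (?b (\<tau> - 2 * pi) t) \<partial>lborel)"
    by (intro nn_integral_add) auto
  also have "\<dots> \<le> ennreal (12 powr \<sigma>) * ennreal (2 / (\<sigma> - 1) * (1 - r) powr (1 - \<sigma>))
      + ennreal (12 powr \<sigma>) * ennreal (2 / (\<sigma> - 1) * (1 - r) powr (1 - \<sigma>))"
    using nn_integral_abs_powr_le[OF \<sigma>, of "1 - r"] r
    by (intro add_mono) (simp_all add: ennreal_mult' nn_integral_cmult mult_left_mono)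
  also have "\<dots> = ennreal (circ_const \<sigma> * (1 - cmod x) powr (1 - \<sigma>))"
    using \<sigma> by (simp add: circ_const_def r_def ennreal_mult'[symmetric] ennreal_plus[symmetric] algebra_simps
        del: ennreal_plus)
  finally show ?thesis .
qed

section \<open>Integrals of the kernel\<close>

interpretation dA_lborel: pair_sigma_finite dA "lborel :: real measure" ..
interpretation dA_dA: pair_sigma_finite dA dA ..

lemma cis_measurable [measurable]: "cis \<in> borel_measurable borel"
  by (intro borel_measurable_continuous_onI continuous_intros)

lemma cnj_measurable [measurable]: "cnj \<in> borel_measurable borel"
  by (intro borel_measurable_continuous_onI continuous_intros)

lemma cmod_one_minus_ge:
  assumes "cmod z < 1" "cmod w < 1"
  shows "defect z / 2 \<le> cmod (1 - z * cnj w)" "defect w / 2 \<le> cmod (1 - z * cnj w)"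
    "max (defect w) (defect z) / 2 \<le> 1 - cmod (z * cnj w)"
proof -
  have aux: "(1 - x\<^sup>2) / 2 \<le> 1 - x" if "0 \<le> x" "x < 1" for x :: real
    using zero_le_power2[of "1 - x"] by (simp add: power2_diff; linarith)
  have "cmod z * cmod w \<le> cmod z" "cmod z * cmod w \<le> cmod w"
    using assms by (auto intro: mult_left_le mult_left_le_one_le)
  moreover have "1 - cmod z * cmod w \<le> cmod (1 - z * cnj w)"
    using norm_triangle_ineq2[of 1 "z * cnj w"] by (simp add: norm_mult)
  ultimately show "defect z / 2 \<le> cmod (1 - z * cnj w)"
    "defect w / 2 \<le> cmod (1 - z * cnj w)"
    "max (defect w) (defect z) / 2 \<le> 1 - cmod (z * cnj w)"
    using aux[of "cmod z"] aux[of "cmod w"] assms by (auto simp: norm_mult max_def)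
qed

lemma one_minus_cmod_sq_pos: "cmod z < 1 \<Longrightarrow> 0 < defect z"
  by (simp add: abs_square_less_1)

text \<open>Averaging over rotations of \<open>w\<close> replaces polar coordinates.\<close>

lemma kernel_integral_le:
  fixes \<phi> :: "real \<Rightarrow> ennreal" and \<sigma> :: real
  assumes [measurable]: "\<phi> \<in> borel_measurable borel" and \<sigma>: "1 < \<sigma>" and z: "cmod z < 1"
  defines "v \<equiv> defect z"
  shows "(\<integral>\<^sup>+ w. \<phi> (defect w) * ennreal (cmod (1 - z * cnj w) powr - \<sigma>) \<partial>dA)
    \<le> ennreal (circ_const \<sigma> * 2 powr (\<sigma> - 1)) *
       (\<integral>\<^sup>+ u. \<phi> u * ennreal (max u v powr (1 - \<sigma>)) * indicator {0<..<1} u \<partial>lborel)"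
    (is "?I \<le> _ * ?J")
proof -
  let ?g = "\<lambda>w. \<phi> (defect w) * ennreal (cmod (1 - z * cnj w) powr - \<sigma>)"
  let ?K = "\<lambda>w t. \<phi> (defect w) * (ennreal (cmod (1 - (z * cnj w) * cis t) powr - \<sigma>) * indicator {0..2 * pi} t)"
  have rot: "(\<integral>\<^sup>+ w. ?g (cis (- t) * w) \<partial>dA) = ?I" for t
    by (rule nn_integral_dA_rotate) auto
  \<comment> \<open>A true average over rotations would carry the factor 1 / (2 pi). For an upper
    bound it may be dropped, so \<open>?I\<close> is simply integrated over t in [0, 2 pi].\<close>
  have "?I \<le> ennreal (2 * pi) * ?I"
  proof -
    have "ennreal 1 \<le> ennreal (2 * pi)" using pi_gt3 by (intro ennreal_leI) auto
    then have "ennreal 1 * ?I \<le> ennreal (2 * pi) * ?I" by (intro mult_right_mono) auto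
    then show ?thesis by simp
  qed
  also have "\<dots> = (\<integral>\<^sup>+ t. ?I * indicator {0..2 * pi} t \<partial>lborel)"
    by (subst nn_integral_cmult) (auto simp: mult.commute)
  also have "\<dots> = (\<integral>\<^sup>+ t. (\<integral>\<^sup>+ w. ?K w t \<partial>dA) \<partial>lborel)"
  proof (rule nn_integral_cong)
    fix t :: real
    have "?I * indicator {0..2 * pi} t = (\<integral>\<^sup>+ w. ?g (cis (- t) * w) * indicator {0..2 * pi} t \<partial>dA)"
      unfolding rot[of t, symmetric] by (rule nn_integral_multc[symmetric]) measurable
    also have "\<dots> = (\<integral>\<^sup>+ w. ?K w t \<partial>dA)"
      by (rule nn_integral_cong) (simp add: norm_mult cis_cnj mult_ac)
    finally show "?I * indicator {0..2 * pi} t = (\<integral>\<^sup>+ w. ?K w t \<partial>dA)" .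
  qed
  also have "\<dots> = (\<integral>\<^sup>+ w. (\<integral>\<^sup>+ t. ?K w t \<partial>lborel) \<partial>dA)"
    by (rule dA_lborel.Fubini') measurable
  also have "\<dots> \<le> (\<integral>\<^sup>+ w. \<phi> (defect w) *
      ennreal (circ_const \<sigma> * 2 powr (\<sigma> - 1) * max (defect w) v powr (1 - \<sigma>)) \<partial>dA)"
  proof (rule nn_integral_mono)
    fix w assume "w \<in> space dA"
    then have w: "cmod w < 1" by simp
    have x1: "cmod (z * cnj w) < 1"
      using cmod_one_minus_ge(3)[OF z w] one_minus_cmod_sq_pos[OF z] by auto
    have pos: "0 < max (defect w) v" using one_minus_cmod_sq_pos[OF z] by (simp add: v_def)
    have "(\<integral>\<^sup>+ t. ?K w t \<partial>lborel) = \<phi> (defect w) *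
        (\<integral>\<^sup>+ t. ennreal (cmod (1 - (z * cnj w) * cis t) powr - \<sigma>) * indicator {0..2 * pi} t \<partial>lborel)"
      by (rule nn_integral_cmult) measurable
    also have "\<dots> \<le> \<phi> (defect w) *
        ennreal (circ_const \<sigma> * (1 - cmod (z * cnj w)) powr (1 - \<sigma>))"
      by (intro mult_left_mono circle_integral_le \<sigma> x1) simp
    also have "\<dots> \<le> \<phi> (defect w) *
      ennreal (circ_const \<sigma> * 2 powr (\<sigma> - 1) * max (defect w) v powr (1 - \<sigma>))"
    proof (intro mult_left_mono ennreal_leI)
      have "(1 - cmod (z * cnj w)) powr (1 - \<sigma>) \<le> (max (defect w) v / 2) powr (1 - \<sigma>)"
        using cmod_one_minus_ge(3)[OF z w] pos \<sigma> by (intro powr_mono2') (auto simp: v_def)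
      also have "\<dots> = 2 powr (\<sigma> - 1) * max (defect w) v powr (1 - \<sigma>)"
        using pos by (simp add: powr_divide powr_diff divide_simps)
      finally show "circ_const \<sigma> * (1 - cmod (z * cnj w)) powr (1 - \<sigma>)
         \<le> circ_const \<sigma> * 2 powr (\<sigma> - 1) * max (defect w) v powr (1 - \<sigma>)"
        using \<sigma> by (simp add: circ_const_def divide_simps mult_left_mono mult.assoc)
    qed auto
    finally show "(\<integral>\<^sup>+ t. ?K w t \<partial>lborel) \<le> \<phi> (defect w) *
      ennreal (circ_const \<sigma> * 2 powr (\<sigma> - 1) * max (defect w) v powr (1 - \<sigma>))" .
  qed
  also have "\<dots> = (\<integral>\<^sup>+ u. \<phi> u * ennreal (circ_const \<sigma> * 2 powr (\<sigma> - 1) * max u v powr (1 - \<sigma>)) *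
      indicator {0<..<1} u \<partial>lborel)"
    by (rule nn_integral_dA_radial) measurable
  also have "\<dots> = (\<integral>\<^sup>+ u. ennreal (circ_const \<sigma> * 2 powr (\<sigma> - 1)) *
      (\<phi> u * ennreal (max u v powr (1 - \<sigma>)) * indicator {0<..<1} u) \<partial>lborel)"
    by (intro nn_integral_cong)
      (subst ennreal_mult''[OF powr_ge_zero, of _ "max _ v"], simp only: mult_ac)
  also have "\<dots> = ennreal (circ_const \<sigma> * 2 powr (\<sigma> - 1)) * ?J"
    by (rule nn_integral_cmult) measurable
  finally show ?thesis .
qed

text \<open>After the reduction to one variable the integral splits at u = v. Below v the maximum is
  v and \<beta> > -1 gives convergence at 0. Above v the integrand is u^(-1-\<gamma>), which
  converges at infinity because \<gamma> > 0. Both pieces scale like v^(-\<gamma>).\<close>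

lemma forelli_rudin:
  fixes \<beta> \<gamma> :: real
  assumes \<beta>: "-1 < \<beta>" and \<gamma>: "0 < \<gamma>"
  obtains C where "0 < C" "\<And>z. cmod z < 1 \<Longrightarrow>
    (\<integral>\<^sup>+ w. ennreal (defect w powr \<beta> * cmod (1 - z * cnj w) powr - (2 + \<beta> + \<gamma>)) \<partial>dA)
      \<le> ennreal (C * defect z powr - \<gamma>)"
proof -
  define \<sigma> where "\<sigma> = 2 + \<beta> + \<gamma>"
  have \<sigma>: "1 < \<sigma>" using assms by (simp add: \<sigma>_def)
  define D where "D = circ_const \<sigma> * 2 powr (\<sigma> - 1)"
  have D: "0 < D" using \<sigma> by (simp add: D_def circ_const_def)
  show ?thesis
  proof (rule that[of "D * (1 / (\<beta> + 1) + 1 / \<gamma>)"])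
    show "0 < D * (1 / (\<beta> + 1) + 1 / \<gamma>)" using D assms by (intro mult_pos_pos add_pos_pos) auto
    fix z :: complex assume z: "cmod z < 1"
    define v where "v = defect z"
    have v: "0 < v" using one_minus_cmod_sq_pos[OF z] by (simp add: v_def)
    have "(\<integral>\<^sup>+ w. ennreal (defect w powr \<beta> * cmod (1 - z * cnj w) powr - (2 + \<beta> + \<gamma>)) \<partial>dA)
       = (\<integral>\<^sup>+ w. ennreal (defect w powr \<beta>) * ennreal (cmod (1 - z * cnj w) powr - \<sigma>) \<partial>dA)"
      by (simp add: ennreal_mult \<sigma>_def)
    also have "\<dots> \<le> ennreal D * (\<integral>\<^sup>+ u. ennreal (u powr \<beta>) * ennreal (max u v powr (1 - \<sigma>)) * indicator {0<..<1} u \<partial>lborel)"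
      unfolding D_def v_def by (rule kernel_integral_le[OF _ \<sigma> z]) measurable
    also have "(\<integral>\<^sup>+ u. ennreal (u powr \<beta>) * ennreal (max u v powr (1 - \<sigma>)) * indicator {0<..<1} u \<partial>lborel)
      \<le> (\<integral>\<^sup>+ u. ennreal (v powr (1 - \<sigma>)) * (ennreal (u powr \<beta>) * indicator {0<..<v} u)
            + ennreal (u powr (- 1 - \<gamma>)) * indicator {v..} u \<partial>lborel)"
    proof (rule nn_integral_mono)
      fix u :: real
      have "u powr \<beta> * u powr (1 - \<sigma>) = u powr (- 1 - \<gamma>)" if "0 < u"
      proof -
        have "\<beta> + (1 - \<sigma>) = - 1 - \<gamma>" by (simp add: \<sigma>_def)
        then show ?thesis by (simp only: powr_add[symmetric])
      qed
      then show "ennreal (u powr \<beta>) * ennreal (max u v powr (1 - \<sigma>)) * indicator {0<..<1} u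
        \<le> ennreal (v powr (1 - \<sigma>)) * (ennreal (u powr \<beta>) * indicator {0<..<v} u)
            + ennreal (u powr (- 1 - \<gamma>)) * indicator {v..} u"
        by (auto simp: indicator_def max_def mult.commute simp flip: ennreal_mult)
    qed
    also have "\<dots> = ennreal (v powr (1 - \<sigma>)) * (\<integral>\<^sup>+ u. ennreal (u powr \<beta>) * indicator {0<..<v} u \<partial>lborel)
            + (\<integral>\<^sup>+ u. ennreal (u powr (- 1 - \<gamma>)) * indicator {v..} u \<partial>lborel)"
      by (subst nn_integral_add) (auto simp: nn_integral_cmult)
    also have "\<dots> = ennreal (v powr (1 - \<sigma>) * (v powr (\<beta> + 1) / (\<beta> + 1)) + v powr - \<gamma> / \<gamma>)"
      using assms v by (simp add: nn_integral_powr_0 nn_integral_powr_inf flip: ennreal_mult ennreal_plus)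
    also have "v powr (1 - \<sigma>) * (v powr (\<beta> + 1) / (\<beta> + 1)) + v powr - \<gamma> / \<gamma> = (1 / (\<beta> + 1) + 1 / \<gamma>) * v powr - \<gamma>"
    proof -
      have "v powr (1 - \<sigma>) * v powr (\<beta> + 1) = v powr - \<gamma>"
        using v by (simp add: \<sigma>_def flip: powr_add)
      then show ?thesis by (simp add: algebra_simps)
    qed
    finally show "(\<integral>\<^sup>+ w. ennreal (defect w powr \<beta> * cmod (1 - z * cnj w) powr - (2 + \<beta> + \<gamma>)) \<partial>dA)
      \<le> ennreal (D * (1 / (\<beta> + 1) + 1 / \<gamma>) * defect z powr - \<gamma>)"
      using D by (simp add: v_def ennreal_mult' mult_left_mono mult.assoc)
  qed
qed

text \<open>With \<open>\<alpha> = a + \<delta>\<close> and \<open>\<delta> = c - a - b - 2\<close>, the kernel of \<open>S\<close> is \<open>defect z powr - \<delta> * hker \<alpha> b z w\<close>.\<close>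

definition hker :: "real \<Rightarrow> real \<Rightarrow> complex \<Rightarrow> complex \<Rightarrow> real" where
  "hker \<alpha> b z w = defect z powr \<alpha> * defect w powr b * cmod (1 - z * cnj w) powr - (2 + \<alpha> + b)"

lemma hker_nonneg: "0 \<le> hker \<alpha> b z w"
  by (simp add: hker_def)

text \<open>Replacing \<open>max u v\<close> by v only increases the integrand, as its exponent is
  negative. By homogeneity all powers of v then cancel, and only the cut ratio remains. The bound is
  crude for large \<rho> but holds for every \<rho>.\<close>

lemma hker_near_integral:
  fixes \<alpha> b :: real
  assumes \<alpha>: "0 \<le> \<alpha>" and b: "-1 < b"
  obtains C where "0 < C" "\<And>z \<rho>. cmod z < 1 \<Longrightarrow> 0 < \<rho> \<Longrightarrow>
    (\<integral>\<^sup>+ w. ennreal (hker \<alpha> b z w) * indicator {w. defect w < \<rho> * defect z} w \<partial>dA)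
      \<le> ennreal (C * \<rho> powr (b + 1))"
proof -
  define \<sigma> where "\<sigma> = 2 + \<alpha> + b"
  have \<sigma>: "1 < \<sigma>" using assms by (simp add: \<sigma>_def)
  define D where "D = circ_const \<sigma> * 2 powr (\<sigma> - 1)"
  have D: "0 < D" using \<sigma> by (simp add: D_def circ_const_def)
  show ?thesis
  proof (rule that[of "D / (b + 1)"])
    show "0 < D / (b + 1)" using D assms by simp
    fix z :: complex and \<rho> :: real assume z: "cmod z < 1" and \<rho>: "0 < \<rho>"
    define v where "v = defect z"
    have v: "0 < v" using one_minus_cmod_sq_pos[OF z] by (simp add: v_def)
    let ?\<phi> = "\<lambda>u. ennreal (v powr \<alpha>) * (ennreal (u powr b) * indicator {u. u < \<rho> * v} u)"
    have "(\<integral>\<^sup>+ w. ennreal (hker \<alpha> b z w) * indicator {w. defect w < \<rho> * defect z} w \<partial>dA)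
       = (\<integral>\<^sup>+ w. ?\<phi> (defect w) * ennreal (cmod (1 - z * cnj w) powr - \<sigma>) \<partial>dA)"
      by (intro nn_integral_cong) (simp add: hker_def \<sigma>_def ennreal_mult v_def indicator_def)
    also have "\<dots> \<le> ennreal D * (\<integral>\<^sup>+ u. ?\<phi> u * ennreal (max u v powr (1 - \<sigma>)) * indicator {0<..<1} u \<partial>lborel)"
      unfolding D_def v_def by (rule kernel_integral_le[OF _ \<sigma> z]) measurable
    also have "(\<integral>\<^sup>+ u. ?\<phi> u * ennreal (max u v powr (1 - \<sigma>)) * indicator {0<..<1} u \<partial>lborel)
      \<le> (\<integral>\<^sup>+ u. ennreal (v powr (\<alpha> + 1 - \<sigma>)) * (ennreal (u powr b) * indicator {0<..<\<rho> * v} u) \<partial>lborel)"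
    proof (rule nn_integral_mono)
      fix u :: real
      have "max u v powr (1 - \<sigma>) \<le> v powr (1 - \<sigma>)" using v \<sigma> by (intro powr_mono2') auto
      then have "v powr \<alpha> * u powr b * max u v powr (1 - \<sigma>) \<le> v powr (\<alpha> + 1 - \<sigma>) * u powr b"
      proof -
        have "v powr \<alpha> * u powr b * max u v powr (1 - \<sigma>) \<le> v powr \<alpha> * u powr b * v powr (1 - \<sigma>)"
          using \<open>max u v powr (1 - \<sigma>) \<le> v powr (1 - \<sigma>)\<close> by (intro mult_left_mono) auto
        also have "\<dots> = v powr (\<alpha> + (1 - \<sigma>)) * u powr b" by (simp add: powr_add)
        finally show ?thesis by (simp add: add_diff_eq)
      qed
      then show "?\<phi> u * ennreal (max u v powr (1 - \<sigma>)) * indicator {0<..<1} u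
        \<le> ennreal (v powr (\<alpha> + 1 - \<sigma>)) * (ennreal (u powr b) * indicator {0<..<\<rho> * v} u)"
        by (auto simp: indicator_def ennreal_leI simp flip: ennreal_mult)
    qed
    also have "\<dots> = ennreal (v powr (\<alpha> + 1 - \<sigma>) * ((\<rho> * v) powr (b + 1) / (b + 1)))"
      using b \<rho> v by (subst nn_integral_cmult) (auto simp: nn_integral_powr_0 simp flip: ennreal_mult)
    also have "v powr (\<alpha> + 1 - \<sigma>) * ((\<rho> * v) powr (b + 1) / (b + 1)) = \<rho> powr (b + 1) / (b + 1)"
    proof -
      have "v powr (\<alpha> + 1 - \<sigma>) * v powr (b + 1) = 1"
        using v by (simp add: \<sigma>_def flip: powr_add)
      then show ?thesis using \<rho> v by (simp add: powr_mult algebra_simps)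
    qed
    finally show "(\<integral>\<^sup>+ w. ennreal (hker \<alpha> b z w) * indicator {w. defect w < \<rho> * defect z} w \<partial>dA)
      \<le> ennreal (D / (b + 1) * \<rho> powr (b + 1))"
      using D by (simp add: ennreal_mult'[symmetric] mult_left_mono mult.assoc)
  qed
qed

lemma cmod_one_minus_commute: "cmod (1 - z * cnj w) = cmod (1 - w * cnj z)"
proof -
  have "1 - w * cnj z = cnj (1 - z * cnj w)" by (simp add: mult.commute)
  then show ?thesis by (simp only: complex_mod_cnj)
qed

text \<open>Here z is the variable of integration. The factor \<open>defect z powr \<alpha>\<close>
  is absorbed by |1 - w cnj z|^\<alpha> and lowers the kernel exponent to 2 + b. What remains is
  v^(-1-b) on 0 < v \<le> u / \<rho>, integrable at 0 exactly because b < 0.\<close>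

lemma hker_far_integral:
  fixes \<alpha> b :: real
  assumes \<alpha>: "0 \<le> \<alpha>" and b: "-1 < b" "b < 0"
  obtains C where "0 < C" "\<And>w \<rho>. cmod w < 1 \<Longrightarrow> 0 < \<rho> \<Longrightarrow>
    (\<integral>\<^sup>+ z. ennreal (hker \<alpha> b z w) * indicator {z. \<rho> * defect z \<le> defect w} z \<partial>dA)
      \<le> ennreal (C * \<rho> powr b)"
proof -
  define \<sigma> where "\<sigma> = 2 + b"
  have \<sigma>: "1 < \<sigma>" using assms by (simp add: \<sigma>_def)
  define D where "D = circ_const \<sigma> * 2 powr (\<sigma> - 1)"
  have D: "0 < D" using \<sigma> by (simp add: D_def circ_const_def)
  show ?thesis
  proof (rule that[of "2 powr \<alpha> * D / (- b)"])
    show "0 < 2 powr \<alpha> * D / (- b)" using D assms by (intro divide_pos_pos) auto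
    fix w :: complex and \<rho> :: real assume w: "cmod w < 1" and \<rho>: "0 < \<rho>"
    define u where "u = defect w"
    have u: "0 < u" using one_minus_cmod_sq_pos[OF w] by (simp add: u_def)
    let ?\<phi> = "\<lambda>v. ennreal (2 powr \<alpha> * u powr b) * indicator {v. \<rho> * v \<le> u} v"
    have "(\<integral>\<^sup>+ z. ennreal (hker \<alpha> b z w) * indicator {z. \<rho> * defect z \<le> defect w} z \<partial>dA)
       \<le> (\<integral>\<^sup>+ z. ?\<phi> (defect z) * ennreal (cmod (1 - w * cnj z) powr - \<sigma>) \<partial>dA)"
    proof (rule nn_integral_mono)
      fix z assume "z \<in> space dA"
      then have z: "cmod z < 1" by simp
      have pos: "0 < cmod (1 - w * cnj z)"
        by (rule less_le_trans[OF _ cmod_one_minus_ge(1)[OF w z]]) (use u in \<open>simp add: u_def\<close>)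
      have "defect z powr \<alpha> \<le> (2 * cmod (1 - w * cnj z)) powr \<alpha>"
        using cmod_one_minus_ge(2)[OF w z] one_minus_cmod_sq_pos[OF z] \<alpha> by (intro powr_mono2) auto
      also have "\<dots> = 2 powr \<alpha> * cmod (1 - w * cnj z) powr \<alpha>" by (simp add: powr_mult)
      finally have "hker \<alpha> b z w \<le> (2 powr \<alpha> * cmod (1 - w * cnj z) powr \<alpha>) * u powr b * cmod (1 - w * cnj z) powr - (2 + \<alpha> + b)"
        unfolding hker_def cmod_one_minus_commute[of z w] u_def
        by (intro mult_right_mono) auto
      also have "\<dots> = 2 powr \<alpha> * u powr b * (cmod (1 - w * cnj z) powr \<alpha> * cmod (1 - w * cnj z) powr - (2 + \<alpha> + b))"
        by simp
      also have "cmod (1 - w * cnj z) powr \<alpha> * cmod (1 - w * cnj z) powr - (2 + \<alpha> + b) = cmod (1 - w * cnj z) powr - \<sigma>"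
        using pos by (simp add: \<sigma>_def flip: powr_add)
      finally show "ennreal (hker \<alpha> b z w) * indicator {z. \<rho> * defect z \<le> defect w} z
         \<le> ?\<phi> (defect z) * ennreal (cmod (1 - w * cnj z) powr - \<sigma>)"
        by (auto simp: indicator_def u_def ennreal_leI simp flip: ennreal_mult)
    qed
    also have "\<dots> \<le> ennreal D * (\<integral>\<^sup>+ v. ?\<phi> v * ennreal (max v u powr (1 - \<sigma>)) * indicator {0<..<1} v \<partial>lborel)"
      unfolding D_def u_def by (rule kernel_integral_le[OF _ \<sigma> w]) measurable
    also have "(\<integral>\<^sup>+ v. ?\<phi> v * ennreal (max v u powr (1 - \<sigma>)) * indicator {0<..<1} v \<partial>lborel)
      \<le> (\<integral>\<^sup>+ v. ennreal (2 powr \<alpha> * u powr b) * (ennreal (v powr (1 - \<sigma>)) * indicator {0<..u / \<rho>} v) \<partial>lborel)"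
    proof (rule nn_integral_mono)
      fix v :: real
      have "max v u powr (1 - \<sigma>) \<le> v powr (1 - \<sigma>)" if "0 < v" using that \<sigma> by (intro powr_mono2') auto
      then show "?\<phi> v * ennreal (max v u powr (1 - \<sigma>)) * indicator {0<..<1} v
        \<le> ennreal (2 powr \<alpha> * u powr b) * (ennreal (v powr (1 - \<sigma>)) * indicator {0<..u / \<rho>} v)"
        using \<rho> by (auto simp: indicator_def mult_left_mono ennreal_leI field_simps simp flip: ennreal_mult)
    qed
    also have "\<dots> = ennreal (2 powr \<alpha> * u powr b) * (\<integral>\<^sup>+ v. ennreal (v powr (1 - \<sigma>)) * indicator {0<..<u / \<rho>} v \<partial>lborel)"
    proof -
      have "(\<integral>\<^sup>+ v. ennreal (v powr (1 - \<sigma>)) * indicator {0<..u / \<rho>} v \<partial>lborel)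
         = (\<integral>\<^sup>+ v. ennreal (v powr (1 - \<sigma>)) * indicator {0<..<u / \<rho>} v \<partial>lborel)"
        by (rule nn_integral_cong_AE) (use AE_lborel_singleton[of "u / \<rho>"] in \<open>eventually_elim, auto simp: indicator_def\<close>)
      then show ?thesis by (subst nn_integral_cmult) auto
    qed
    also have "\<dots> = ennreal (2 powr \<alpha> * u powr b * ((u / \<rho>) powr (- b) / (- b)))"
    proof -
      have "(\<integral>\<^sup>+ v. ennreal (v powr (1 - \<sigma>)) * indicator {0<..<u / \<rho>} v \<partial>lborel) = ennreal ((u / \<rho>) powr (- b) / (- b))"
        using b \<rho> u nn_integral_powr_0[of "1 - \<sigma>" "u / \<rho>"] by (simp add: \<sigma>_def)
      moreover have "0 \<le> (u / \<rho>) powr (- b) / (- b)" using b by (intro divide_nonneg_nonneg) auto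
      ultimately show ?thesis by (simp only: ennreal_mult''[symmetric])
    qed
    also have "2 powr \<alpha> * u powr b * ((u / \<rho>) powr (- b) / (- b)) = 2 powr \<alpha> / (- b) * \<rho> powr b"
      using u \<rho> by (simp add: powr_divide powr_minus field_simps)
    finally show "(\<integral>\<^sup>+ z. ennreal (hker \<alpha> b z w) * indicator {z. \<rho> * defect z \<le> defect w} z \<partial>dA)
      \<le> ennreal (2 powr \<alpha> * D / (- b) * \<rho> powr b)"
      using D by (simp add: ennreal_mult'[symmetric] mult_right_mono mult_ac)
  qed
qed

section \<open>Weak-type bounds\<close>

lemma hker_measurable [measurable (raw)]:
  assumes [measurable]: "f \<in> borel_measurable M" "g \<in> borel_measurable M"
  shows "(\<lambda>x. hker \<alpha> b (f x) (g x)) \<in> borel_measurable M"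
  unfolding hker_def by measurable

text \<open>The values lie in [0, \<infinity>], so divergence is recorded as a value and Tonelli
  applies freely. Almost everywhere finiteness is recovered only in
  \<open>maps_boundedlyI\<close>.\<close>

definition hop :: "real \<Rightarrow> real \<Rightarrow> (complex \<Rightarrow> real) \<Rightarrow> complex \<Rightarrow> ennreal" where
  "hop \<alpha> b g z = (\<integral>\<^sup>+ w. ennreal (hker \<alpha> b z w) * ennreal (g w) \<partial>dA)"

lemma hop_measurable [measurable]:
  assumes [measurable]: "g \<in> borel_measurable dA"
  shows "hop \<alpha> b g \<in> borel_measurable dA"
  unfolding hop_def by measurable

lemma le_add_powr_mult:
  fixes t y p :: real
  assumes "0 < t" "0 \<le> y" "1 < p"
  shows "y \<le> t + t powr (1 - p) * y powr p"
proof (cases "y \<le> t")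
  case False
  then have "1 * y \<le> (y / t) powr (p - 1) * y"
    using assms by (intro mult_right_mono ge_one_powr_ge_zero) auto
  also have "\<dots> = t powr (1 - p) * y powr p"
    using assms False by (simp add: powr_divide powr_diff field_simps)
  finally show ?thesis using assms by simp
qed (use assms in \<open>simp add: add_increasing2\<close>)

text \<open>A Schur test with the weight \<open>(1 - |w|\<^sup>2) powr - s\<close>. In place of Hoelder's inequality the
  pointwise bound \<open>y \<le> t + t powr (1 - p) * y powr p\<close> is used, with \<open>t\<close> depending on \<open>z\<close>
  such that the first summand contributes \<open>\<mu> / 2\<close>.\<close>

lemma hop_weak_type:
  fixes \<alpha> b p :: real
  assumes \<alpha>: "0 \<le> \<alpha>" and b: "-1 < b" "b < 0" and p: "1 < p * (b + 1)"
  obtains C where "0 < C" "\<And>g \<mu>. g \<in> borel_measurable dA \<Longrightarrow> (\<And>w. 0 \<le> g w) \<Longrightarrow> 0 < \<mu> \<Longrightarrow>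
    emeasure dA {z \<in> space dA. ennreal \<mu> < hop \<alpha> b g z}
      \<le> ennreal (C * \<mu> powr - p) * (\<integral>\<^sup>+ w. ennreal (g w powr p) \<partial>dA)"
proof -
  have p1: "1 < p"
  proof (rule ccontr)
    assume "\<not> 1 < p"
    then have "p * (b + 1) \<le> 1 * (b + 1)" using b by (intro mult_right_mono) auto
    from less_le_trans[OF p this] show False using b by simp
  qed
  \<comment> \<open>The two Forelli-Rudin estimates below require s < b + 1 (weight integrable in
    w), s (p - 1) > -b (positive exponent in the dual estimate) and s (p - 1) < 1 + \<alpha> (weight
    integrable in z). The first two are compatible exactly when p (b + 1) > 1.\<close>
  have "- b / (p - 1) < b + 1" using p p1 by (simp add: field_simps)
  moreover have "- b / (p - 1) < (1 + \<alpha>) / (p - 1)"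
    using p1 \<alpha> b by (intro divide_strict_right_mono) auto
  ultimately have "- b / (p - 1) < min (b + 1) ((1 + \<alpha>) / (p - 1))" by simp
  then obtain s where s: "- b / (p - 1) < s" "s < min (b + 1) ((1 + \<alpha>) / (p - 1))"
    using dense by blast
  have s0: "0 < s" by (rule less_trans[OF divide_pos_pos s(1)]) (use b p1 in auto)
  have s1: "- b < s * (p - 1)" "s < b + 1" "s * (p - 1) < 1 + \<alpha>"
    using s p1 by (auto simp: field_simps)
  obtain C1 where C1: "0 < C1" "\<And>z. cmod z < 1 \<Longrightarrow>
      (\<integral>\<^sup>+ w. ennreal (defect w powr (b - s) * cmod (1 - z * cnj w) powr - (2 + (b - s) + (\<alpha> + s))) \<partial>dA)
      \<le> ennreal (C1 * defect z powr - (\<alpha> + s))"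
    by (rule forelli_rudin[of "b - s" "\<alpha> + s"]) (use s1 s0 \<alpha> in auto)
  define \<tau> where "\<tau> = s * (p - 1)"
  obtain C2 where C2: "0 < C2" "\<And>w. cmod w < 1 \<Longrightarrow>
      (\<integral>\<^sup>+ z. ennreal (defect z powr (\<alpha> - \<tau>) * cmod (1 - w * cnj z) powr - (2 + (\<alpha> - \<tau>) + (b + \<tau>))) \<partial>dA)
      \<le> ennreal (C2 * defect w powr - (b + \<tau>))"
    by (rule forelli_rudin[of "\<alpha> - \<tau>" "b + \<tau>"]) (use s1 in \<open>auto simp: \<tau>_def\<close>)
  show ?thesis
  proof (rule that[of "2 * (2 * C1) powr (p - 1) * C2"])
    show "0 < 2 * (2 * C1) powr (p - 1) * C2" using C1 C2 by simp
    fix g :: "complex \<Rightarrow> real" and \<mu> :: real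
    assume g[measurable]: "g \<in> borel_measurable dA" and g0: "\<And>w. 0 \<le> g w" and \<mu>: "0 < \<mu>"
    define H where "H z = (\<integral>\<^sup>+ w. ennreal (hker \<alpha> b z w) * ennreal (defect w powr \<tau> * g w powr p) \<partial>dA)" for z
    have [measurable]: "H \<in> borel_measurable dA" unfolding H_def by measurable
    define c where "c = 2 / \<mu> * (\<mu> / (2 * C1)) powr (1 - p)"
    have c: "0 < c" using \<mu> C1 by (simp add: c_def)
    have pointwise: "1 \<le> ennreal c * (ennreal (defect z powr - \<tau>) * H z)"
      if z: "cmod z < 1" and *: "ennreal \<mu> < hop \<alpha> b g z" for z
    proof -
      define v where "v = defect z"
      have v: "0 < v" using one_minus_cmod_sq_pos[OF z] by (simp add: v_def)
      define t where "t = \<mu> * v powr s / (2 * C1)"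
      have t: "0 < t" using \<mu> v C1 by (simp add: t_def)
      have "hop \<alpha> b g z \<le> (\<integral>\<^sup>+ w. ennreal t * ennreal (hker \<alpha> b z w * defect w powr - s) +
          ennreal (t powr (1 - p)) * (ennreal (hker \<alpha> b z w) * ennreal (defect w powr \<tau> * g w powr p)) \<partial>dA)"
        unfolding hop_def
      proof (rule nn_integral_mono)
        fix w assume "w \<in> space dA"
        then have w: "cmod w < 1" by simp
        define u where "u = defect w"
        have u: "0 < u" using one_minus_cmod_sq_pos[OF w] by (simp add: u_def)
        \<comment> \<open>The pointwise bound is applied to y = g(w) u^s. The weight then appears as
          u^(-s) in the linear term and as u^(s (p - 1)) = u^\<tau> in the term with the p-th
          power.\<close>
        have "g w = u powr - s * (g w * u powr s)" using u by (simp add: powr_minus field_simps)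
        also have "\<dots> \<le> u powr - s * (t + t powr (1 - p) * (g w * u powr s) powr p)"
          using g0[of w] t p1 by (intro mult_left_mono le_add_powr_mult) auto
        also have "\<dots> = t * u powr - s + t powr (1 - p) * (u powr \<tau> * g w powr p)"
        proof -
          have "u powr - s * (u powr s) powr p = u powr \<tau>"
            by (simp add: powr_powr \<tau>_def algebra_simps flip: powr_add)
          then show ?thesis using g0[of w] by (simp add: powr_mult algebra_simps)
        qed
        finally have "hker \<alpha> b z w * g w \<le> hker \<alpha> b z w * (t * u powr - s + t powr (1 - p) * (u powr \<tau> * g w powr p))"
          by (intro mult_left_mono hker_nonneg)
        also have "\<dots> = t * (hker \<alpha> b z w * u powr - s) + t powr (1 - p) * (hker \<alpha> b z w * (u powr \<tau> * g w powr p))"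
          by (simp add: algebra_simps)
        finally show "ennreal (hker \<alpha> b z w) * ennreal (g w) \<le> ennreal t * ennreal (hker \<alpha> b z w * defect w powr - s) +
          ennreal (t powr (1 - p)) * (ennreal (hker \<alpha> b z w) * ennreal (defect w powr \<tau> * g w powr p))"
          using t hker_nonneg[of \<alpha> b z w] g0[of w]
          by (simp add: u_def ennreal_leI flip: ennreal_mult ennreal_plus)
      qed
      also have "\<dots> = ennreal t * (\<integral>\<^sup>+ w. ennreal (hker \<alpha> b z w * defect w powr - s) \<partial>dA)
          + ennreal (t powr (1 - p)) * H z"
        unfolding H_def by (subst nn_integral_add) (auto simp: nn_integral_cmult)
      also have "(\<integral>\<^sup>+ w. ennreal (hker \<alpha> b z w * defect w powr - s) \<partial>dA)
        = (\<integral>\<^sup>+ w. ennreal (v powr \<alpha>) * ennreal (defect w powr (b - s) * cmod (1 - z * cnj w) powr - (2 + (b - s) + (\<alpha> + s))) \<partial>dA)"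
      proof (rule nn_integral_cong)
        fix w
        show "ennreal (hker \<alpha> b z w * defect w powr - s) = ennreal (v powr \<alpha>) * ennreal (defect w powr (b - s) * cmod (1 - z * cnj w) powr - (2 + (b - s) + (\<alpha> + s)))"
          using powr_add[of "defect w" b "- s"]
          by (simp add: hker_def v_def algebra_simps flip: ennreal_mult)
      qed
      also have "\<dots> = ennreal (v powr \<alpha>) * (\<integral>\<^sup>+ w. ennreal (defect w powr (b - s) * cmod (1 - z * cnj w) powr - (2 + (b - s) + (\<alpha> + s))) \<partial>dA)"
        by (rule nn_integral_cmult) measurable
      also have "\<dots> \<le> ennreal (v powr \<alpha>) * ennreal (C1 * v powr - (\<alpha> + s))"
        unfolding v_def by (intro mult_left_mono C1(2) z) simp
      also have "\<dots> = ennreal (C1 * v powr - s)"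
        using v C1 powr_add[of v \<alpha> "- (\<alpha> + s)"] by (simp add: mult_ac flip: ennreal_mult)
      finally have "ennreal \<mu> < ennreal t * ennreal (C1 * v powr - s) + ennreal (t powr (1 - p)) * H z"
        using * t by (meson add_right_mono less_le_trans mult_left_mono zero_le)
      also have "ennreal t * ennreal (C1 * v powr - s) = ennreal (\<mu> / 2)"
        using t v C1 by (simp add: t_def powr_minus flip: ennreal_mult)
      also have "ennreal (t powr (1 - p)) * H z = ennreal (\<mu> / 2) * (ennreal c * (ennreal (v powr - \<tau>) * H z))"
      proof -
        have "t powr (1 - p) = \<mu> / 2 * (c * v powr - \<tau>)"
          using \<mu> v C1 unfolding t_def c_def \<tau>_def
          by (simp add: powr_mult powr_divide powr_powr algebra_simps)
        also have "ennreal \<dots> = ennreal (\<mu> / 2) * (ennreal c * ennreal (v powr - \<tau>))"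
          using \<mu> c by (simp flip: ennreal_mult)
        finally show ?thesis by (simp only: mult.assoc)
      qed
      finally have **: "ennreal \<mu> < ennreal (\<mu> / 2) + ennreal (\<mu> / 2) * (ennreal c * (ennreal (v powr - \<tau>) * H z))" .
      show ?thesis
      proof (rule ccontr)
        assume "\<not> ?thesis"
        then have "ennreal (\<mu> / 2) * (ennreal c * (ennreal (v powr - \<tau>) * H z)) \<le> ennreal (\<mu> / 2) * 1"
          by (intro mult_left_mono) (auto simp: v_def)
        then have "ennreal (\<mu> / 2) + ennreal (\<mu> / 2) * (ennreal c * (ennreal (v powr - \<tau>) * H z)) \<le> ennreal (\<mu> / 2) + ennreal (\<mu> / 2) * 1"
          by (intro add_left_mono)
        also have "\<dots> = ennreal \<mu>" using \<mu> by (simp flip: ennreal_plus)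
        finally show False using ** by simp
      qed
    qed
    have "emeasure dA {z \<in> space dA. ennreal \<mu> < hop \<alpha> b g z}
       \<le> emeasure dA {z \<in> space dA. 1 \<le> ennreal c * (ennreal (defect z powr - \<tau>) * H z)}"
    proof (rule emeasure_mono)
      show "{z \<in> space dA. ennreal \<mu> < hop \<alpha> b g z}
          \<subseteq> {z \<in> space dA. 1 \<le> ennreal c * (ennreal (defect z powr - \<tau>) * H z)}"
        using pointwise by auto
    qed measurable
    also have "\<dots> \<le> ennreal c * (\<integral>\<^sup>+ z. ennreal (defect z powr - \<tau>) * H z \<partial>dA)"
    proof -
      have "emeasure dA {z \<in> space dA. 1 \<le> ennreal c * (ennreal (defect z powr - \<tau>) * H z)}
        \<le> ennreal c * (\<integral>\<^sup>+ z. ennreal (defect z powr - \<tau>) * H z * indicator (space dA) z \<partial>dA)"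
        by (rule nn_integral_Markov_inequality) measurable
      also have "(\<integral>\<^sup>+ z. ennreal (defect z powr - \<tau>) * H z * indicator (space dA) z \<partial>dA)
        = (\<integral>\<^sup>+ z. ennreal (defect z powr - \<tau>) * H z \<partial>dA)"
        by (rule nn_integral_cong) simp
      finally show ?thesis .
    qed
    also have "(\<integral>\<^sup>+ z. ennreal (defect z powr - \<tau>) * H z \<partial>dA)
      = (\<integral>\<^sup>+ z. (\<integral>\<^sup>+ w. ennreal (defect z powr - \<tau>) * (ennreal (hker \<alpha> b z w) * ennreal (defect w powr \<tau> * g w powr p)) \<partial>dA) \<partial>dA)"
      unfolding H_def by (intro nn_integral_cong nn_integral_cmult[symmetric]) measurable
    also have "\<dots> = (\<integral>\<^sup>+ w. (\<integral>\<^sup>+ z. ennreal (defect z powr - \<tau>) * (ennreal (hker \<alpha> b z w) * ennreal (defect w powr \<tau> * g w powr p)) \<partial>dA) \<partial>dA)"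
      by (rule dA_dA.Fubini'[symmetric]) measurable
    also have "\<dots> \<le> (\<integral>\<^sup>+ w. ennreal C2 * ennreal (g w powr p) \<partial>dA)"
    proof (rule nn_integral_mono)
      fix w assume "w \<in> space dA"
      then have w: "cmod w < 1" by simp
      define u where "u = defect w"
      have u: "0 < u" using one_minus_cmod_sq_pos[OF w] by (simp add: u_def)
      have "(\<integral>\<^sup>+ z. ennreal (defect z powr - \<tau>) * (ennreal (hker \<alpha> b z w) * ennreal (defect w powr \<tau> * g w powr p)) \<partial>dA)
        = (\<integral>\<^sup>+ z. ennreal (u powr (b + \<tau>) * g w powr p) * ennreal (defect z powr (\<alpha> - \<tau>) * cmod (1 - w * cnj z) powr - (2 + (\<alpha> - \<tau>) + (b + \<tau>))) \<partial>dA)"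
      proof (rule nn_integral_cong)
        fix z
        have "defect z powr (\<alpha> - \<tau>) = defect z powr \<alpha> * defect z powr - \<tau>"
          by (simp flip: powr_add)
        moreover have "- (2 + (\<alpha> - \<tau>) + (b + \<tau>)) = - (2 + \<alpha> + b)" by simp
        ultimately show "ennreal (defect z powr - \<tau>) * (ennreal (hker \<alpha> b z w) * ennreal (defect w powr \<tau> * g w powr p))
          = ennreal (u powr (b + \<tau>) * g w powr p) * ennreal (defect z powr (\<alpha> - \<tau>) * cmod (1 - w * cnj z) powr - (2 + (\<alpha> - \<tau>) + (b + \<tau>)))"
          by (simp only: hker_def u_def powr_add cmod_one_minus_commute[of z w]) (simp add: mult_ac flip: ennreal_mult)
      qed
      also have "\<dots> = ennreal (u powr (b + \<tau>) * g w powr p) *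
          (\<integral>\<^sup>+ z. ennreal (defect z powr (\<alpha> - \<tau>) * cmod (1 - w * cnj z) powr - (2 + (\<alpha> - \<tau>) + (b + \<tau>))) \<partial>dA)"
        by (rule nn_integral_cmult) measurable
      also have "\<dots> \<le> ennreal (u powr (b + \<tau>) * g w powr p) * ennreal (C2 * u powr - (b + \<tau>))"
        unfolding u_def by (intro mult_left_mono C2(2) w) simp
      also have "\<dots> = ennreal C2 * ennreal (g w powr p)"
        using u C2(1) powr_add[of u "b + \<tau>" "- (b + \<tau>)"] by (simp add: mult_ac flip: ennreal_mult)
      finally show "(\<integral>\<^sup>+ z. ennreal (defect z powr - \<tau>) * (ennreal (hker \<alpha> b z w) * ennreal (defect w powr \<tau> * g w powr p)) \<partial>dA)
        \<le> ennreal C2 * ennreal (g w powr p)" .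
    qed
    also have "\<dots> = ennreal C2 * (\<integral>\<^sup>+ w. ennreal (g w powr p) \<partial>dA)"
      by (rule nn_integral_cmult) measurable
    also have "ennreal c * (ennreal C2 * (\<integral>\<^sup>+ w. ennreal (g w powr p) \<partial>dA))
       = ennreal (2 * (2 * C1) powr (p - 1) * C2 * \<mu> powr - p) * (\<integral>\<^sup>+ w. ennreal (g w powr p) \<partial>dA)"
    proof -
      have "c * C2 = 2 * (2 * C1) powr (p - 1) * C2 * \<mu> powr - p"
        using \<mu> C1 unfolding c_def by (simp add: powr_divide powr_diff powr_minus field_simps)
      moreover have "ennreal c * ennreal C2 = ennreal (c * C2)" using c C2 by (simp add: ennreal_mult)
      ultimately show ?thesis by (simp only: mult.assoc[symmetric])
    qed
    finally show "emeasure dA {z \<in> space dA. ennreal \<mu> < hop \<alpha> b g z}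
      \<le> ennreal (2 * (2 * C1) powr (p - 1) * C2 * \<mu> powr - p) * (\<integral>\<^sup>+ w. ennreal (g w powr p) \<partial>dA)"
      by (simp add: mult_left_mono)
  qed
qed

text \<open>Superlevel sets of \<open>defect z powr - \<delta>\<close> are such collars, so this is
  the weak L^(1/\<delta>) bound for that factor.\<close>

lemma emeasure_dA_collar_le:
  fixes h :: real
  assumes "0 \<le> h"
  shows "emeasure dA {z \<in> space dA. defect z < h} \<le> ennreal h"
proof -
  have "emeasure dA {z \<in> space dA. defect z < h} = (\<integral>\<^sup>+ z. indicator {z \<in> space dA. defect z < h} z \<partial>dA)"
    by (rule nn_integral_indicator[symmetric]) measurable
  also have "\<dots> = (\<integral>\<^sup>+ z. indicator {..<h} (defect z) \<partial>dA)"
    by (rule nn_integral_cong) (auto simp: indicator_def)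
  also have "\<dots> = (\<integral>\<^sup>+ u. indicator {..<h} u * indicator {0<..<1} u \<partial>lborel)"
    by (rule nn_integral_dA_radial) measurable
  also have "\<dots> \<le> (\<integral>\<^sup>+ u. indicator {0..h} u \<partial>lborel)"
    by (rule nn_integral_mono) (auto simp: indicator_def)
  also have "\<dots> = ennreal h" using assms by simp
  finally show ?thesis .
qed

text \<open>Hoelder's inequality for weak spaces, with 1 / q = 1 / p + \<delta>. Where the product
  exceeds t, either G exceeds s or z lies in the collar
  \<open>defect z < (s / t) powr (1 / \<delta>)\<close>. The factor 2^(1/q) pays for the two
  sets.\<close>

lemma weak_type_mult_powr:
  fixes G :: "complex \<Rightarrow> ennreal" and N p \<delta> t :: real
  assumes [measurable]: "G \<in> borel_measurable dA" and N: "0 \<le> N" and p: "0 < p" and \<delta>: "0 < \<delta>" and t: "0 < t"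
    and weak: "\<And>\<mu>. 0 < \<mu> \<Longrightarrow> emeasure dA {z \<in> space dA. ennreal \<mu> < G z} \<le> ennreal ((N / \<mu>) powr p)"
  defines "q \<equiv> p / (1 + p * \<delta>)"
  shows "emeasure dA {z \<in> space dA. ennreal t < ennreal (defect z powr - \<delta>) * G z}
    \<le> ennreal ((2 powr (1 / q) * N / t) powr q)"
proof -
  have q: "0 < q" using p \<delta> by (simp add: q_def add_pos_nonneg)
  let ?S = "{z \<in> space dA. ennreal t < ennreal (defect z powr - \<delta>) * G z}"
  show ?thesis
  proof (cases "N = 0")
    \<comment> \<open>For N = 0 the balancing level s would vanish. Here G is zero almost
      everywhere, seen by exhausting G > 0 with the levels 1 / (n + 1).\<close>
    case True
    have "?S \<subseteq> (\<Union>n. {z \<in> space dA. ennreal (1 / real (Suc n)) < G z})"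
    proof
      fix z assume z: "z \<in> ?S"
      then have "0 < G z" by (auto intro!: gr_zeroI)
      then obtain x where x: "0 < x" "ennreal x < G z"
        using dense[of 0 "G z"]
        by (metis ennreal_cases ennreal_less_zero_iff less_top_ennreal order.strict_trans2 top_greatest)
      obtain n where "1 / real (Suc n) < x" using x(1) nat_approx_posE by metis
      then have "ennreal (1 / real (Suc n)) < G z"
        using x(2) by (meson ennreal_leI le_less_trans less_imp_le)
      then show "z \<in> (\<Union>n. {z \<in> space dA. ennreal (1 / real (Suc n)) < G z})" using z by auto
    qed
    then have "emeasure dA ?S \<le> emeasure dA (\<Union>n. {z \<in> space dA. ennreal (1 / real (Suc n)) < G z})"
      by (rule emeasure_mono) measurable
    also have "\<dots> = 0"
    proof (rule emeasure_UN_eq_0)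
      fix n show "emeasure dA {z \<in> space dA. ennreal (1 / real (Suc n)) < G z} = 0"
        using weak[of "1 / real (Suc n)"] True by simp
    qed (intro image_subsetI, measurable)
    finally show ?thesis by simp
  next
    case False
    then have N: "0 < N" using N by simp
    \<comment> \<open>This s solves (N / s)^p = (s / t)^(1/\<delta>), which makes the bounds for the
      two sets equal. Their common value is (N / t)^q.\<close>
    define s where "s = N powr (p * \<delta> / (1 + p * \<delta>)) * t powr (1 / (1 + p * \<delta>))"
    have d: "0 < 1 + p * \<delta>" using p \<delta> by (simp add: add_pos_nonneg)
    have s: "0 < s" using N t by (simp add: s_def)
    have sum1: "p * \<delta> / (1 + p * \<delta>) + 1 / (1 + p * \<delta>) = 1" using d by (simp add: field_simps)
    have e1: "(N / s) powr p = (N / t) powr q"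
    proof -
      have "N / s = (N / t) powr (1 / (1 + p * \<delta>))"
      proof -
        have "N = N powr (p * \<delta> / (1 + p * \<delta>)) * N powr (1 / (1 + p * \<delta>))"
          using N sum1 by (simp add: powr_add[symmetric])
        then show ?thesis using N t by (simp add: s_def powr_divide field_simps)
      qed
      then show ?thesis using p by (simp add: powr_powr q_def)
    qed
    have e2: "(s / t) powr (1 / \<delta>) = (N / t) powr q"
    proof -
      have "s / t = (N / t) powr (p * \<delta> / (1 + p * \<delta>))"
      proof -
        have "t = t powr (p * \<delta> / (1 + p * \<delta>)) * t powr (1 / (1 + p * \<delta>))"
          using t sum1 by (simp add: powr_add[symmetric])
        then show ?thesis using N t by (simp add: s_def powr_divide field_simps)
      qed
      then show ?thesis using \<delta> by (simp add: powr_powr q_def)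
    qed
    have "?S \<subseteq> {z \<in> space dA. ennreal s < G z} \<union> {z \<in> space dA. defect z < (s / t) powr (1 / \<delta>)}"
    proof
      fix z assume z: "z \<in> ?S"
      then have z1: "cmod z < 1" by simp
      define v where "v = defect z"
      have v: "0 < v" using one_minus_cmod_sq_pos[OF z1] by (simp add: v_def)
      have "v < (s / t) powr (1 / \<delta>)" if "\<not> ennreal s < G z"
      proof -
        have "ennreal t < ennreal (v powr - \<delta>) * G z" using z by (simp add: v_def)
        also have "\<dots> \<le> ennreal (v powr - \<delta>) * ennreal s" using that by (intro mult_left_mono) auto
        also have "\<dots> = ennreal (v powr - \<delta> * s)" using s by (simp add: ennreal_mult)
        finally have "t < v powr - \<delta> * s" using t by (simp add: ennreal_less_iff)
        then have "v powr \<delta> < s / t" using t v by (simp add: powr_minus field_simps)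
        then have "(v powr \<delta>) powr (1 / \<delta>) < (s / t) powr (1 / \<delta>)" using \<delta> by (intro powr_less_mono2) auto
        then show ?thesis using \<delta> v by (simp add: powr_powr)
      qed
      then show "z \<in> {z \<in> space dA. ennreal s < G z} \<union> {z \<in> space dA. defect z < (s / t) powr (1 / \<delta>)}"
        using z1 by (auto simp: v_def)
    qed
    then have "emeasure dA ?S \<le> emeasure dA ({z \<in> space dA. ennreal s < G z} \<union> {z \<in> space dA. defect z < (s / t) powr (1 / \<delta>)})"
      by (rule emeasure_mono) measurable
    also have "\<dots> \<le> emeasure dA {z \<in> space dA. ennreal s < G z} + emeasure dA {z \<in> space dA. defect z < (s / t) powr (1 / \<delta>)}"
      by (rule emeasure_subadditive) measurable
    also have "\<dots> \<le> ennreal ((N / s) powr p) + ennreal ((s / t) powr (1 / \<delta>))"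
      by (intro add_mono weak s emeasure_dA_collar_le) simp
    also have "\<dots> = ennreal (2 * (N / t) powr q)" unfolding e1 e2 by (simp flip: ennreal_plus)
    also have "2 * (N / t) powr q = (2 powr (1 / q) * N / t) powr q"
      using q N t by (simp add: powr_mult powr_divide powr_powr)
    finally show ?thesis .
  qed
qed

section \<open>Restricted weak type at the critical exponent and its Lorentz extension\<close>

lemma nn_integral_dA_null:
  assumes "E \<in> sets dA" "measure dA E = 0"
  shows "(\<integral>\<^sup>+ w. g w * indicator E w \<partial>dA) = 0"
proof -
  have "E \<in> null_sets dA" using assms by (intro null_setsI) (simp_all add: dA.emeasure_eq_measure)
  then have "AE w in dA. w \<notin> E" by (rule AE_not_in)
  then have "(\<integral>\<^sup>+ w. g w * indicator E w \<partial>dA) = (\<integral>\<^sup>+ w. 0 \<partial>dA)"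
    by (intro nn_integral_cong_AE) (auto elim!: eventually_mono)
  then show ?thesis by simp
qed

text \<open>The conditional, unlike an indicator of a set that depends on x, is visibly jointly
  measurable in s and in the point at which x is evaluated, as the Tonelli steps require.\<close>

lemma ennreal_eq_layers:
  fixes x :: real
  assumes "0 \<le> x"
  shows "ennreal x = (\<integral>\<^sup>+ s. (if 0 < s \<and> s < x then 1 else 0) \<partial>lborel)"
proof -
  have "ennreal x = (\<integral>\<^sup>+ s. indicator {0<..<x} s \<partial>lborel)" using assms by simp
  also have "\<dots> = (\<integral>\<^sup>+ s. (if 0 < s \<and> s < x then 1 else 0) \<partial>lborel)"
    by (rule nn_integral_cong) (simp add: indicator_def)
  finally show ?thesis .
qed

text \<open>The near part is integrated over w first and costs \<rho>^(b+1) |F|. The far part is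
  integrated over z first and costs \<rho>^b |E|. At \<rho> = |E| / |F| both are multiples of
  |E|^(b+1) |F|^(-b), the bilinear form of the restricted weak-type bound at p = 1 / (b +
  1).\<close>

lemma hker_rectangle_le:
  fixes \<alpha> b :: real
  assumes \<alpha>: "0 \<le> \<alpha>" and b: "-1 < b" "b < 0"
  obtains C where "0 < C" "\<And>E F. E \<in> sets dA \<Longrightarrow> F \<in> sets dA \<Longrightarrow>
    (\<integral>\<^sup>+ w. (\<integral>\<^sup>+ z. ennreal (hker \<alpha> b z w) * indicator F z \<partial>dA) * indicator E w \<partial>dA)
      \<le> ennreal (C * measure dA E powr (b + 1) * measure dA F powr - b)"
proof -
  obtain C1 where C1: "0 < C1" "\<And>z \<rho>. cmod z < 1 \<Longrightarrow> 0 < \<rho> \<Longrightarrow>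
    (\<integral>\<^sup>+ w. ennreal (hker \<alpha> b z w) * indicator {w. defect w < \<rho> * defect z} w \<partial>dA)
      \<le> ennreal (C1 * \<rho> powr (b + 1))"
    by (rule hker_near_integral[OF \<alpha> b(1)]) blast
  obtain C2 where C2: "0 < C2" "\<And>w \<rho>. cmod w < 1 \<Longrightarrow> 0 < \<rho> \<Longrightarrow>
    (\<integral>\<^sup>+ z. ennreal (hker \<alpha> b z w) * indicator {z. \<rho> * defect z \<le> defect w} z \<partial>dA)
      \<le> ennreal (C2 * \<rho> powr b)"
    by (rule hker_far_integral[OF \<alpha> b]) blast
  show ?thesis
  proof (rule that[of "C1 + C2"])
    show "0 < C1 + C2" using C1 C2 by simp
    fix E F assume E[measurable]: "E \<in> sets dA" and F[measurable]: "F \<in> sets dA"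
    let ?I = "\<integral>\<^sup>+ w. (\<integral>\<^sup>+ z. ennreal (hker \<alpha> b z w) * indicator F z \<partial>dA) * indicator E w \<partial>dA"
    define e where "e = measure dA E"
    define m where "m = measure dA F"
    have em: "emeasure dA E = ennreal e" "emeasure dA F = ennreal m"
      by (simp_all add: e_def m_def dA.emeasure_eq_measure)
    have "0 \<le> e" "0 \<le> m" by (simp_all add: e_def m_def)
    \<comment> \<open>The ratio \<rho> = e / m is usable only when both measures are positive. On a
      null set the integral vanishes.\<close>
    then consider "e = 0" | "m = 0" | "0 < e" "0 < m" by linarith
    then show "?I \<le> ennreal ((C1 + C2) * measure dA E powr (b + 1) * measure dA F powr - b)"
    proof cases
      case 1
      then show ?thesis using nn_integral_dA_null[OF E] by (simp add: e_def)
    next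
      case 2
      then show ?thesis using nn_integral_dA_null[OF F] by (simp add: m_def)
    next
      case 3
      define \<rho> where "\<rho> = e / m"
      have \<rho>: "0 < \<rho>" using 3 by (simp add: \<rho>_def)
      define kN where "kN z w = (if defect w < \<rho> * defect z then ennreal (hker \<alpha> b z w) else 0)" for z w
      define kF where "kF z w = (if \<rho> * defect z \<le> defect w then ennreal (hker \<alpha> b z w) else 0)" for z w
      have [measurable]: "(\<lambda>x. kN (f x) (g x)) \<in> borel_measurable M" "(\<lambda>x. kF (f x) (g x)) \<in> borel_measurable M"
        if [measurable]: "f \<in> borel_measurable M" "g \<in> borel_measurable M" for f g and M :: "'m measure"
        unfolding kN_def kF_def by measurable
      have split: "ennreal (hker \<alpha> b z w) = kN z w + kF z w" for z w by (simp add: kN_def kF_def)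
      have "?I = (\<integral>\<^sup>+ w. (\<integral>\<^sup>+ z. kN z w * indicator F z * indicator E w \<partial>dA) + (\<integral>\<^sup>+ z. kF z w * indicator F z \<partial>dA) * indicator E w \<partial>dA)"
      proof (rule nn_integral_cong)
        fix w
        have "(\<integral>\<^sup>+ z. ennreal (hker \<alpha> b z w) * indicator F z \<partial>dA) = (\<integral>\<^sup>+ z. kN z w * indicator F z + kF z w * indicator F z \<partial>dA)"
          by (simp add: split distrib_right)
        also have "\<dots> = (\<integral>\<^sup>+ z. kN z w * indicator F z \<partial>dA) + (\<integral>\<^sup>+ z. kF z w * indicator F z \<partial>dA)"
          by (rule nn_integral_add) measurable
        finally show "(\<integral>\<^sup>+ z. ennreal (hker \<alpha> b z w) * indicator F z \<partial>dA) * indicator E w =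
            (\<integral>\<^sup>+ z. kN z w * indicator F z * indicator E w \<partial>dA) + (\<integral>\<^sup>+ z. kF z w * indicator F z \<partial>dA) * indicator E w"
          by (simp add: distrib_right nn_integral_multc)
      qed
      also have "\<dots> = (\<integral>\<^sup>+ w. (\<integral>\<^sup>+ z. kN z w * indicator F z * indicator E w \<partial>dA) \<partial>dA) + (\<integral>\<^sup>+ w. (\<integral>\<^sup>+ z. kF z w * indicator F z \<partial>dA) * indicator E w \<partial>dA)"
        by (rule nn_integral_add) measurable
      also have "(\<integral>\<^sup>+ w. (\<integral>\<^sup>+ z. kN z w * indicator F z * indicator E w \<partial>dA) \<partial>dA) = (\<integral>\<^sup>+ z. (\<integral>\<^sup>+ w. kN z w * indicator F z * indicator E w \<partial>dA) \<partial>dA)"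
        by (rule dA_dA.Fubini') measurable
      also have "\<dots> \<le> (\<integral>\<^sup>+ z. ennreal (C1 * \<rho> powr (b + 1)) * indicator F z \<partial>dA)"
      proof (rule nn_integral_mono)
        fix z assume "z \<in> space dA"
        then have z: "cmod z < 1" by simp
        have "(\<integral>\<^sup>+ w. kN z w * indicator F z * indicator E w \<partial>dA) \<le> (\<integral>\<^sup>+ w. kN z w * indicator F z \<partial>dA)"
          by (rule nn_integral_mono) (simp add: indicator_def)
        also have "\<dots> = (\<integral>\<^sup>+ w. kN z w \<partial>dA) * indicator F z"
          by (rule nn_integral_multc) measurable
        also have "(\<integral>\<^sup>+ w. kN z w \<partial>dA) = (\<integral>\<^sup>+ w. ennreal (hker \<alpha> b z w) * indicator {w. defect w < \<rho> * defect z} w \<partial>dA)"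
          by (rule nn_integral_cong) (simp add: kN_def)
        also have "\<dots> \<le> ennreal (C1 * \<rho> powr (b + 1))" by (rule C1(2)[OF z \<rho>])
        finally show "(\<integral>\<^sup>+ w. kN z w * indicator F z * indicator E w \<partial>dA) \<le> ennreal (C1 * \<rho> powr (b + 1)) * indicator F z"
          by (simp add: mult_right_mono)
      qed
      also have "\<dots> = ennreal (C1 * \<rho> powr (b + 1)) * ennreal m" by (simp add: em nn_integral_cmult)
      also have "(\<integral>\<^sup>+ w. (\<integral>\<^sup>+ z. kF z w * indicator F z \<partial>dA) * indicator E w \<partial>dA) \<le> (\<integral>\<^sup>+ w. ennreal (C2 * \<rho> powr b) * indicator E w \<partial>dA)"
      proof (rule nn_integral_mono)
        fix w assume "w \<in> space dA"
        then have w: "cmod w < 1" by simp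
        have "(\<integral>\<^sup>+ z. kF z w * indicator F z \<partial>dA) \<le> (\<integral>\<^sup>+ z. ennreal (hker \<alpha> b z w) * indicator {z. \<rho> * defect z \<le> defect w} z \<partial>dA)"
          by (rule nn_integral_mono) (simp add: kF_def indicator_def)
        also have "\<dots> \<le> ennreal (C2 * \<rho> powr b)" by (rule C2(2)[OF w \<rho>])
        finally show "(\<integral>\<^sup>+ z. kF z w * indicator F z \<partial>dA) * indicator E w \<le> ennreal (C2 * \<rho> powr b) * indicator E w"
          by (simp add: mult_right_mono)
      qed
      also have "\<dots> = ennreal (C2 * \<rho> powr b) * ennreal e" by (simp add: em nn_integral_cmult)
      also have "ennreal (C1 * \<rho> powr (b + 1)) * ennreal m + ennreal (C2 * \<rho> powr b) * ennreal e = ennreal (C1 * \<rho> powr (b + 1) * m + C2 * \<rho> powr b * e)"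
        using C1 C2 3 by (simp flip: ennreal_mult ennreal_plus)
      also have "C1 * \<rho> powr (b + 1) * m + C2 * \<rho> powr b * e = (C1 + C2) * e powr (b + 1) * m powr - b"
      proof -
        have 1: "\<rho> powr (b + 1) * m = e powr (b + 1) * m powr - b"
          using 3 by (simp add: \<rho>_def powr_divide powr_add powr_minus field_simps)
        have 2: "\<rho> powr b * e = e powr (b + 1) * m powr - b"
          using 3 by (simp add: \<rho>_def powr_divide powr_add powr_minus field_simps)
        show ?thesis unfolding mult.assoc 1 2 by (simp add: distrib_right)
      qed
      finally show ?thesis by (simp add: e_def m_def add_mono)
    qed
  qed
qed

text \<open>By the layer cake decomposition of \<open>g\<close> the rectangle bound controls the integral of \<open>hop \<alpha> b g\<close> over its own superlevel set.\<close>

lemma hop_lorentz_weak_type: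
  fixes \<alpha> b :: real
  assumes \<alpha>: "0 \<le> \<alpha>" and b: "-1 < b" "b < 0"
  obtains C where "0 < C" "\<And>g N \<mu>. g \<in> borel_measurable dA \<Longrightarrow> (\<And>w. 0 \<le> g w) \<Longrightarrow> 0 < \<mu> \<Longrightarrow> 0 \<le> N \<Longrightarrow>
    (\<integral>\<^sup>+ s\<in>{0<..}. ennreal (measure dA {w \<in> space dA. s < g w} powr (b + 1)) \<partial>lborel) \<le> ennreal N \<Longrightarrow>
    emeasure dA {z \<in> space dA. ennreal \<mu> < hop \<alpha> b g z} \<le> ennreal ((C * N / \<mu>) powr (1 / (b + 1)))"
proof -
  obtain C where C: "0 < C" "\<And>E F. E \<in> sets dA \<Longrightarrow> F \<in> sets dA \<Longrightarrow>
    (\<integral>\<^sup>+ w. (\<integral>\<^sup>+ z. ennreal (hker \<alpha> b z w) * indicator F z \<partial>dA) * indicator E w \<partial>dA)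
      \<le> ennreal (C * measure dA E powr (b + 1) * measure dA F powr - b)"
    by (rule hker_rectangle_le[OF \<alpha> b]) blast
  show ?thesis
  proof (rule that[OF C(1)])
    fix g :: "complex \<Rightarrow> real" and N \<mu> :: real
    assume g[measurable]: "g \<in> borel_measurable dA" and g0: "\<And>w. 0 \<le> g w" and \<mu>: "0 < \<mu>" and N: "0 \<le> N"
      and gN: "(\<integral>\<^sup>+ s\<in>{0<..}. ennreal (measure dA {w \<in> space dA. s < g w} powr (b + 1)) \<partial>lborel) \<le> ennreal N"
    define F where "F = {z \<in> space dA. ennreal \<mu> < hop \<alpha> b g z}"
    have F[measurable]: "F \<in> sets dA" unfolding F_def by measurable
    define m where "m = measure dA F"
    have em: "emeasure dA F = ennreal m" by (simp add: m_def dA.emeasure_eq_measure)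
    have m0: "0 \<le> m" by (simp add: m_def)
    define G where "G w = (\<integral>\<^sup>+ z. ennreal (hker \<alpha> b z w) * indicator F z \<partial>dA)" for w
    have [measurable]: "G \<in> borel_measurable dA" unfolding G_def by measurable
    \<comment> \<open>On F the function \<open>hop \<alpha> b g\<close> exceeds \<mu>. Bounding its
      integral over F from above, layer by layer in g, gives an inequality in which |F| occurs on
      both sides.\<close>
    have "ennreal \<mu> * ennreal m = (\<integral>\<^sup>+ z. ennreal \<mu> * indicator F z \<partial>dA)"
      by (simp add: em nn_integral_cmult)
    also have "\<dots> \<le> (\<integral>\<^sup>+ z. hop \<alpha> b g z * indicator F z \<partial>dA)"
      by (rule nn_integral_mono) (auto simp: F_def indicator_def)
    also have "\<dots> = (\<integral>\<^sup>+ z. (\<integral>\<^sup>+ w. ennreal (hker \<alpha> b z w) * ennreal (g w) * indicator F z \<partial>dA) \<partial>dA)"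
      unfolding hop_def by (intro nn_integral_cong nn_integral_multc[symmetric]) measurable
    also have "\<dots> = (\<integral>\<^sup>+ w. (\<integral>\<^sup>+ z. ennreal (hker \<alpha> b z w) * ennreal (g w) * indicator F z \<partial>dA) \<partial>dA)"
      by (rule dA_dA.Fubini'[symmetric]) measurable
    also have "\<dots> = (\<integral>\<^sup>+ w. G w * ennreal (g w) \<partial>dA)"
      unfolding G_def
      by (intro nn_integral_cong) (subst nn_integral_multc[symmetric], measurable, simp add: mult_ac)
    also have "\<dots> = (\<integral>\<^sup>+ w. (\<integral>\<^sup>+ s. G w * (if 0 < s \<and> s < g w then 1 else 0) \<partial>lborel) \<partial>dA)"
    proof (rule nn_integral_cong)
      fix w
      show "G w * ennreal (g w) = (\<integral>\<^sup>+ s. G w * (if 0 < s \<and> s < g w then 1 else 0) \<partial>lborel)"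
        unfolding ennreal_eq_layers[OF g0] by (subst nn_integral_cmult) auto
    qed
    also have "\<dots> = (\<integral>\<^sup>+ s. (\<integral>\<^sup>+ w. G w * (if 0 < s \<and> s < g w then 1 else 0) \<partial>dA) \<partial>lborel)"
      by (rule dA_lborel.Fubini'[symmetric]) measurable
    also have "\<dots> \<le> (\<integral>\<^sup>+ s. ennreal (C * m powr - b) * (ennreal (measure dA {w \<in> space dA. s < g w} powr (b + 1)) * indicator {0<..} s) \<partial>lborel)"
    proof (rule nn_integral_mono)
      fix s :: real
      show "(\<integral>\<^sup>+ w. G w * (if 0 < s \<and> s < g w then 1 else 0) \<partial>dA)
        \<le> ennreal (C * m powr - b) * (ennreal (measure dA {w \<in> space dA. s < g w} powr (b + 1)) * indicator {0<..} s)"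
      proof (cases "0 < s")
        case True
        have "(\<integral>\<^sup>+ w. G w * (if 0 < s \<and> s < g w then 1 else 0) \<partial>dA) = (\<integral>\<^sup>+ w. G w * indicator {w \<in> space dA. s < g w} w \<partial>dA)"
          using True by (intro nn_integral_cong) (simp add: indicator_def)
        also have "\<dots> \<le> ennreal (C * measure dA {w \<in> space dA. s < g w} powr (b + 1) * m powr - b)"
          unfolding G_def m_def by (rule C(2)) measurable
        also have "\<dots> = ennreal (C * m powr - b) * ennreal (measure dA {w \<in> space dA. s < g w} powr (b + 1))"
          using C(1) by (simp add: mult_ac flip: ennreal_mult)
        finally show ?thesis using True by simp
      qed simp
    qed
    also have "\<dots> = ennreal (C * m powr - b) * (\<integral>\<^sup>+ s\<in>{0<..}. ennreal (measure dA {w \<in> space dA. s < g w} powr (b + 1)) \<partial>lborel)"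
    proof (rule nn_integral_cmult)
      have "(\<lambda>s. emeasure dA {w \<in> space dA. s < g w}) \<in> borel_measurable borel" by measurable
      then show "(\<lambda>s. ennreal (measure dA {w \<in> space dA. s < g w} powr (b + 1)) * indicator {0<..} s) \<in> borel_measurable lborel"
        unfolding measure_def by measurable
    qed
    also have "\<dots> \<le> ennreal (C * m powr - b) * ennreal N"
      by (intro mult_left_mono gN) simp
    finally have "\<mu> * m \<le> C * m powr - b * N"
      using \<mu> m0 N C(1) by (simp flip: ennreal_mult)
    \<comment> \<open>As m is finite and positive, dividing by m^(-b) leaves m^(b+1) \<le> C N /
      \<mu>.\<close>
    have "m \<le> (C * N / \<mu>) powr (1 / (b + 1))"
    proof (cases "m = 0")
      case False
      then have m: "0 < m" using m0 by simp
      have "m powr (b + 1) = m * m powr b" using m by (simp add: powr_add)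
      also have "\<dots> \<le> C * N / \<mu>"
        using \<open>\<mu> * m \<le> C * m powr - b * N\<close> m \<mu> by (simp add: powr_minus field_simps)
      finally have "(m powr (b + 1)) powr (1 / (b + 1)) \<le> (C * N / \<mu>) powr (1 / (b + 1))"
        using b by (intro powr_mono2) auto
      then show ?thesis using b m by (simp add: powr_powr)
    qed simp
    then show "emeasure dA {z \<in> space dA. ennreal \<mu> < hop \<alpha> b g z} \<le> ennreal ((C * N / \<mu>) powr (1 / (b + 1)))"
      using em by (simp add: F_def ennreal_leI)
  qed
qed

section \<open>Boundedness of the operators\<close>

lemma T_ker_measurable [measurable (raw)]:
  assumes [measurable]: "f \<in> borel_measurable M" "g \<in> borel_measurable M"
  shows "(\<lambda>x. T_ker b c (f x) (g x)) \<in> borel_measurable M"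
  unfolding T_ker_def by measurable

lemma S_ker_measurable [measurable (raw)]:
  assumes [measurable]: "f \<in> borel_measurable M" "g \<in> borel_measurable M"
  shows "(\<lambda>x. S_ker b c (f x) (g x)) \<in> borel_measurable M"
  unfolding S_ker_def by measurable

lemma norm_T_ker: "cmod (T_ker b c z w) = defect w powr b / cmod (1 - z * cnj w) powr c"
  by (simp add: T_ker_def norm_divide norm_powr_real_powr')

lemma norm_S_ker: "cmod (S_ker b c z w) = defect w powr b / cmod (1 - z * cnj w) powr c"
  by (simp add: S_ker_def norm_divide)

lemma int_op_measurable:
  assumes k: "k = T_ker b c \<or> k = S_ker b c" and [measurable]: "f \<in> borel_measurable dA"
  shows "int_op a k f \<in> borel_measurable dA"
proof -
  have [measurable]: "(\<lambda>x. k (fst x) (snd x)) \<in> borel_measurable (dA \<Otimes>\<^sub>M dA)"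
    using k by auto
  have "(\<lambda>x. k (fst x) (snd x) * f (snd x)) \<in> borel_measurable (dA \<Otimes>\<^sub>M dA)"
    by measurable
  then have [measurable]: "(\<lambda>z. \<integral>w. k z w * f w \<partial>dA) \<in> borel_measurable dA"
    by (intro dA.borel_measurable_lebesgue_integral) (simp add: case_prod_beta')
  show ?thesis unfolding int_op_def by measurable
qed

lemma kernel_mult_measurable:
  assumes k: "k = T_ker b c \<or> k = S_ker b c" and [measurable]: "f \<in> borel_measurable dA"
  shows "(\<lambda>w. k z w * f w) \<in> borel_measurable dA"
  using k by auto

lemma nn_integral_kernel_eq_hop:
  assumes k: "k = T_ker b c \<or> k = S_ker b c" and c: "c = a + b + 2 + \<delta>"
    and [measurable]: "f \<in> borel_measurable dA" and z: "cmod z < 1"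
  shows "ennreal (defect z powr a) * (\<integral>\<^sup>+ w. ennreal (cmod (k z w * f w)) \<partial>dA)
    = ennreal (defect z powr - \<delta>) * hop (a + \<delta>) b (\<lambda>w. cmod (f w)) z"
proof -
  define v where "v = defect z"
  have v: "0 < v" using one_minus_cmod_sq_pos[OF z] by (simp add: v_def)
  have "ennreal (v powr a) * (\<integral>\<^sup>+ w. ennreal (cmod (k z w * f w)) \<partial>dA)
      = (\<integral>\<^sup>+ w. ennreal (v powr a) * ennreal (cmod (k z w * f w)) \<partial>dA)"
    by (intro nn_integral_cmult[symmetric] measurable_compose[OF kernel_mult_measurable[OF k assms(3)]]) measurable
  also have "\<dots> = (\<integral>\<^sup>+ w. ennreal (v powr - \<delta>) * (ennreal (hker (a + \<delta>) b z w) * ennreal (cmod (f w))) \<partial>dA)"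
  proof (rule nn_integral_cong)
    fix w
    have "cmod (k z w) = defect w powr b / cmod (1 - z * cnj w) powr c"
      using k norm_T_ker norm_S_ker by auto
    moreover have "c = 2 + (a + \<delta>) + b" by (simp add: c)
    ultimately have "cmod (k z w) = defect w powr b * cmod (1 - z * cnj w) powr - (2 + (a + \<delta>) + b)"
      by (simp only: powr_minus_divide) simp
    moreover have "v powr a = v powr - \<delta> * v powr (a + \<delta>)" by (simp flip: powr_add)
    ultimately have "v powr a * cmod (k z w * f w) = v powr - \<delta> * (hker (a + \<delta>) b z w * cmod (f w))"
      by (simp only: norm_mult hker_def v_def mult_ac)
    then show "ennreal (v powr a) * ennreal (cmod (k z w * f w)) =
        ennreal (v powr - \<delta>) * (ennreal (hker (a + \<delta>) b z w) * ennreal (cmod (f w)))"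
      by (simp add: hker_nonneg flip: ennreal_mult)
  qed
  also have "\<dots> = ennreal (v powr - \<delta>) * hop (a + \<delta>) b (\<lambda>w. cmod (f w)) z"
    unfolding hop_def by (rule nn_integral_cmult) measurable
  finally show ?thesis by (simp add: v_def)
qed

lemma cmod_int_op_le:
  assumes k: "k = T_ker b c \<or> k = S_ker b c" and c: "c = a + b + 2 + \<delta>"
    and f[measurable]: "f \<in> borel_measurable dA" and z: "cmod z < 1"
  shows "ennreal (cmod (int_op a k f z)) \<le> ennreal (defect z powr - \<delta>) * hop (a + \<delta>) b (\<lambda>w. cmod (f w)) z"
proof -
  \<comment> \<open>Where the integrand is not integrable the Bochner integral is 0, so the
    inequality holds there as well.\<close>
  have "ennreal (cmod (\<integral>w. k z w * f w \<partial>dA)) \<le> (\<integral>\<^sup>+ w. ennreal (cmod (k z w * f w)) \<partial>dA)"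
    by (cases "integrable dA (\<lambda>w. k z w * f w)")
      (simp_all add: integral_norm_bound_ennreal not_integrable_integral_eq)
  then have "ennreal (defect z powr a) * ennreal (cmod (\<integral>w. k z w * f w \<partial>dA))
    \<le> ennreal (defect z powr a) * (\<integral>\<^sup>+ w. ennreal (cmod (k z w * f w)) \<partial>dA)"
    by (rule mult_left_mono) simp
  also have "\<dots> = ennreal (defect z powr - \<delta>) * hop (a + \<delta>) b (\<lambda>w. cmod (f w)) z"
    by (rule nn_integral_kernel_eq_hop[OF k c f z])
  finally show ?thesis by (simp add: int_op_def norm_mult flip: ennreal_mult)
qed

lemma integrable_kernel:
  assumes k: "k = T_ker b c \<or> k = S_ker b c" and c: "c = a + b + 2 + \<delta>"
    and f[measurable]: "f \<in> borel_measurable dA" and z: "cmod z < 1"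
    and fin: "hop (a + \<delta>) b (\<lambda>w. cmod (f w)) z < \<infinity>"
  shows "integrable dA (\<lambda>w. k z w * f w)"
proof (rule integrableI_bounded)
  show "(\<lambda>w. k z w * f w) \<in> borel_measurable dA" by (rule kernel_mult_measurable[OF k f])
  have "ennreal (defect z powr a) * (\<integral>\<^sup>+ w. ennreal (cmod (k z w * f w)) \<partial>dA) < \<infinity>"
    unfolding nn_integral_kernel_eq_hop[OF k c f z]
    using fin by (simp add: ennreal_mult_less_top)
  then show "(\<integral>\<^sup>+ w. ennreal (cmod (k z w * f w)) \<partial>dA) < \<infinity>"
    using one_minus_cmod_sq_pos[OF z] by (auto simp: ennreal_mult_less_top ennreal_eq_0_iff)
qed

lemma weak_norm_leI:
  fixes q B :: real
  assumes q: "0 < q" and B: "0 \<le> B"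
    and le: "\<And>t. 0 < t \<Longrightarrow> emeasure dA {z \<in> space dA. t < cmod (h z)} \<le> ennreal ((B / t) powr q)"
  shows "weak_norm (ereal q) h \<le> ennreal B"
proof -
  have "t * distr_fun h t powr (1 / q) \<le> B" if t: "0 < t" for t
  proof -
    have "distr_fun h t \<le> (B / t) powr q"
      using le[OF t] unfolding distr_fun_def dA.emeasure_eq_measure by simp
    then have "distr_fun h t powr (1 / q) \<le> ((B / t) powr q) powr (1 / q)"
      using q by (intro powr_mono2) (auto simp: distr_fun_def)
    also have "\<dots> = B / t" using q B t by (simp add: powr_powr)
    finally show ?thesis using t by (simp add: field_simps)
  qed
  then show ?thesis unfolding weak_norm_def by (auto intro!: SUP_least ennreal_leI)
qed

text \<open>As \<open>dA\<close> is a probability measure, \<open>distr_fun\<close> is at most 1 and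
  its powers decrease in the exponent. This yields all targets below the critical one in the Lorentz
  estimate.\<close>

lemma weak_norm_mono_exponent:
  fixes q q' :: real
  assumes "0 < q'" "q' \<le> q"
  shows "weak_norm (ereal q') h \<le> weak_norm (ereal q) h"
proof -
  have "distr_fun h t powr (1 / q') \<le> distr_fun h t powr (1 / q)" for t
    using assms by (intro powr_mono') (auto simp: distr_fun_def field_simps)
  note le = this
  have "(SUP t\<in>{0<..}. ennreal (t * distr_fun h t powr (1 / q'))) \<le> (SUP t\<in>{0<..}. ennreal (t * distr_fun h t powr (1 / q)))"
  proof (rule SUP_mono)
    fix t :: real assume "t \<in> {0<..}"
    then show "\<exists>s\<in>{0<..}. ennreal (t * distr_fun h t powr (1 / q')) \<le> ennreal (s * distr_fun h s powr (1 / q))"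
      by (intro bexI[of _ t] ennreal_leI mult_left_mono le) auto
  qed
  then show ?thesis by (simp add: weak_norm_def)
qed

text \<open>One weak-type bound for the positive majorant yields both requirements. The majorant
  dominates the operator, and the set where it is infinite lies in all its superlevel sets, whose
  measures tend to 0, so the defining integral converges absolutely almost everywhere.\<close>

lemma maps_boundedlyI:
  fixes q C :: real
  assumes k: "k = T_ker b c \<or> k = S_ker b c" and c: "c = a + b + 2 + \<delta>" and q: "0 < q" and C: "0 \<le> C"
    and weak: "\<And>f t. f \<in> borel_measurable dA \<Longrightarrow> NX f < \<infinity> \<Longrightarrow> 0 < t \<Longrightarrow>
      emeasure dA {z \<in> space dA. ennreal t < ennreal (defect z powr - \<delta>) * hop (a + \<delta>) b (\<lambda>w. cmod (f w)) z}
        \<le> ennreal ((C * enn2real (NX f) / t) powr q)"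
  shows "maps_boundedly a k NX (weak_norm (ereal q))"
  unfolding maps_boundedly_def
proof (rule exI[of _ C], intro conjI C ballI impI)
  fix f assume f[measurable]: "f \<in> borel_measurable dA" and fin: "NX f < \<infinity>"
  let ?G = "\<lambda>z. ennreal (defect z powr - \<delta>) * hop (a + \<delta>) b (\<lambda>w. cmod (f w)) z"
  define N where "N = enn2real (NX f)"
  have N: "0 \<le> N" "NX f = ennreal N" using fin by (auto simp: N_def)
  show "int_op a k f \<in> borel_measurable dA" by (rule int_op_measurable[OF k f])
  show "AE z in dA. integrable dA (\<lambda>w. k z w * f w)"
  proof -
    have "emeasure dA {z \<in> space dA. ?G z = \<infinity>} \<le> 0 + ennreal e" if e: "0 < e" for e :: real
    proof -
      \<comment> \<open>Chosen so that (C N / t)^q \<le> e. The summand 1 keeps t positive when C N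
        = 0.\<close>
      define t where "t = (C * N + 1) / e powr (1 / q)"
      have t: "0 < t" using e C N by (simp add: t_def add_nonneg_pos)
      have "emeasure dA {z \<in> space dA. ?G z = \<infinity>} \<le> emeasure dA {z \<in> space dA. ennreal t < ?G z}"
      proof (rule emeasure_mono)
        show "{z \<in> space dA. ?G z = \<infinity>} \<subseteq> {z \<in> space dA. ennreal t < ?G z}" by auto
      qed measurable
      also have "\<dots> \<le> ennreal ((C * N / t) powr q)" unfolding N_def by (rule weak[OF f fin t])
      also have "\<dots> \<le> ennreal ((e powr (1 / q)) powr q)"
      proof (intro ennreal_leI powr_mono2)
        have "0 \<le> C * N" using C N by simp
        then have "C * N / (C * N + 1) \<le> 1" by (simp add: divide_le_eq_1)
        then have "C * N / (C * N + 1) * e powr (1 / q) \<le> 1 * e powr (1 / q)" by (intro mult_right_mono) auto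
        then show "C * N / t \<le> e powr (1 / q)" by (simp add: t_def)
      qed (use C N t q in auto)
      also have "\<dots> = ennreal e" using q e by (simp add: powr_powr)
      finally show ?thesis by simp
    qed
    then have "emeasure dA {z \<in> space dA. ?G z = \<infinity>} \<le> 0" by (rule ennreal_le_epsilon)
    then have "emeasure dA {z \<in> space dA. ?G z = \<infinity>} = 0" by (simp only: le_zero_eq)
    moreover have "{z \<in> space dA. ?G z = \<infinity>} \<in> sets dA" by measurable
    ultimately have "{z \<in> space dA. ?G z = \<infinity>} \<in> null_sets dA" by (rule null_setsI)
    then have "AE z in dA. z \<notin> {z \<in> space dA. ?G z = \<infinity>}" by (rule AE_not_in)
    then show ?thesis
    proof (rule AE_mp[OF _ AE_I2])
      fix z assume "z \<in> space dA"
      then have z: "cmod z < 1" by simp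
      have "hop (a + \<delta>) b (\<lambda>w. cmod (f w)) z < \<infinity>" if "?G z \<noteq> \<infinity>"
        using that one_minus_cmod_sq_pos[OF z]
        by (auto simp: ennreal_mult_eq_top_iff ennreal_eq_0_iff top.not_eq_extremum)
      then show "z \<notin> {z \<in> space dA. ?G z = \<infinity>} \<longrightarrow> integrable dA (\<lambda>w. k z w * f w)"
        using integrable_kernel[OF k c f z] z by auto
    qed
  qed
  show "weak_norm (ereal q) (int_op a k f) \<le> ennreal C * NX f"
  proof -
    have "weak_norm (ereal q) (int_op a k f) \<le> ennreal (C * N)"
    proof (rule weak_norm_leI[OF q])
      fix t :: real assume t: "0 < t"
      have "emeasure dA {z \<in> space dA. t < cmod (int_op a k f z)} \<le> emeasure dA {z \<in> space dA. ennreal t < ?G z}"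
      proof (rule emeasure_mono)
        show "{z \<in> space dA. t < cmod (int_op a k f z)} \<subseteq> {z \<in> space dA. ennreal t < ?G z}"
        proof
          fix z assume z: "z \<in> {z \<in> space dA. t < cmod (int_op a k f z)}"
          then have "ennreal t < ennreal (cmod (int_op a k f z))" using t by (simp add: ennreal_less_iff)
          also have "\<dots> \<le> ?G z" using z by (intro cmod_int_op_le[OF k c f]) simp
          finally show "z \<in> {z \<in> space dA. ennreal t < ?G z}" using z by simp
        qed
      qed measurable
      also have "\<dots> \<le> ennreal ((C * N / t) powr q)" unfolding N_def by (rule weak[OF f fin t])
      finally show "emeasure dA {z \<in> space dA. t < cmod (int_op a k f z)} \<le> ennreal ((C * N / t) powr q)" .
    qed (use C N in simp)
    then show ?thesis using C N by (simp add: ennreal_mult)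
  qed
qed

lemma maps_boundedly_Lp:
  fixes p :: real
  assumes k: "k = T_ker b c \<or> k = S_ker b c" and c: "c = a + b + 2 + \<delta>"
    and b: "-1 < b" "b < 0" and \<delta>: "0 < \<delta>" "0 \<le> a + \<delta>" and p: "0 < p" "1 < p * (b + 1)"
  shows "maps_boundedly a k (Lp_norm (ereal p)) (weak_norm (ereal (p / (1 + p * \<delta>))))"
proof -
  define q where "q = p / (1 + p * \<delta>)"
  have q: "0 < q" using p \<delta> by (simp add: q_def add_pos_nonneg)
  obtain C where C: "0 < C" "\<And>g \<mu>. g \<in> borel_measurable dA \<Longrightarrow> (\<And>w. 0 \<le> g w) \<Longrightarrow> 0 < \<mu> \<Longrightarrow>
    emeasure dA {z \<in> space dA. ennreal \<mu> < hop (a + \<delta>) b g z}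
      \<le> ennreal (C * \<mu> powr - p) * (\<integral>\<^sup>+ w. ennreal (g w powr p) \<partial>dA)"
    by (rule hop_weak_type[OF \<delta>(2) b p(2)]) blast
  show ?thesis
    unfolding q_def[symmetric]
  proof (rule maps_boundedlyI[OF k c q, of "2 powr (1 / q) * C powr (1 / p)"])
    fix f :: "complex \<Rightarrow> complex" and t :: real
    assume f[measurable]: "f \<in> borel_measurable dA" and fin: "Lp_norm (ereal p) f < \<infinity>" and t: "0 < t"
    define I where "I = (\<integral>\<^sup>+ w. ennreal (cmod (f w) powr p) \<partial>dA)"
    have I: "I \<noteq> \<infinity>" using fin by (auto simp: Lp_norm_def ennpowr_def I_def)
    define J where "J = enn2real I"
    have J: "0 \<le> J" "I = ennreal J" using I by (auto simp: J_def less_top)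
    have N: "enn2real (Lp_norm (ereal p) f) = J powr (1 / p)"
      using I by (simp add: Lp_norm_def ennpowr_def I_def[symmetric] J_def)
    have "emeasure dA {z \<in> space dA. ennreal t < ennreal (defect z powr - \<delta>) * hop (a + \<delta>) b (\<lambda>w. cmod (f w)) z}
      \<le> ennreal ((2 powr (1 / q) * (C powr (1 / p) * J powr (1 / p)) / t) powr q)"
      unfolding q_def
    proof (rule weak_type_mult_powr[OF _ _ p(1) \<delta>(1) t])
      fix \<mu> :: real assume \<mu>: "0 < \<mu>"
      have "emeasure dA {z \<in> space dA. ennreal \<mu> < hop (a + \<delta>) b (\<lambda>w. cmod (f w)) z}
        \<le> ennreal (C * \<mu> powr - p) * I"
        unfolding I_def by (rule C(2)) (use \<mu> in auto)
      also have "\<dots> = ennreal ((C powr (1 / p) * J powr (1 / p) / \<mu>) powr p)"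
        using C(1) J \<mu> p by (simp add: powr_mult powr_divide powr_powr powr_minus_divide flip: ennreal_mult)
      finally show "emeasure dA {z \<in> space dA. ennreal \<mu> < hop (a + \<delta>) b (\<lambda>w. cmod (f w)) z}
        \<le> ennreal ((C powr (1 / p) * J powr (1 / p) / \<mu>) powr p)" .
    qed auto
    then show "emeasure dA {z \<in> space dA. ennreal t < ennreal (defect z powr - \<delta>) * hop (a + \<delta>) b (\<lambda>w. cmod (f w)) z}
      \<le> ennreal ((2 powr (1 / q) * C powr (1 / p) * enn2real (Lp_norm (ereal p) f) / t) powr q)"
      by (simp add: N mult.assoc)
  qed simp
qed

text \<open>With Forelli-Rudin exponent \<gamma> = a + \<delta> > 0 the homogeneous operator is
  bounded on bounded functions. Superlevel sets of the majorant then lie in a collar, which replaces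
  \<open>weak_type_mult_powr\<close> in the limiting case of infinite p.\<close>

lemma maps_boundedly_Linf:
  assumes k: "k = T_ker b c \<or> k = S_ker b c" and c: "c = a + b + 2 + \<delta>"
    and b: "-1 < b" and \<delta>: "0 < \<delta>" "0 < a + \<delta>"
  shows "maps_boundedly a k (Lp_norm \<infinity>) (weak_norm (ereal (1 / \<delta>)))"
proof -
  obtain C where C: "0 < C" "\<And>z. cmod z < 1 \<Longrightarrow>
    (\<integral>\<^sup>+ w. ennreal (defect w powr b * cmod (1 - z * cnj w) powr - (2 + b + (a + \<delta>))) \<partial>dA)
      \<le> ennreal (C * defect z powr - (a + \<delta>))"
    by (rule forelli_rudin[OF b \<delta>(2)]) blast
  show ?thesis
  proof (rule maps_boundedlyI[OF k c, of "1 / \<delta>" C])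
    fix f :: "complex \<Rightarrow> complex" and t :: real
    assume f[measurable]: "f \<in> borel_measurable dA" and fin: "Lp_norm \<infinity> f < \<infinity>" and t: "0 < t"
    define M where "M = enn2real (Lp_norm \<infinity> f)"
    have M: "0 \<le> M" "Lp_norm \<infinity> f = ennreal M" using fin by (auto simp: M_def)
    have "AE w in dA. ennreal (cmod (f w)) \<le> Lp_norm \<infinity> f"
      using esssup_AE[of "\<lambda>w. ennreal (cmod (f w))" dA] by (simp add: Lp_norm_def)
    then have AE_M: "AE w in dA. cmod (f w) \<le> M" using M by simp
    have hop_le: "hop (a + \<delta>) b (\<lambda>w. cmod (f w)) z \<le> ennreal (C * M)" if z: "cmod z < 1" for z
    proof -
      define v where "v = defect z"
      have v: "0 < v" using one_minus_cmod_sq_pos[OF z] by (simp add: v_def)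
      have "hop (a + \<delta>) b (\<lambda>w. cmod (f w)) z
        \<le> (\<integral>\<^sup>+ w. ennreal (M * v powr (a + \<delta>)) * ennreal (defect w powr b * cmod (1 - z * cnj w) powr - (2 + b + (a + \<delta>))) \<partial>dA)"
        unfolding hop_def
      proof (rule nn_integral_mono_AE)
        show "AE w in dA. ennreal (hker (a + \<delta>) b z w) * ennreal (cmod (f w)) \<le>
          ennreal (M * v powr (a + \<delta>)) * ennreal (defect w powr b * cmod (1 - z * cnj w) powr - (2 + b + (a + \<delta>)))"
          using AE_M
        proof eventually_elim
          fix w assume "cmod (f w) \<le> M"
          then have "hker (a + \<delta>) b z w * cmod (f w) \<le> hker (a + \<delta>) b z w * M"
            by (intro mult_left_mono hker_nonneg)
          also have "\<dots> = M * v powr (a + \<delta>) * (defect w powr b * cmod (1 - z * cnj w) powr - (2 + b + (a + \<delta>)))"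
            by (simp add: hker_def v_def algebra_simps)
          finally show "ennreal (hker (a + \<delta>) b z w) * ennreal (cmod (f w)) \<le>
            ennreal (M * v powr (a + \<delta>)) * ennreal (defect w powr b * cmod (1 - z * cnj w) powr - (2 + b + (a + \<delta>)))"
            using M by (simp add: hker_nonneg ennreal_leI flip: ennreal_mult)
        qed
      qed
      also have "\<dots> = ennreal (M * v powr (a + \<delta>)) * (\<integral>\<^sup>+ w. ennreal (defect w powr b * cmod (1 - z * cnj w) powr - (2 + b + (a + \<delta>))) \<partial>dA)"
        by (rule nn_integral_cmult) measurable
      also have "\<dots> \<le> ennreal (M * v powr (a + \<delta>)) * ennreal (C * v powr - (a + \<delta>))"
        unfolding v_def by (intro mult_left_mono C(2) z) simp
      also have "\<dots> = ennreal (C * M)"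
        using M C(1) v powr_add[of v "a + \<delta>" "- (a + \<delta>)"] by (simp add: mult_ac flip: ennreal_mult)
      finally show ?thesis .
    qed
    have "emeasure dA {z \<in> space dA. ennreal t < ennreal (defect z powr - \<delta>) * hop (a + \<delta>) b (\<lambda>w. cmod (f w)) z}
       \<le> emeasure dA {z \<in> space dA. defect z < (C * M / t) powr (1 / \<delta>)}"
    proof (rule emeasure_mono)
      show "{z \<in> space dA. ennreal t < ennreal (defect z powr - \<delta>) * hop (a + \<delta>) b (\<lambda>w. cmod (f w)) z}
        \<subseteq> {z \<in> space dA. defect z < (C * M / t) powr (1 / \<delta>)}"
      proof
        fix z assume *: "z \<in> {z \<in> space dA. ennreal t < ennreal (defect z powr - \<delta>) * hop (a + \<delta>) b (\<lambda>w. cmod (f w)) z}"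
        then have z: "cmod z < 1" by simp
        define v where "v = defect z"
        have v: "0 < v" using one_minus_cmod_sq_pos[OF z] by (simp add: v_def)
        have "ennreal t < ennreal (v powr - \<delta>) * hop (a + \<delta>) b (\<lambda>w. cmod (f w)) z" using * by (simp add: v_def)
        also have "\<dots> \<le> ennreal (v powr - \<delta>) * ennreal (C * M)" by (intro mult_left_mono hop_le z) simp
        also have "\<dots> = ennreal (v powr - \<delta> * (C * M))" using C(1) M by (simp add: ennreal_mult)
        finally have "t < v powr - \<delta> * (C * M)" using t by (simp add: ennreal_less_iff)
        then have "v powr \<delta> < C * M / t" using t v by (simp add: powr_minus field_simps)
        then have "(v powr \<delta>) powr (1 / \<delta>) < (C * M / t) powr (1 / \<delta>)" using \<delta> by (intro powr_less_mono2) auto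
        then have "v < (C * M / t) powr (1 / \<delta>)" using \<delta> v by (simp add: powr_powr)
        then show "z \<in> {z \<in> space dA. defect z < (C * M / t) powr (1 / \<delta>)}"
          using z by (simp add: v_def)
      qed
    qed measurable
    also have "\<dots> \<le> ennreal ((C * M / t) powr (1 / \<delta>))" by (rule emeasure_dA_collar_le) simp
    finally show "emeasure dA {z \<in> space dA. ennreal t < ennreal (defect z powr - \<delta>) * hop (a + \<delta>) b (\<lambda>w. cmod (f w)) z}
      \<le> ennreal ((C * enn2real (Lp_norm \<infinity> f) / t) powr (1 / \<delta>))"
      by (simp add: M_def)
  qed (use \<delta> C in auto)
qed

lemma maps_boundedly_lorentz:
  fixes q' :: real
  assumes k: "k = T_ker b c \<or> k = S_ker b c" and c: "c = a + b + 2 + \<delta>"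
    and b: "-1 < b" "b < 0" and \<delta>: "0 < \<delta>" "0 \<le> a + \<delta>" and q': "0 < q'" "b + 1 + \<delta> \<le> 1 / q'"
  shows "maps_boundedly a k (lorentz1_norm (1 / (b + 1))) (weak_norm (ereal q'))"
proof -
  define p where "p = 1 / (b + 1)"
  have p: "0 < p" "1 / p = b + 1" using b by (auto simp: p_def)
  define q where "q = p / (1 + p * \<delta>)"
  have q: "0 < q" using p \<delta> by (simp add: q_def add_pos_nonneg)
  \<comment> \<open>The critical target: b + 1 + \<delta> equals c - 1 - a, the lower end of the
    admissible range of 1 / q'.\<close>
  have "1 / q = b + 1 + \<delta>" using p by (simp add: q_def add_divide_distrib)
  then have "1 / q \<le> 1 / q'" using q' by simp
  then have "q' \<le> q" using q' q by (simp add: field_simps)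
  obtain C where C: "0 < C" "\<And>g N \<mu>. g \<in> borel_measurable dA \<Longrightarrow> (\<And>w. 0 \<le> g w) \<Longrightarrow> 0 < \<mu> \<Longrightarrow> 0 \<le> N \<Longrightarrow>
    (\<integral>\<^sup>+ s\<in>{0<..}. ennreal (measure dA {w \<in> space dA. s < g w} powr (b + 1)) \<partial>lborel) \<le> ennreal N \<Longrightarrow>
    emeasure dA {z \<in> space dA. ennreal \<mu> < hop (a + \<delta>) b g z} \<le> ennreal ((C * N / \<mu>) powr (1 / (b + 1)))"
    by (rule hop_lorentz_weak_type[OF \<delta>(2) b]) blast
  have "maps_boundedly a k (lorentz1_norm p) (weak_norm (ereal q))"
  \<comment> \<open>The division by p offsets the factor p in \<open>lorentz1_norm\<close>.\<close>
  proof (rule maps_boundedlyI[OF k c q, of "2 powr (1 / q) * C / p"])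
    fix f :: "complex \<Rightarrow> complex" and t :: real
    assume f[measurable]: "f \<in> borel_measurable dA" and fin: "lorentz1_norm p f < \<infinity>" and t: "0 < t"
    define I where "I = (\<integral>\<^sup>+ s\<in>{0<..}. ennreal (measure dA {w \<in> space dA. s < cmod (f w)} powr (b + 1)) \<partial>lborel)"
    have lI: "lorentz1_norm p f = ennreal p * I"
      by (simp add: lorentz1_norm_def I_def distr_fun_def p(2))
    have I: "I < \<infinity>" using fin p(1) unfolding lI by (auto simp: ennreal_mult_less_top)
    define N where "N = enn2real I"
    have N: "0 \<le> N" "I = ennreal N" using I by (auto simp: N_def)
    have "emeasure dA {z \<in> space dA. ennreal t < ennreal (defect z powr - \<delta>) * hop (a + \<delta>) b (\<lambda>w. cmod (f w)) z}
      \<le> ennreal ((2 powr (1 / q) * (C * N) / t) powr q)"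
      unfolding q_def
    proof (rule weak_type_mult_powr[OF _ _ p(1) \<delta>(1) t])
      fix \<mu> :: real assume \<mu>: "0 < \<mu>"
      show "emeasure dA {z \<in> space dA. ennreal \<mu> < hop (a + \<delta>) b (\<lambda>w. cmod (f w)) z} \<le> ennreal ((C * N / \<mu>) powr p)"
        unfolding p_def by (rule C(2)) (use \<mu> N in \<open>auto simp: I_def\<close>)
    qed (use C N in auto)
    moreover have "enn2real (lorentz1_norm p f) = p * N"
      unfolding lI N(2) using p N by (simp flip: ennreal_mult)
    ultimately show "emeasure dA {z \<in> space dA. ennreal t < ennreal (defect z powr - \<delta>) * hop (a + \<delta>) b (\<lambda>w. cmod (f w)) z}
      \<le> ennreal ((2 powr (1 / q) * C / p * enn2real (lorentz1_norm p f) / t) powr q)"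
      using p(1) by (simp add: mult.assoc)
  qed (use C p in simp)
  then show ?thesis
    unfolding maps_boundedly_def p_def[symmetric]
    using weak_norm_mono_exponent[OF q'(1) \<open>q' \<le> q\<close>] by (meson order_trans)
qed

section \<open>Divergence at the endpoint\<close>

text \<open>In the variable 1 - ln u the integrand is a power with exponent -p < -1 on a half-line.
  Truncation at exp(-n) keeps the fundamental theorem on compact intervals, and monotone convergence
  removes it.\<close>

lemma nn_integral_log_powr_finite:
  fixes p :: real
  assumes p: "1 < p"
  shows "(\<integral>\<^sup>+ u. ennreal (inverse u * (1 - ln u) powr - p) * indicator {0<..<1} u \<partial>lborel) < \<infinity>"
proof -
  let ?g = "\<lambda>u::real. inverse u * (1 - ln u) powr - p"
  let ?F = "\<lambda>u::real. (1 - ln u) powr (1 - p) / (p - 1)"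
  have "(\<integral>\<^sup>+ u. ennreal (?g u) * indicator {exp (- real n)..1} u \<partial>lborel) \<le> ennreal (1 / (p - 1))" for n
  proof -
    have "(\<integral>\<^sup>+ u. ennreal (?g u) * indicator {exp (- real n)..1} u \<partial>lborel) = ennreal (?F 1 - ?F (exp (- real n)))"
    proof (rule nn_integral_FTC_Icc)
      fix u :: real assume "u \<in> {exp (- real n)..1}"
      then have u: "exp (- real n) \<le> u" "u \<le> 1" by auto
      then have u0: "0 < u" by (meson exp_gt_zero less_le_trans)
      then have "0 < 1 - ln u" using u by (smt (verit) ln_le_zero_iff)
      then show "(?F has_real_derivative ?g u) (at u)"
        using p u0 by (auto intro!: derivative_eq_intros simp: divide_simps) (simp add: algebra_simps)
      show "0 \<le> ?g u" using u0 by simp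
    qed auto
    also have "\<dots> \<le> ennreal (1 / (p - 1))" using p by (intro ennreal_leI) simp
    finally show ?thesis .
  qed
  moreover have "(\<lambda>n. \<integral>\<^sup>+ u. ennreal (?g u) * indicator {exp (- real n)..1} u \<partial>lborel)
    \<longlonglongrightarrow> (\<integral>\<^sup>+ u. ennreal (?g u) * indicator {0<..1} u \<partial>lborel)"
  proof (rule nn_integral_LIMSEQ)
    show "incseq (\<lambda>n u. ennreal (?g u) * indicator {exp (- real n)..1} u)"
      by (auto intro!: incseq_SucI le_funI mult_left_mono simp: indicator_def) (smt (verit) exp_le_cancel_iff)
    fix u :: real
    show "(\<lambda>n. ennreal (?g u) * indicator {exp (- real n)..1} u) \<longlonglongrightarrow> ennreal (?g u) * indicator {0<..1} u"
    proof (cases "u \<in> {0<..1}")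
      case True
      obtain N where N: "- ln u < real N" using reals_Archimedean2 by blast
      have "exp (- real n) \<le> u" if "N \<le> n" for n
      proof -
        have "- real n \<le> ln u" using N that by simp
        then have "exp (- real n) \<le> exp (ln u)" by (simp only: exp_le_cancel_iff)
        also have "exp (ln u) = u" using True by simp
        finally show ?thesis .
      qed
      then have "eventually (\<lambda>n. ennreal (?g u) * indicator {exp (- real n)..1} u = ennreal (?g u) * indicator {0<..1} u) sequentially"
        using True by (intro eventually_sequentiallyI[of N]) (auto simp: indicator_def)
      then show ?thesis by (rule tendsto_eventually)
    next
      case False
      then have "u \<notin> {exp (- real n)..1}" for n
        by (auto simp: not_le intro: le_less_trans[OF _ exp_gt_zero])
      then show ?thesis using False by simp
    qed
  qed measurable
  ultimately have le: "(\<integral>\<^sup>+ u. ennreal (?g u) * indicator {0<..1} u \<partial>lborel) \<le> ennreal (1 / (p - 1))"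
    by (intro LIMSEQ_le_const2) auto
  have "(\<integral>\<^sup>+ u. ennreal (?g u) * indicator {0<..<1} u \<partial>lborel) \<le> (\<integral>\<^sup>+ u. ennreal (?g u) * indicator {0<..1} u \<partial>lborel)"
    by (rule nn_integral_mono) (simp add: indicator_def)
  also note le
  also have "ennreal (1 / (p - 1)) < \<infinity>" by simp
  finally show ?thesis .
qed

text \<open>The borderline exponent of the same substitution: the part over [exp(-n), 1] equals ln
  (1 + n).\<close>

lemma nn_integral_log_infinite:
  "(\<integral>\<^sup>+ u. ennreal (inverse u * inverse (1 - ln u)) * indicator {0<..<1} u \<partial>lborel) = \<infinity>"
proof -
  let ?g = "\<lambda>u::real. inverse u * inverse (1 - ln u)"
  let ?I = "\<integral>\<^sup>+ u. ennreal (?g u) * indicator {0<..<1} u \<partial>lborel"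
  have ge: "ennreal (ln (1 + real n)) \<le> ?I" for n
  proof -
    have "(\<integral>\<^sup>+ u. ennreal (?g u) * indicator {exp (- real n)..1} u \<partial>lborel)
        = ennreal (- ln (1 - ln 1) - - ln (1 - ln (exp (- real n))))"
    proof (rule nn_integral_FTC_Icc[where F = "\<lambda>u. - ln (1 - ln u)"])
      fix u :: real assume "u \<in> {exp (- real n)..1}"
      then have u: "exp (- real n) \<le> u" "u \<le> 1" by auto
      then have u0: "0 < u" by (meson exp_gt_zero less_le_trans)
      then have pos: "0 < 1 - ln u" using u by (smt (verit) ln_le_zero_iff)
      then show "((\<lambda>u. - ln (1 - ln u)) has_real_derivative ?g u) (at u)"
        using u0 by (auto intro!: derivative_eq_intros simp: divide_simps)
      show "0 \<le> ?g u" using u0 pos by simp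
    qed auto
    moreover have "(\<integral>\<^sup>+ u. ennreal (?g u) * indicator {exp (- real n)..1} u \<partial>lborel) \<le> ?I"
    proof (rule nn_integral_mono_AE)
      show "AE u in lborel. ennreal (?g u) * indicator {exp (- real n)..1} u \<le> ennreal (?g u) * indicator {0<..<1} u"
        using AE_lborel_singleton[of 1]
        by eventually_elim (auto simp: indicator_def intro: less_le_trans[OF exp_gt_zero])
    qed
    ultimately show ?thesis by simp
  qed
  show ?thesis
  proof (rule ccontr)
    assume "?I \<noteq> \<infinity>"
    then obtain r where r: "0 \<le> r" "?I = ennreal r" by (cases ?I) auto
    then have "ln (1 + real n) \<le> r" for n using ge[of n] by simp
    moreover obtain n where "exp r < real n" using reals_Archimedean2 by blast
    ultimately have "ln (1 + real n) \<le> ln (exp r)" "exp r < 1 + real n" by auto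
    then show False by (smt (verit) exp_gt_zero ln_le_cancel_iff)
  qed
qed

text \<open>At \<open>p = 1 / (b + 1)\<close> the weight \<open>(1 - |w|\<^sup>2) powr b\<close> just fails to be in the dual of
  \<open>L\<^sup>p\<close>, so for a suitable \<open>f\<close> the defining integrals converge at no point at all.\<close>

lemma not_maps_boundedly_endpoint:
  assumes k: "k = T_ker b c \<or> k = S_ker b c" and b: "-1 < b" "b < 0" and c: "0 \<le> c"
  shows "\<not> maps_boundedly a k (Lp_norm (ereal (1 / (b + 1)))) NY"
proof
  assume bdd: "maps_boundedly a k (Lp_norm (ereal (1 / (b + 1)))) NY"
  define p where "p = 1 / (b + 1)"
  have p: "1 < p" "(b + 1) * p = 1" using b by (auto simp: p_def field_simps)
  \<comment> \<open>The power u^(-(b+1)) is critical for L^p at p = 1 / (b + 1). The logarithm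
    enters the p-th power with exponent -p and makes it integrable since p > 1. Against the weight
    u^b it enters only with exponent -1, and the integral diverges.\<close>
  define \<phi> where "\<phi> u = u powr - (b + 1) * inverse (1 - ln u)" for u :: real
  define f where "f w = complex_of_real (\<phi> (defect w))" for w :: complex
  have \<phi>_meas[measurable]: "\<phi> \<in> borel_measurable borel" unfolding \<phi>_def by measurable
  have f_meas[measurable]: "f \<in> borel_measurable dA" unfolding f_def by measurable
  have ln_pos: "0 < 1 - ln u" if "0 < u" "u < 1" for u :: real
    using that by (smt (verit) ln_less_zero)
  have \<phi>_nonneg: "0 \<le> \<phi> u" if "0 < u" "u < 1" for u
    using ln_pos[OF that] by (simp add: \<phi>_def)
  have "(\<integral>\<^sup>+ w. ennreal (cmod (f w) powr p) \<partial>dA) = (\<integral>\<^sup>+ u. ennreal (\<bar>\<phi> u\<bar> powr p) * indicator {0<..<1} u \<partial>lborel)"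
    unfolding f_def norm_of_real by (rule nn_integral_dA_radial) measurable
  also have "\<dots> = (\<integral>\<^sup>+ u. ennreal (inverse u * (1 - ln u) powr - p) * indicator {0<..<1} u \<partial>lborel)"
  proof (rule nn_integral_cong)
    fix u :: real
    have "\<bar>\<phi> u\<bar> powr p = inverse u * (1 - ln u) powr - p" if "0 < u" "u < 1"
    proof -
      have "\<bar>\<phi> u\<bar> powr p = (u powr - (b + 1)) powr p * inverse (1 - ln u) powr p"
        using \<phi>_nonneg[OF that] ln_pos[OF that] by (simp add: \<phi>_def powr_mult)
      also have "(u powr - (b + 1)) powr p = inverse u"
        using that p(2) by (simp only: powr_powr mult_minus_left) (simp add: powr_minus)
      also have "inverse (1 - ln u) powr p = (1 - ln u) powr - p"
        using ln_pos[OF that] by (simp add: inverse_powr powr_minus)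
      finally show ?thesis .
    qed
    then show "ennreal (\<bar>\<phi> u\<bar> powr p) * indicator {0<..<1} u = ennreal (inverse u * (1 - ln u) powr - p) * indicator {0<..<1} u"
      by (simp add: indicator_def)
  qed
  also have "\<dots> < \<infinity>" by (rule nn_integral_log_powr_finite[OF p(1)])
  finally have "Lp_norm (ereal (1 / (b + 1))) f < \<infinity>"
    by (auto simp: Lp_norm_def ennpowr_def p_def)
  then have "AE z in dA. integrable dA (\<lambda>w. k z w * f w)"
    using bdd f_meas by (auto simp: maps_boundedly_def)
  moreover have "\<not> integrable dA (\<lambda>w. k z w * f w)" if z: "cmod z < 1" for z
  proof
    assume "integrable dA (\<lambda>w. k z w * f w)"
    then have "(\<integral>\<^sup>+ w. ennreal (cmod (k z w * f w)) \<partial>dA) < \<infinity>" by (simp add: integrable_iff_bounded)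
    moreover have "(\<integral>\<^sup>+ w. ennreal (cmod (k z w * f w)) \<partial>dA) \<ge> (\<integral>\<^sup>+ w. ennreal (2 powr - c) * ennreal (defect w powr b * \<phi> (defect w)) \<partial>dA)"
    proof (rule nn_integral_mono)
      fix w assume "w \<in> space dA"
      then have w: "cmod w < 1" by simp
      have u: "0 < defect w" using one_minus_cmod_sq_pos[OF w] .
      \<comment> \<open>At w = 0 the defect is 1, an endpoint that \<open>\<phi>_nonneg\<close>
        leaves out.\<close>
      have \<phi>0: "0 \<le> \<phi> (defect w)"
      proof (cases "w = 0")
        case False
        then show ?thesis using u by (intro \<phi>_nonneg) auto
      qed (simp add: \<phi>_def)
      have pos: "0 < cmod (1 - z * cnj w)"
        by (rule less_le_trans[OF _ cmod_one_minus_ge(2)[OF z w]]) (use u in simp)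
      have "cmod (1 - z * cnj w) \<le> 1 + cmod z * cmod w"
        using norm_triangle_ineq4[of 1 "z * cnj w"] by (simp add: norm_mult)
      also have "\<dots> \<le> 2" using z w by (simp add: mult_le_one)
      finally have "2 powr - c \<le> cmod (1 - z * cnj w) powr - c"
        using c pos by (intro powr_mono2') auto
      then have "2 powr - c * (defect w powr b * \<phi> (defect w)) \<le> cmod (1 - z * cnj w) powr - c * (defect w powr b * \<phi> (defect w))"
        using \<phi>0 by (intro mult_right_mono) auto
      also have "\<dots> = cmod (k z w * f w)"
        using k norm_T_ker[of b c z w] norm_S_ker[of b c z w] \<phi>0
        by (auto simp: norm_mult f_def powr_minus_divide)
      finally show "ennreal (2 powr - c) * ennreal (defect w powr b * \<phi> (defect w)) \<le> ennreal (cmod (k z w * f w))"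
        using \<phi>0 by (simp add: ennreal_leI flip: ennreal_mult)
    qed
    moreover have "(\<integral>\<^sup>+ w. ennreal (2 powr - c) * ennreal (defect w powr b * \<phi> (defect w)) \<partial>dA)
      = ennreal (2 powr - c) * (\<integral>\<^sup>+ w. ennreal (defect w powr b * \<phi> (defect w)) \<partial>dA)"
      by (rule nn_integral_cmult) measurable
    moreover have "(\<integral>\<^sup>+ w. ennreal (defect w powr b * \<phi> (defect w)) \<partial>dA)
      = (\<integral>\<^sup>+ u. ennreal (u powr b * \<phi> u) * indicator {0<..<1} u \<partial>lborel)"
      by (rule nn_integral_dA_radial) measurable
    moreover have "\<dots> = (\<integral>\<^sup>+ u. ennreal (inverse u * inverse (1 - ln u)) * indicator {0<..<1} u \<partial>lborel)"
    proof (rule nn_integral_cong)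
      fix u :: real
      have "u powr b * \<phi> u = inverse u * inverse (1 - ln u)" if "0 < u"
        using that powr_add[of u b "- (b + 1)"] by (simp add: \<phi>_def powr_minus)
      then show "ennreal (u powr b * \<phi> u) * indicator {0<..<1} u = ennreal (inverse u * inverse (1 - ln u)) * indicator {0<..<1} u"
        by (simp add: indicator_def)
    qed
    ultimately show False by (simp add: nn_integral_log_infinite ennreal_mult_top)
  qed
  ultimately have "AE z in dA. False"
    by (elim AE_mp) (intro AE_I2, simp)
  then show False using dA.AE_const by auto
qed

section \<open>Orthogonality of monomials against radial weights\<close>

lemma integral_dA_rotate:
  fixes g :: "complex \<Rightarrow> complex"
  assumes [measurable]: "g \<in> borel_measurable borel" and u: "cmod u = 1"
  shows "(\<integral> z. g (u * z) \<partial>dA) = (\<integral> z. g z \<partial>dA)"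
proof -
  have "distr dA borel (\<lambda>z. u * z) = distr dA borel (\<lambda>z. z)"
  proof (rule measure_eqI)
    fix A :: "complex set" assume "A \<in> sets (distr dA borel (\<lambda>z. u * z))"
    then have [measurable]: "A \<in> sets borel" by simp
    have "emeasure (distr dA borel (\<lambda>z. u * z)) A = (\<integral>\<^sup>+ z. indicator A z \<partial>distr dA borel (\<lambda>z. u * z))" by simp
    also have "\<dots> = (\<integral>\<^sup>+ z. indicator A (u * z) \<partial>dA)" by (subst nn_integral_distr) (auto intro: borel_measurable_indicator)
    also have "\<dots> = (\<integral>\<^sup>+ z. indicator A z \<partial>dA)" by (rule nn_integral_dA_rotate[OF _ u]) (simp add: borel_measurable_indicator)
    also have "\<dots> = (\<integral>\<^sup>+ z. indicator A z \<partial>distr dA borel (\<lambda>z. z))" by (subst nn_integral_distr) (auto intro: borel_measurable_indicator)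
    also have "\<dots> = emeasure (distr dA borel (\<lambda>z. z)) A" by simp
    finally show "emeasure (distr dA borel (\<lambda>z. u * z)) A = emeasure (distr dA borel (\<lambda>z. z)) A" .
  qed simp
  then have "(\<integral> z. g z \<partial>distr dA borel (\<lambda>z. u * z)) = (\<integral> z. g z \<partial>distr dA borel (\<lambda>z. z))" by simp
  then show ?thesis by (subst (asm) (1 2) integral_distr) auto
qed

text \<open>The rotation by the angle pi / (j - m) turns the integrand into its negative, while
  rotation invariance leaves the integral unchanged.\<close>

lemma integral_radial_monomials_eq_0:
  fixes \<psi> :: "real \<Rightarrow> complex"
  assumes [measurable]: "\<psi> \<in> borel_measurable borel" and jm: "j \<noteq> m"
  shows "(\<integral> z. \<psi> (cmod z) * z ^ j * cnj z ^ m \<partial>dA) = 0"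
proof -
  define u where "u = cis (pi / (real j - real m))"
  have u: "cmod u = 1" by (simp add: u_def)
  have "u ^ j * cnj u ^ m = cis (real j * (pi / (real j - real m)) - real m * (pi / (real j - real m)))"
    by (simp only: u_def cis_cnj Complex.DeMoivre cis_mult mult_minus_right diff_conv_add_uminus)
  also have "real j * (pi / (real j - real m)) - real m * (pi / (real j - real m)) = pi"
    unfolding left_diff_distrib[symmetric] using jm by simp
  finally have um: "u ^ j * cnj u ^ m = - 1" by simp
  let ?g = "\<lambda>z. \<psi> (cmod z) * z ^ j * cnj z ^ m"
  have "?g (u * z) = - ?g z" for z
  proof -
    have "?g (u * z) = (u ^ j * cnj u ^ m) * ?g z"
      by (simp add: norm_mult u power_mult_distrib mult_ac)
    then show ?thesis by (simp add: um)
  qed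
  moreover have "(\<integral> z. ?g (u * z) \<partial>dA) = (\<integral> z. ?g z \<partial>dA)"
    by (rule integral_dA_rotate[OF _ u]) measurable
  ultimately have "- (\<integral> z. ?g z \<partial>dA) = (\<integral> z. ?g z \<partial>dA)" by simp
  then have "2 * (\<integral> z. ?g z \<partial>dA) = 0" by (simp only: neg_eq_iff_add_eq_0 mult_2)
  then show ?thesis by simp
qed

section \<open>Lacunary functions and random unions\<close>

text \<open>A Riesz product: the random sums are tested against
  \<open>\<Prod>k. (1 \<plusminus> \<i> sgn (y k) / sqrt n)\<close>, whose modulus is bounded independently of \<open>n\<close>.\<close>

lemma sum_abs_le_subset_sums_real:
  fixes y :: "'k \<Rightarrow> real"
  assumes A: "finite A" "A \<noteq> {}"
  shows "2 ^ card A * (\<Sum>k\<in>A. \<bar>y k\<bar>) \<le> 4 * sqrt (card A) * (\<Sum>X\<in>Pow A. \<bar>\<Sum>k\<in>X. y k\<bar>)"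
proof -
  define n where "n = card A"
  have n: "0 < n" using A by (simp add: n_def card_gt_0_iff)
  \<comment> \<open>With \<theta> = 1 / sqrt n each factor has modulus at most sqrt (1 + 1 / n), so
    a product of n of them is at most sqrt e < 2.\<close>
  define \<theta> where "\<theta> = 1 / sqrt n"
  have \<theta>: "0 < \<theta>" "\<theta>\<^sup>2 = 1 / n" using n by (auto simp: \<theta>_def power_divide)
  define f where "f k = Complex 1 (\<theta> * sgn (y k))" for k
  define g where "g k = Complex 1 (- \<theta> * sgn (y k))" for k
  \<comment> \<open>The coefficient attached to the subset X: a factor f k for k in X and the
    conjugate factor g k otherwise. Since f k + g k = 2, summing over all X that contain k leaves f
    k 2^(n-1), whose imaginary part carries the sign of y k.\<close>
  define M where "M X = prod f X * prod g (A - X)" for X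
  have fg: "f k + g k = 2" for k by (simp add: f_def g_def complex_eq_iff)
  have norm_fg: "cmod (f k) \<le> sqrt (1 + 1 / n)" "cmod (g k) \<le> sqrt (1 + 1 / n)" for k
    using \<theta>(2) by (auto simp: f_def g_def cmod_def power_mult_distrib sgn_if)
  have norm_M: "cmod (M X) \<le> 2" if X: "X \<in> Pow A" for X
  proof -
    have fin: "finite X" using X A(1) by (auto intro: finite_subset)
    have "cmod (M X) = (\<Prod>k\<in>X. cmod (f k)) * (\<Prod>k\<in>A - X. cmod (g k))"
      by (simp add: M_def norm_mult prod_norm)
    also have "\<dots> \<le> (\<Prod>k\<in>X. sqrt (1 + 1 / n)) * (\<Prod>k\<in>A - X. sqrt (1 + 1 / n))"
      using norm_fg by (intro mult_mono prod_mono prod_nonneg) auto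
    also have "\<dots> = sqrt (1 + 1 / n) ^ n"
      using X A(1) fin by (simp add: n_def card_Diff_subset card_mono flip: power_add)
    also have "\<dots> = sqrt ((1 + 1 / n) ^ n)" by (simp add: real_sqrt_power)
    also have "\<dots> \<le> sqrt 4"
    proof (rule real_sqrt_le_mono)
      have "(1 + 1 / real n) ^ n \<le> exp (1 / real n) ^ n"
        using exp_ge_add_one_self[of "1 / real n"] by (intro power_mono) auto
      also have "\<dots> = exp 1" using n by (simp flip: exp_of_nat_mult)
      also have "\<dots> \<le> 4" using exp_le by linarith
      finally show "(1 + 1 / real n) ^ n \<le> 4" .
    qed
    finally show ?thesis by simp
  qed
  have M_k: "(\<Sum>X\<in>Pow A. if k \<in> X then M X else 0) = f k * 2 ^ (n - 1)" if k: "k \<in> A" for k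
  proof -
    \<comment> \<open>Setting the complementary factor at k to 0 removes the subsets that omit k, so
      that the restricted sum is still the expansion of a product.\<close>
    define g' where "g' j = (if j = k then 0 else g j)" for j
    have "(\<Sum>X\<in>Pow A. if k \<in> X then M X else 0) = (\<Sum>X\<in>Pow A. prod f X * prod g' (A - X))"
    proof (rule sum.cong[OF refl])
      fix X assume X: "X \<in> Pow A"
      show "(if k \<in> X then M X else 0) = prod f X * prod g' (A - X)"
      proof (cases "k \<in> X")
        case True
        then have "prod g' (A - X) = prod g (A - X)" by (intro prod.cong) (auto simp: g'_def)
        then show ?thesis using True by (simp add: M_def)
      next
        case False
        then have "prod g' (A - X) = 0" using k A(1) by (intro prod_zero) (auto simp: g'_def)
        then show ?thesis using False by simp
      qed
    qed
    also have "\<dots> = (\<Prod>j\<in>A. f j + g' j)" by (rule prod_add[OF A(1), symmetric])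
    also have "\<dots> = (f k + g' k) * (\<Prod>j\<in>A - {k}. f j + g' j)" by (rule prod.remove[OF A(1) k])
    also have "(\<Prod>j\<in>A - {k}. f j + g' j) = (\<Prod>j\<in>A - {k}. 2)"
      by (rule prod.cong) (auto simp: g'_def fg)
    finally show ?thesis using k A(1) by (simp add: g'_def n_def)
  qed
  have "(\<Sum>X\<in>Pow A. M X * complex_of_real (\<Sum>k\<in>X. y k)) = (\<Sum>X\<in>Pow A. \<Sum>k\<in>A. of_real (y k) * (if k \<in> X then M X else 0))"
  proof (rule sum.cong[OF refl])
    fix X assume X: "X \<in> Pow A"
    have "(\<Sum>k\<in>A. of_real (y k) * (if k \<in> X then M X else 0)) = (\<Sum>k\<in>X. of_real (y k) * M X)"
      using X A(1) by (intro sum.mono_neutral_cong_right) auto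
    then show "M X * complex_of_real (\<Sum>k\<in>X. y k) = (\<Sum>k\<in>A. of_real (y k) * (if k \<in> X then M X else 0))"
      by (simp add: sum_distrib_left mult.commute)
  qed
  also have "\<dots> = (\<Sum>k\<in>A. of_real (y k) * (\<Sum>X\<in>Pow A. if k \<in> X then M X else 0))"
    by (subst sum.swap) (simp add: sum_distrib_left)
  also have "\<dots> = (\<Sum>k\<in>A. of_real (y k) * (f k * 2 ^ (n - 1)))" by (rule sum.cong) (simp_all add: M_k)
  finally have eq: "(\<Sum>X\<in>Pow A. M X * complex_of_real (\<Sum>k\<in>X. y k)) = (\<Sum>k\<in>A. of_real (y k) * (f k * 2 ^ (n - 1)))" .
  \<comment> \<open>The real parts give only signed sums of the y k. The imaginary parts recover the
    absolute values, at the price of the factor \<theta>.\<close>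
  have "2 ^ (n - 1) * \<theta> * (\<Sum>k\<in>A. \<bar>y k\<bar>) = Im (\<Sum>k\<in>A. of_real (y k) * (f k * 2 ^ (n - 1)))"
  proof -
    have "f k * 2 ^ (n - 1) = Complex (2 ^ (n - 1)) (2 ^ (n - 1) * \<theta> * sgn (y k))" for k
    proof -
      have "f k * 2 ^ (n - 1) = f k * complex_of_real (2 ^ (n - 1))" by simp
      also have "\<dots> = Complex (2 ^ (n - 1)) (2 ^ (n - 1) * \<theta> * sgn (y k))"
        by (simp only: f_def complex_eq_iff) (simp del: of_real_power)
      finally show ?thesis .
    qed
    then show ?thesis by (simp add: Im_sum sum_distrib_left abs_sgn mult_ac)
  qed
  also have "\<dots> \<le> cmod (\<Sum>X\<in>Pow A. M X * complex_of_real (\<Sum>k\<in>X. y k))"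
    unfolding eq using abs_Im_le_cmod by (rule order_trans[OF abs_ge_self])
  also have "\<dots> \<le> (\<Sum>X\<in>Pow A. cmod (M X) * \<bar>\<Sum>k\<in>X. y k\<bar>)"
    by (rule order_trans[OF norm_sum]) (simp add: norm_mult del: of_real_sum)
  also have "\<dots> \<le> (\<Sum>X\<in>Pow A. 2 * \<bar>\<Sum>k\<in>X. y k\<bar>)"
    by (intro sum_mono mult_right_mono norm_M) auto
  finally have main: "2 ^ (n - 1) * \<theta> * (\<Sum>k\<in>A. \<bar>y k\<bar>) \<le> 2 * (\<Sum>X\<in>Pow A. \<bar>\<Sum>k\<in>X. y k\<bar>)"
    by (simp add: sum_distrib_left)
  have "2 ^ n * (\<Sum>k\<in>A. \<bar>y k\<bar>) = 2 * sqrt n * (2 ^ (n - 1) * \<theta> * (\<Sum>k\<in>A. \<bar>y k\<bar>))"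
    using n by (simp add: \<theta>_def power_eq_if)
  also have "\<dots> \<le> 2 * sqrt n * (2 * (\<Sum>X\<in>Pow A. \<bar>\<Sum>k\<in>X. y k\<bar>))"
    by (intro mult_left_mono main) simp
  finally show ?thesis by (simp add: n_def)
qed

lemma sum_norm_le_subset_sums:
  fixes y :: "'k \<Rightarrow> complex"
  assumes A: "finite A" "A \<noteq> {}"
  shows "2 ^ card A * (\<Sum>k\<in>A. cmod (y k)) \<le> 8 * sqrt (card A) * (\<Sum>X\<in>Pow A. cmod (\<Sum>k\<in>X. y k))"
proof -
  have le: "4 * sqrt (card A) * (\<Sum>X\<in>Pow A. \<bar>\<Sum>k\<in>X. h (y k)\<bar>) \<le> 4 * sqrt (card A) * (\<Sum>X\<in>Pow A. cmod (\<Sum>k\<in>X. y k))"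
    if "h = Re \<or> h = Im" for h
    using that abs_Re_le_cmod abs_Im_le_cmod
    by (intro mult_left_mono sum_mono) (auto simp flip: Re_sum Im_sum)
  have "2 ^ card A * (\<Sum>k\<in>A. cmod (y k)) \<le> 2 ^ card A * (\<Sum>k\<in>A. \<bar>Re (y k)\<bar> + \<bar>Im (y k)\<bar>)"
    by (intro mult_left_mono sum_mono cmod_le) auto
  also have "\<dots> = 2 ^ card A * (\<Sum>k\<in>A. \<bar>Re (y k)\<bar>) + 2 ^ card A * (\<Sum>k\<in>A. \<bar>Im (y k)\<bar>)"
    by (simp add: sum.distrib distrib_left)
  also have "\<dots> \<le> 4 * sqrt (card A) * (\<Sum>X\<in>Pow A. cmod (\<Sum>k\<in>X. y k)) + 4 * sqrt (card A) * (\<Sum>X\<in>Pow A. cmod (\<Sum>k\<in>X. y k))"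
    using order_trans[OF sum_abs_le_subset_sums_real[OF A] le] by (intro add_mono) blast+
  finally show ?thesis by simp
qed

text \<open>In the layer cake integral the part of F above level s has measure at most m = |F| and
  at most (B / s)^(1/\<delta>). The two bounds meet at the level t0 = B m^(-\<delta>), and the tail
  beyond it converges because 1 / \<delta> > 1.\<close>

lemma weak_norm_imp_L1_bound:
  fixes \<delta> B :: real
  assumes \<delta>: "0 < \<delta>" "\<delta> < 1" and B: "0 < B" and h[measurable]: "h \<in> borel_measurable dA"
    and weak: "weak_norm (ereal (1 / \<delta>)) h \<le> ennreal B" and F[measurable]: "F \<in> sets dA"
  shows "(\<integral>\<^sup>+ z. ennreal (cmod (h z)) * indicator F z \<partial>dA) \<le> ennreal (B / (1 - \<delta>) * measure dA F powr (1 - \<delta>))"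
proof -
  define m where "m = measure dA F"
  have em: "emeasure dA F = ennreal m" by (simp add: m_def dA.emeasure_eq_measure)
  have distr: "distr_fun h t \<le> (B / t) powr (1 / \<delta>)" if t: "0 < t" for t
  proof -
    have "ennreal (t * distr_fun h t powr \<delta>) \<le> weak_norm (ereal (1 / \<delta>)) h"
      using t \<delta> by (auto simp: weak_norm_def intro!: SUP_upper2[of t])
    then have "ennreal (t * distr_fun h t powr \<delta>) \<le> ennreal B" using weak by (rule order_trans)
    then have "distr_fun h t powr \<delta> \<le> B / t" using t B by (simp add: field_simps)
    then have "(distr_fun h t powr \<delta>) powr (1 / \<delta>) \<le> (B / t) powr (1 / \<delta>)"
      using \<delta> by (intro powr_mono2) auto
    then show ?thesis using \<delta> by (simp add: powr_powr distr_fun_def)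
  qed
  show ?thesis
  proof (cases "m = 0")
    case True
    then show ?thesis using nn_integral_dA_null[OF F] by (simp add: m_def)
  next
    case False
    then have m: "0 < m" by (simp add: m_def zero_less_measure_iff)
    define t0 where "t0 = B * m powr - \<delta>"
    have t0: "0 < t0" using B m by (simp add: t0_def)
    have "(\<integral>\<^sup>+ z. ennreal (cmod (h z)) * indicator F z \<partial>dA)
      = (\<integral>\<^sup>+ z. (\<integral>\<^sup>+ s. (if 0 < s \<and> s < cmod (h z) then 1 else 0) * indicator F z \<partial>lborel) \<partial>dA)"
    proof (rule nn_integral_cong)
      fix z
      show "ennreal (cmod (h z)) * indicator F z = (\<integral>\<^sup>+ s. (if 0 < s \<and> s < cmod (h z) then 1 else 0) * indicator F z \<partial>lborel)"
        by (subst ennreal_eq_layers) (simp_all add: nn_integral_multc)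
    qed
    also have "\<dots> = (\<integral>\<^sup>+ s. (\<integral>\<^sup>+ z. (if 0 < s \<and> s < cmod (h z) then 1 else 0) * indicator F z \<partial>dA) \<partial>lborel)"
      by (rule dA_lborel.Fubini'[symmetric]) measurable
    also have "\<dots> \<le> (\<integral>\<^sup>+ s. ennreal m * indicator {0<..<t0} s + ennreal (B powr (1 / \<delta>)) * (ennreal (s powr (- 1 - (1 / \<delta> - 1))) * indicator {t0..} s) \<partial>lborel)"
    proof (rule nn_integral_mono)
      fix s :: real
      show "(\<integral>\<^sup>+ z. (if 0 < s \<and> s < cmod (h z) then 1 else 0) * indicator F z \<partial>dA)
        \<le> ennreal m * indicator {0<..<t0} s + ennreal (B powr (1 / \<delta>)) * (ennreal (s powr (- 1 - (1 / \<delta> - 1))) * indicator {t0..} s)"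
      proof (cases "0 < s")
        case s: True
        show ?thesis
        proof (cases "s < t0")
          case True
          have "(\<integral>\<^sup>+ z. (if 0 < s \<and> s < cmod (h z) then 1 else 0) * indicator F z \<partial>dA) \<le> (\<integral>\<^sup>+ z. indicator F z \<partial>dA)"
            by (rule nn_integral_mono) simp
          then show ?thesis using True s by (simp add: em)
        next
          case False
          have "(\<integral>\<^sup>+ z. (if 0 < s \<and> s < cmod (h z) then 1 else 0) * indicator F z \<partial>dA) \<le> (\<integral>\<^sup>+ z. indicator {z \<in> space dA. s < cmod (h z)} z \<partial>dA)"
            by (rule nn_integral_mono) (simp add: indicator_def)
          also have "\<dots> = emeasure dA {z \<in> space dA. s < cmod (h z)}"
            by (rule nn_integral_indicator) measurable
          also have "\<dots> = ennreal (distr_fun h s)" by (simp add: distr_fun_def dA.emeasure_eq_measure)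
          also have "\<dots> \<le> ennreal ((B / s) powr (1 / \<delta>))" by (intro ennreal_leI distr s)
          also have "(B / s) powr (1 / \<delta>) = B powr (1 / \<delta>) * s powr (- 1 - (1 / \<delta> - 1))"
            using B s by (simp add: powr_divide powr_minus_divide)
          finally show ?thesis using False s by (simp add: ennreal_mult)
        qed
      qed simp
    qed
    also have "\<dots> = (\<integral>\<^sup>+ s. ennreal m * indicator {0<..<t0} s \<partial>lborel) + (\<integral>\<^sup>+ s. ennreal (B powr (1 / \<delta>)) * (ennreal (s powr (- 1 - (1 / \<delta> - 1))) * indicator {t0..} s) \<partial>lborel)"
      by (rule nn_integral_add) measurable
    also have "\<dots> = ennreal m * ennreal t0 + ennreal (B powr (1 / \<delta>)) * ennreal (t0 powr (- (1 / \<delta> - 1)) / (1 / \<delta> - 1))"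
    proof -
      have "(\<integral>\<^sup>+ s. ennreal (B powr (1 / \<delta>)) * (ennreal (s powr (- 1 - (1 / \<delta> - 1))) * indicator {t0..} s) \<partial>lborel)
        = ennreal (B powr (1 / \<delta>)) * (\<integral>\<^sup>+ s. ennreal (s powr (- 1 - (1 / \<delta> - 1))) * indicator {t0..} s \<partial>lborel)"
        by (rule nn_integral_cmult) measurable
      also have "(\<integral>\<^sup>+ s. ennreal (s powr (- 1 - (1 / \<delta> - 1))) * indicator {t0..} s \<partial>lborel) = ennreal (t0 powr (- (1 / \<delta> - 1)) / (1 / \<delta> - 1))"
        using \<delta> t0 by (intro nn_integral_powr_inf) auto
      finally show ?thesis using t0 by (simp add: nn_integral_cmult)
    qed
    also have "\<dots> = ennreal (m * t0 + B powr (1 / \<delta>) * (t0 powr (- (1 / \<delta> - 1)) / (1 / \<delta> - 1)))"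
      using m t0 \<delta> by (simp flip: ennreal_mult ennreal_plus)
    also have "m * t0 + B powr (1 / \<delta>) * (t0 powr (- (1 / \<delta> - 1)) / (1 / \<delta> - 1)) = B / (1 - \<delta>) * m powr (1 - \<delta>)"
    proof -
      have 1: "m * t0 = B * m powr (1 - \<delta>)"
        using m by (simp add: t0_def powr_diff powr_minus_divide)
      have "t0 powr (- (1 / \<delta> - 1)) = B powr (- (1 / \<delta> - 1)) * m powr ((- \<delta>) * (- (1 / \<delta> - 1)))"
        using B m by (simp only: t0_def powr_mult powr_powr)
      also have "(- \<delta>) * (- (1 / \<delta> - 1)) = 1 - \<delta>" using \<delta> by (simp add: field_simps)
      finally have "B powr (1 / \<delta>) * t0 powr (- (1 / \<delta> - 1)) = (B powr (1 / \<delta>) * B powr (- (1 / \<delta> - 1))) * m powr (1 - \<delta>)"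
        by simp
      also have "B powr (1 / \<delta>) * B powr (- (1 / \<delta> - 1)) = B" using B by (simp flip: powr_add)
      finally have 2: "B powr (1 / \<delta>) * t0 powr (- (1 / \<delta> - 1)) = B * m powr (1 - \<delta>)" .
      have 3: "1 + 1 / (1 / \<delta> - 1) = 1 / (1 - \<delta>)" using \<delta> by (simp add: field_simps)
      have "m * t0 + B powr (1 / \<delta>) * (t0 powr (- (1 / \<delta> - 1)) / (1 / \<delta> - 1)) = B * m powr (1 - \<delta>) * (1 + 1 / (1 / \<delta> - 1))"
        unfolding times_divide_eq_right 1 2 by (simp add: distrib_left)
      then show ?thesis unfolding 3 by simp
    qed
    finally show ?thesis by (simp add: m_def)
  qed
qed

section \<open>Power series of the kernel and its pairing with monomials\<close>

definition bincoef :: "real \<Rightarrow> nat \<Rightarrow> real" where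
  "bincoef s n = pochhammer s n / fact n"

lemma bincoef_nonneg: "0 < s \<Longrightarrow> 0 \<le> bincoef s n"
  by (simp add: bincoef_def pochhammer_nonneg)

text \<open>Consecutive coefficients have ratio 1 + s / (n + 1). By the weighted
  arithmetic-geometric mean inequality this is at least (1 + 1 / (n + 1))^s, the ratio of the powers
  on the left. The growth compensates the decay in \<open>exists_correlated_set\<close>.\<close>

lemma bincoef_ge:
  assumes s: "0 \<le> s" "s \<le> 1"
  shows "real (Suc n) powr s \<le> bincoef (1 + s) n"
proof (induction n)
  case (Suc n)
  define x where "x = 1 / real (Suc n)"
  have x: "0 < x" by (simp add: x_def)
  have step: "bincoef (1 + s) (Suc n) = bincoef (1 + s) n * (1 + s * x)"
    by (simp add: bincoef_def pochhammer_Suc x_def field_simps)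
  have "real (Suc (Suc n)) = real (Suc n) * (1 + x)" by (simp add: x_def field_simps)
  then have "real (Suc (Suc n)) powr s = real (Suc n) powr s * (1 + x) powr s" using x by (simp add: powr_mult)
  also have "\<dots> \<le> bincoef (1 + s) n * (1 + s * x)"
  proof (intro mult_mono Suc.IH)
    show "(1 + x) powr s \<le> 1 + s * x"
      using Youngs_inequality_0[of s "1 - s" "1 + x" 1] s x by (simp add: algebra_simps)
    show "0 \<le> bincoef (1 + s) n" using s by (intro bincoef_nonneg) simp
  qed simp
  finally show ?case by (simp only: step)
qed (simp add: bincoef_def)

lemma binomial_series_complex:
  assumes "cmod x < 1"
  shows "(\<lambda>n. complex_of_real (bincoef s n) * x ^ n) sums ((1 - x) powr - complex_of_real s)"
proof -
  have "(\<lambda>n. (- complex_of_real s gchoose n) * (- x) ^ n) sums (1 + - x) powr - complex_of_real s"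
    using assms by (intro gen_binomial_complex) simp
  moreover have "(- complex_of_real s gchoose n) * (- x) ^ n = complex_of_real (bincoef s n) * x ^ n" for n
  proof -
    have "(- complex_of_real s gchoose n) * (- x) ^ n = ((- 1) ^ n * (- 1) ^ n) * (pochhammer (complex_of_real s) n / fact n * x ^ n)"
      by (simp add: gbinomial_pochhammer power_minus[of x] mult_ac)
    also have "(- 1) ^ n * (- 1) ^ n = (1 :: complex)" by (simp flip: power_mult_distrib)
    finally show ?thesis by (simp add: bincoef_def pochhammer_of_real)
  qed
  ultimately show ?thesis by simp
qed

lemma binomial_series_summable:
  assumes "0 \<le> r" "r < 1"
  shows "summable (\<lambda>n. bincoef s n * r ^ n)"
proof -
  have "summable (\<lambda>n. complex_of_real (bincoef s n) * of_real r ^ n)"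
    using binomial_series_complex[of "of_real r" s] assms by (simp add: sums_iff)
  then have "summable (\<lambda>n. complex_of_real (bincoef s n * r ^ n))" by simp
  then show ?thesis by (simp only: summable_of_real_iff)
qed

lemma integrable_dA_bounded:
  fixes f :: "complex \<Rightarrow> complex"
  assumes "f \<in> borel_measurable dA" "\<And>z. cmod z < 1 \<Longrightarrow> cmod (f z) \<le> B"
  shows "integrable dA f"
  using assms by (intro dA.integrable_const_bound[of _ B] AE_I2) auto

text \<open>Expand the kernel in powers of z cnj w and integrate term by term. Orthogonality leaves
  only the index m. The interchange is dominated by the binomial series at |w| < 1, uniformly in
  z.\<close>

lemma fourier_coefficient_binomial:
  fixes \<psi> :: "real \<Rightarrow> complex"
  assumes [measurable]: "\<psi> \<in> borel_measurable borel" and B: "\<And>r. cmod (\<psi> r) \<le> B" and s: "0 < s" and w: "cmod w < 1"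
  shows "(\<integral> z. \<psi> (cmod z) * cnj z ^ m * (1 - z * cnj w) powr - complex_of_real s \<partial>dA)
    = of_real (bincoef s m) * cnj w ^ m * (\<integral> z. \<psi> (cmod z) * z ^ m * cnj z ^ m \<partial>dA)"
proof -
  define f where "f i z = of_real (bincoef s i) * cnj w ^ i * (\<psi> (cmod z) * z ^ i * cnj z ^ m)" for i z
  have [measurable]: "f i \<in> borel_measurable dA" for i unfolding f_def by measurable
  have B0: "0 \<le> B" using B[of 0] norm_ge_zero order_trans by blast
  have norm_f: "cmod (f i z) \<le> bincoef s i * cmod w ^ i * B" if z: "cmod z < 1" for i z
  proof -
    have "cmod (\<psi> (cmod z) * z ^ i * cnj z ^ m) \<le> B * 1 * 1"
      unfolding norm_mult using B B0 z by (intro mult_mono) (auto simp: norm_power power_le_one)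
    then show ?thesis unfolding f_def using bincoef_nonneg[OF s, of i]
      by (simp add: norm_mult norm_power mult_left_mono)
  qed
  have int_f: "integrable dA (f i)" for i by (rule integrable_dA_bounded[OF _ norm_f]) simp
  have summ: "summable (\<lambda>i. bincoef s i * cmod w ^ i * B)"
    using w by (intro summable_mult2 binomial_series_summable) auto
  have "(\<integral> z. \<psi> (cmod z) * cnj z ^ m * (1 - z * cnj w) powr - complex_of_real s \<partial>dA) = (\<integral> z. (\<Sum>i. f i z) \<partial>dA)"
  proof (rule Bochner_Integration.integral_cong[OF refl])
    fix z assume "z \<in> space dA"
    then have z: "cmod z < 1" by simp
    have "cmod (z * cnj w) < 1" using z w using mult_strict_mono'[of "cmod z" 1 "cmod w" 1] by (simp add: norm_mult)
    then have "(\<lambda>i. \<psi> (cmod z) * cnj z ^ m * (of_real (bincoef s i) * (z * cnj w) ^ i)) sums (\<psi> (cmod z) * cnj z ^ m * (1 - z * cnj w) powr - complex_of_real s)"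
      by (intro sums_mult binomial_series_complex)
    moreover have "\<psi> (cmod z) * cnj z ^ m * (of_real (bincoef s i) * (z * cnj w) ^ i) = f i z" for i
      by (simp add: f_def power_mult_distrib mult_ac)
    ultimately show "\<psi> (cmod z) * cnj z ^ m * (1 - z * cnj w) powr - complex_of_real s = (\<Sum>i. f i z)"
      by (simp add: sums_iff)
  qed
  also have "\<dots> = (\<Sum>i. \<integral> z. f i z \<partial>dA)"
  proof (rule integral_suminf[OF int_f])
    show "AE z in dA. summable (\<lambda>i. cmod (f i z))"
    proof (rule AE_I2)
      fix z assume "z \<in> space dA"
      then have z: "cmod z < 1" by simp
      show "summable (\<lambda>i. cmod (f i z))"
        by (rule summable_comparison_test'[OF summ, of 0]) (use norm_f[OF z] in auto)
    qed
    show "summable (\<lambda>i. \<integral> z. cmod (f i z) \<partial>dA)"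
    proof (rule summable_comparison_test'[OF summ, of 0])
      fix i
      have "(\<integral> z. cmod (f i z) \<partial>dA) \<le> (\<integral> z. bincoef s i * cmod w ^ i * B \<partial>dA)"
        using int_f norm_f by (intro integral_mono) auto
      also have "\<dots> = bincoef s i * cmod w ^ i * B" using dA.prob_space by (simp del: space_dA)
      finally show "norm (\<integral> z. cmod (f i z) \<partial>dA) \<le> bincoef s i * cmod w ^ i * B" by simp
    qed
  qed
  also have "\<dots> = (\<Sum>i. if i = m then \<integral> z. f m z \<partial>dA else 0)"
  proof -
    have "(\<integral> z. f i z \<partial>dA) = 0" if "i \<noteq> m" for i
      unfolding f_def using integral_radial_monomials_eq_0[OF assms(1) that] by simp
    then show ?thesis by (intro arg_cong[where f = suminf] ext) auto
  qed
  also have "\<dots> = (\<integral> z. f m z \<partial>dA)" by (rule sums_unique[symmetric]) (rule sums_single)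
  also have "\<dots> = of_real (bincoef s m) * cnj w ^ m * (\<integral> z. \<psi> (cmod z) * z ^ m * cnj z ^ m \<partial>dA)"
    unfolding f_def by simp
  finally show ?thesis .
qed

lemma nn_integral_weight: "-1 < b \<Longrightarrow> (\<integral>\<^sup>+ w. ennreal (defect w powr b) \<partial>dA) = ennreal (1 / (b + 1))"
  using nn_integral_dA_radial[of "\<lambda>u. ennreal (u powr b)"] nn_integral_powr_0[of b 1] by simp

lemma norm_T_ker_le:
  assumes "0 \<le> s" "0 < \<eta>" "\<eta> \<le> defect z" "cmod z < 1" "cmod w < 1"
  shows "cmod (T_ker b s z w) \<le> (\<eta> / 2) powr - s * defect w powr b"
proof -
  have "\<eta> / 2 \<le> cmod (1 - z * cnj w)" 
    by (rule order_trans[OF _ cmod_one_minus_ge(1)[OF assms(4,5)]]) (use assms in simp)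
  then have "cmod (1 - z * cnj w) powr - s \<le> (\<eta> / 2) powr - s"
    using assms by (intro powr_mono2') auto
  then have "defect w powr b * cmod (1 - z * cnj w) powr - s \<le> defect w powr b * (\<eta> / 2) powr - s"
    by (rule mult_left_mono) simp
  then show ?thesis by (simp add: norm_T_ker powr_minus_divide mult.commute)
qed

lemma integrable_T_ker_indicator:
  assumes b: "-1 < b" and s: "0 \<le> s" and z: "cmod z < 1" and [measurable]: "E \<in> sets dA"
  shows "integrable dA (\<lambda>w. T_ker b s z w * indicator E w)"
proof (rule integrableI_bounded)
  define K where "K = (defect z / 2) powr - s"
  show "(\<lambda>w. T_ker b s z w * indicator E w) \<in> borel_measurable dA" by measurable
  have "(\<integral>\<^sup>+ w. ennreal (cmod (T_ker b s z w * indicator E w)) \<partial>dA) \<le> (\<integral>\<^sup>+ w. ennreal K * ennreal (defect w powr b) \<partial>dA)"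
  proof (rule nn_integral_mono)
    fix w assume "w \<in> space dA"
    then have "cmod (T_ker b s z w) \<le> K * defect w powr b"
      unfolding K_def using norm_T_ker_le[OF s one_minus_cmod_sq_pos[OF z] order_refl z] by simp
    then show "ennreal (cmod (T_ker b s z w * indicator E w)) \<le> ennreal K * ennreal (defect w powr b)"
      by (auto simp: K_def norm_mult indicator_def ennreal_leI simp flip: ennreal_mult)
  qed
  also have "\<dots> = ennreal K * ennreal (1 / (b + 1))"
    by (subst nn_integral_cmult) (simp_all add: nn_integral_weight[OF b])
  finally show "(\<integral>\<^sup>+ w. ennreal (cmod (T_ker b s z w * indicator E w)) \<partial>dA) < \<infinity>"
    by (simp add: order_le_less_trans ennreal_mult_less_top)
qed

text \<open>The pairing with a monomial on circles factorizes into a coefficient of the kernel, a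
  radial moment of \<psi> and a moment of E. The gap \<eta> keeps the support of \<psi> away from
  the unit circle, where the kernel is at most a constant times \<open>defect w powr b\<close> and
  Fubini applies.\<close>

lemma T_ker_pairing:
  fixes \<psi> :: "real \<Rightarrow> complex"
  assumes [measurable]: "\<psi> \<in> borel_measurable borel" and B: "\<And>r. cmod (\<psi> r) \<le> B"
    and \<eta>: "0 < \<eta>" "\<And>r. \<psi> r \<noteq> 0 \<Longrightarrow> \<eta> \<le> 1 - r\<^sup>2"
    and b: "-1 < b" and s: "0 < s" and E[measurable]: "E \<in> sets dA"
  shows "(\<integral> z. \<psi> (cmod z) * cnj z ^ m * (\<integral> w. T_ker b s z w * indicator E w \<partial>dA) \<partial>dA)
    = of_real (bincoef s m) * (\<integral> z. \<psi> (cmod z) * z ^ m * cnj z ^ m \<partial>dA) *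
      (\<integral> w. of_real (defect w powr b) * cnj w ^ m * indicator E w \<partial>dA)"
proof -
  define f where "f z w = \<psi> (cmod z) * cnj z ^ m * (T_ker b s z w * indicator E w)" for z w
  define J where "J = (\<integral> z. \<psi> (cmod z) * z ^ m * cnj z ^ m \<partial>dA)"
  define K where "K = B * (\<eta> / 2) powr - s"
  have B0: "0 \<le> B" using B[of 0] norm_ge_zero order_trans by blast
  have norm_f: "cmod (f z w) \<le> K * defect w powr b" if z: "cmod z < 1" and w: "cmod w < 1" for z w
  proof (cases "\<psi> (cmod z) = 0")
    case True
    then show ?thesis using B0 by (simp add: f_def K_def)
  next
    case False
    have "cmod (f z w) \<le> B * 1 * (((\<eta> / 2) powr - s * defect w powr b) * 1)"
      unfolding f_def norm_mult
      using B0 B s \<eta>(2)[OF False] norm_T_ker_le[of s \<eta> z w b] \<eta>(1) z w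
      by (intro mult_mono) (auto simp: norm_power power_le_one indicator_def)
    then show ?thesis by (simp add: K_def mult.assoc)
  qed
  have f_meas: "case_prod f \<in> borel_measurable (dA \<Otimes>\<^sub>M dA)"
    unfolding f_def by measurable
  have int_f: "integrable (dA \<Otimes>\<^sub>M dA) (case_prod f)"
  proof (rule integrableI_bounded[OF f_meas])
    have "(\<integral>\<^sup>+ x. ennreal (cmod (case_prod f x)) \<partial>(dA \<Otimes>\<^sub>M dA)) = (\<integral>\<^sup>+ z. (\<integral>\<^sup>+ w. ennreal (cmod (f z w)) \<partial>dA) \<partial>dA)"
      using f_meas by (subst dA.nn_integral_fst[symmetric]) auto
    also have "\<dots> \<le> (\<integral>\<^sup>+ z. (\<integral>\<^sup>+ w. ennreal K * ennreal (defect w powr b) \<partial>dA) \<partial>dA)"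
    proof (intro nn_integral_mono)
      fix z w assume "z \<in> space dA" "w \<in> space dA"
      then show "ennreal (cmod (f z w)) \<le> ennreal K * ennreal (defect w powr b)"
        using norm_f[of z w] B0 by (simp add: K_def ennreal_leI flip: ennreal_mult)
    qed
    also have "\<dots> = ennreal K * ennreal (1 / (b + 1))"
      using emeasure_dA_space by (simp add: nn_integral_cmult nn_integral_weight[OF b])
    finally show "(\<integral>\<^sup>+ x. ennreal (cmod (case_prod f x)) \<partial>(dA \<Otimes>\<^sub>M dA)) < \<infinity>"
      by (simp add: order_le_less_trans ennreal_mult_less_top)
  qed
  have inner: "(\<integral> z. f z w \<partial>dA) = of_real (bincoef s m) * J * (of_real (defect w powr b) * cnj w ^ m * indicator E w)"
    if w: "cmod w < 1" for w
  proof -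
    have "f z w = of_real (defect w powr b) * indicator E w * (\<psi> (cmod z) * cnj z ^ m * (1 - z * cnj w) powr - complex_of_real s)" for z
      by (simp add: f_def T_ker_def powr_def exp_minus divide_inverse mult_ac)
    then have "(\<integral> z. f z w \<partial>dA) = of_real (defect w powr b) * indicator E w * (\<integral> z. \<psi> (cmod z) * cnj z ^ m * (1 - z * cnj w) powr - complex_of_real s \<partial>dA)"
      by simp
    then show ?thesis
      unfolding fourier_coefficient_binomial[OF assms(1) B s w] J_def by (simp add: mult_ac)
  qed
  have "(\<integral> z. \<psi> (cmod z) * cnj z ^ m * (\<integral> w. T_ker b s z w * indicator E w \<partial>dA) \<partial>dA) = (\<integral> z. (\<integral> w. f z w \<partial>dA) \<partial>dA)"
    unfolding f_def by simp
  also have "\<dots> = (\<integral> w. (\<integral> z. f z w \<partial>dA) \<partial>dA)"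
    by (rule dA_dA.Fubini_integral[OF int_f, symmetric])
  also have "\<dots> = (\<integral> w. of_real (bincoef s m) * J * (of_real (defect w powr b) * cnj w ^ m * indicator E w) \<partial>dA)"
    by (rule Bochner_Integration.integral_cong[OF refl]) (simp add: inner)
  finally show ?thesis by (simp add: J_def)
qed

section \<open>Sets correlated with a prescribed frequency\<close>

lemma measure_dA_annulus:
  assumes "0 \<le> x" "x \<le> y" "y \<le> 1"
  shows "measure dA {w \<in> space dA. x < defect w \<and> defect w < y} = y - x"
proof -
  let ?A = "{w \<in> space dA. x < defect w \<and> defect w < y}"
  have "emeasure dA ?A = (\<integral>\<^sup>+ w. indicator ?A w \<partial>dA)"
    by (rule nn_integral_indicator[symmetric]) measurable
  also have "\<dots> = (\<integral>\<^sup>+ w. indicator {x<..<y} (defect w) \<partial>dA)"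
    by (rule nn_integral_cong) (auto simp: indicator_def)
  also have "\<dots> = (\<integral>\<^sup>+ u. indicator {x<..<y} u * indicator {0<..<1} u \<partial>lborel)"
    by (rule nn_integral_dA_radial) measurable
  also have "\<dots> = (\<integral>\<^sup>+ u. indicator {x<..<y} u \<partial>lborel)"
    using assms by (intro nn_integral_cong) (auto simp: indicator_def)
  also have "\<dots> = ennreal (y - x)" using assms by simp
  finally show ?thesis using assms by (simp add: measure_def)
qed

text \<open>On the annulus, of measure 1 / m, the integrand has modulus at least (2 / m)^b / 4.
  Cutting by the signs of its real and imaginary parts removes all cancellation in the relevant
  part, and one of the four pieces carries a quarter of the total. This gives the constant
  16.\<close>

lemma exists_correlated_set:
  assumes b: "b \<le> 0" and j: "1 \<le> j" and m: "m = 4 * j"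
  obtains E where "E \<in> sets dA" "E \<subseteq> {w. 1 / real m < defect w \<and> defect w < 2 / real m}"
    "2 powr b * real m powr (- b - 1) / 16
      \<le> cmod (\<integral> w. of_real (defect w powr b) * cnj w ^ m * indicator E w \<partial>dA)"
proof -
  define A where "A = {w \<in> space dA. 1 / real m < defect w \<and> defect w < 2 / real m}"
  have A[measurable]: "A \<in> sets dA" unfolding A_def by measurable
  define h where "h w = of_real (defect w powr b) * cnj w ^ m" for w
  have [measurable]: "h \<in> borel_measurable dA" unfolding h_def by measurable
  have m1: "4 \<le> real m" using j m by simp
  \<comment> \<open>The supports of the positive and negative parts of Re h and of Im h. They
    overlap, but their contributions add up to |Re h| + |Im h| \<ge> |h|.\<close>
  define P where "P i = {w \<in> A. if i = (0::nat) then 0 < Re (h w) else if i = 1 then Re (h w) < 0 else if i = 2 then 0 < Im (h w) else Im (h w) < 0}" for i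
  have P[measurable]: "P i \<in> sets dA" for i
  proof -
    have "P i = A \<inter> {w \<in> space dA. if i = (0::nat) then 0 < Re (h w) else if i = 1 then Re (h w) < 0 else if i = 2 then 0 < Im (h w) else Im (h w) < 0}"
      by (auto simp: P_def A_def)
    also have "\<dots> \<in> sets dA" by measurable
    finally show ?thesis .
  qed
  have bound: "cmod (h w * indicator Q w) \<le> (1 / real m) powr b" if "Q \<subseteq> A" "cmod w < 1" for Q w
  proof (cases "w \<in> Q")
    case True
    then have "defect w powr b \<le> (1 / real m) powr b"
      using that(1) b m1 by (intro powr_mono2') (auto simp: A_def)
    then have "defect w powr b * cmod w ^ m \<le> (1 / real m) powr b * 1"
      using that(2) by (intro mult_mono) (auto simp: power_le_one)
    then show ?thesis using True by (simp add: h_def norm_mult norm_power)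
  qed simp
  have int_Q: "integrable dA (\<lambda>w. h w * indicator Q w)" if [measurable]: "Q \<in> sets dA" and "Q \<subseteq> A" for Q
    by (rule integrable_dA_bounded[OF _ bound[OF \<open>Q \<subseteq> A\<close>]]) measurable
  have PA: "P i \<subseteq> A" for i by (auto simp: P_def)
  define I where "I i = (\<integral> w. h w * indicator (P i) w \<partial>dA)" for i
  have Re_I: "(\<integral> w. Re (h w * indicator (P i) w) \<partial>dA) = Re (I i)" "(\<integral> w. Im (h w * indicator (P i) w) \<partial>dA) = Im (I i)" for i
    unfolding I_def by (rule integral_Re[OF int_Q[OF P PA]], rule integral_Im[OF int_Q[OF P PA]])
  have int_Re: "integrable dA (\<lambda>w. Re (h w * indicator (P i) w))" "integrable dA (\<lambda>w. Im (h w * indicator (P i) w))" for i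
    by (rule integrable_Re[OF int_Q[OF P PA]], rule integrable_Im[OF int_Q[OF P PA]])
  have "2 powr b * real m powr (- b - 1) / 4 = (\<integral> w. (2 / real m) powr b / 4 * indicator A w \<partial>dA)"
  proof -
    have "measure dA A = 1 / real m"
      unfolding A_def using measure_dA_annulus[of "1 / real m" "2 / real m"] m1 by (simp add: field_simps)
    moreover have "A \<inter> ball 0 1 = A" by (auto simp: A_def)
    ultimately show ?thesis using m1 by (simp add: powr_divide powr_diff powr_minus field_simps)
  qed
  also have "\<dots> \<le> (\<integral> w. cmod (h w * indicator A w) \<partial>dA)"
  proof (rule integral_mono)
    show "integrable dA (\<lambda>w. cmod (h w * indicator A w))" using int_Q[OF A] by (intro integrable_norm) simp
    fix w assume "w \<in> space dA"
    show "(2 / real m) powr b / 4 * indicator A w \<le> cmod (h w * indicator A w)"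
    proof (cases "w \<in> A")
      case True
      then have w: "0 < defect w" "defect w < 2 / real m"
        using m1 by (auto simp: A_def intro: less_trans[of 0 "1 / real m"])
      have 1: "(2 / real m) powr b \<le> defect w powr b"
        using w b by (intro powr_mono2') auto
      \<comment> \<open>With m = 4 j the power |w|^m is the square of (|w|^2)^j, and Bernoulli's
        inequality bounds the latter from below by 1 / 2.\<close>
      have "(1 / 2 :: real) = 1 + real j * (- 1 / (2 * real j))" using j by simp
      also have "\<dots> \<le> (1 + (- 1 / (2 * real j))) ^ j"
        using j by (intro Bernoulli_inequality) simp
      also have "\<dots> = (1 - 2 / real m) ^ j" by (simp add: m)
      also have "\<dots> \<le> ((cmod w)\<^sup>2) ^ j"
        using w m1 by (intro power_mono) auto
      finally have "(1 / 2)\<^sup>2 \<le> (((cmod w)\<^sup>2) ^ j)\<^sup>2" by (intro power_mono) auto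
      also have "\<dots> = cmod w ^ m" by (simp add: m flip: power_mult)
      finally have 2: "1 / 4 \<le> cmod w ^ m" by (simp add: power2_eq_square)
      have "(2 / real m) powr b * (1 / 4) \<le> defect w powr b * cmod w ^ m"
        using 1 2 by (intro mult_mono) auto
      then show ?thesis using True by (simp add: h_def norm_mult norm_power)
    qed simp
  next
    show "integrable dA (\<lambda>w. (2 / real m) powr b / 4 * indicator A w)"
      by (intro integrable_mult_right integrable_real_indicator A) (simp add: dA.emeasure_eq_measure)
  qed
  also have "\<dots> \<le> (\<integral> w. (Re (h w * indicator (P 0) w) - Re (h w * indicator (P 1) w)) + (Im (h w * indicator (P 2) w) - Im (h w * indicator (P 3) w)) \<partial>dA)"
  proof (rule integral_mono)
    show "integrable dA (\<lambda>w. cmod (h w * indicator A w))" using int_Q[OF A] by (intro integrable_norm) simp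
    show "integrable dA (\<lambda>w. (Re (h w * indicator (P 0) w) - Re (h w * indicator (P 1) w)) + (Im (h w * indicator (P 2) w) - Im (h w * indicator (P 3) w)))"
      by (intro Bochner_Integration.integrable_add Bochner_Integration.integrable_diff int_Re)
    fix w
    show "cmod (h w * indicator A w) \<le> (Re (h w * indicator (P 0) w) - Re (h w * indicator (P 1) w)) + (Im (h w * indicator (P 2) w) - Im (h w * indicator (P 3) w))"
      using cmod_le[of "h w"] by (auto simp: indicator_def P_def)
  qed
  also have "\<dots> = (Re (I 0) - Re (I 1)) + (Im (I 2) - Im (I 3))"
    by (simp only: Bochner_Integration.integral_add Bochner_Integration.integral_diff Bochner_Integration.integrable_diff int_Re Re_I)
  also have "\<dots> \<le> cmod (I 0) + cmod (I 1) + (cmod (I 2) + cmod (I 3))"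
    using abs_Re_le_cmod[of "I 0"] abs_Re_le_cmod[of "I 1"] abs_Im_le_cmod[of "I 2"] abs_Im_le_cmod[of "I 3"] by linarith
  finally have le: "2 powr b * real m powr (- b - 1) / 4 \<le> cmod (I 0) + cmod (I 1) + (cmod (I 2) + cmod (I 3))" .
  obtain i where "2 powr b * real m powr (- b - 1) / 16 \<le> cmod (I i)"
  proof -
    have "\<exists>i. 2 powr b * real m powr (- b - 1) / 16 \<le> cmod (I i)"
    proof (rule ccontr)
      assume "\<nexists>i. 2 powr b * real m powr (- b - 1) / 16 \<le> cmod (I i)"
      then have "cmod (I i) < 2 powr b * real m powr (- b - 1) / 16" for i by (simp add: not_le)
      from this[of 0] this[of 1] this[of 2] this[of 3] show False using le by linarith
    qed
    then show ?thesis using that by blast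
  qed
  then show ?thesis
    using that[OF P, of i] PA[of i] by (auto simp: I_def h_def A_def)
qed

section \<open>Reduction of the failure at infinity to T and to indicator functions\<close>

lemma weak_norm_mono:
  assumes [measurable]: "g \<in> borel_measurable dA" "h \<in> borel_measurable dA"
    and le: "\<And>z. cmod z < 1 \<Longrightarrow> cmod (g z) \<le> cmod (h z)" and q: "0 < q"
  shows "weak_norm (ereal q) g \<le> weak_norm (ereal q) h"
proof -
  have d: "distr_fun g t \<le> distr_fun h t" for t
    unfolding distr_fun_def
  proof (rule dA.finite_measure_mono)
    show "{z \<in> space dA. t < cmod (g z)} \<subseteq> {z \<in> space dA. t < cmod (h z)}"
      using le by (auto intro: less_le_trans)
  qed measurable
  have "(SUP t\<in>{0<..}. ennreal (t * distr_fun g t powr (1 / q))) \<le> (SUP t\<in>{0<..}. ennreal (t * distr_fun h t powr (1 / q)))"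
  proof (rule SUP_mono)
    fix t :: real assume "t \<in> {0<..}"
    then show "\<exists>s\<in>{0<..}. ennreal (t * distr_fun g t powr (1 / q)) \<le> ennreal (s * distr_fun h s powr (1 / q))"
      using q d by (intro bexI[of _ t] ennreal_leI mult_left_mono powr_mono2) (auto simp: distr_fun_def)
  qed
  then show ?thesis by (simp add: weak_norm_def)
qed

text \<open>An indicator is nonnegative, so the integrand of S is exactly the modulus of that of T,
  and the triangle inequality compares the images pointwise.\<close>

lemma restricted_weak_type_S_imp_T:
  assumes S: "restricted_weak_type_at_infinity a (S_ker b s) (ereal q)"
    and b: "-1 < b" and s: "0 \<le> s" and q: "0 < q"
  shows "restricted_weak_type_at_infinity a (T_ker b s) (ereal q)"
proof -
  have "weak_norm (ereal q) (int_op a (T_ker b s) (indicator E)) \<le> weak_norm (ereal q) (int_op a (S_ker b s) (indicator E))"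
    if [measurable]: "E \<in> sets dA" for E
  proof (rule weak_norm_mono[OF _ _ _ q])
    have ind: "(indicator E :: complex \<Rightarrow> complex) \<in> borel_measurable dA" by (rule borel_measurable_indicator) fact
    show "int_op a (T_ker b s) (indicator E) \<in> borel_measurable dA"
      "int_op a (S_ker b s) (indicator E) \<in> borel_measurable dA"
      by (rule int_op_measurable[OF _ ind], blast)+
    fix z assume z: "cmod z < 1"
    have "cmod (\<integral> w. T_ker b s z w * indicator E w \<partial>dA) \<le> (\<integral> w. cmod (T_ker b s z w * indicator E w) \<partial>dA)"
      by (rule integral_norm_bound)
    also have "\<dots> = cmod (complex_of_real (\<integral> w. cmod (T_ker b s z w * indicator E w) \<partial>dA))"
      by (simp add: integral_nonneg)
    also have "complex_of_real (\<integral> w. cmod (T_ker b s z w * indicator E w) \<partial>dA) = (\<integral> w. S_ker b s z w * indicator E w \<partial>dA)"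
    proof -
      have "complex_of_real (cmod (T_ker b s z w * indicator E w)) = S_ker b s z w * indicator E w" for w
        by (simp add: norm_mult norm_T_ker S_ker_def indicator_def)
      then show ?thesis by (simp flip: integral_complex_of_real)
    qed
    finally show "cmod (int_op a (T_ker b s) (indicator E) z) \<le> cmod (int_op a (S_ker b s) (indicator E) z)"
      by (simp add: int_op_def norm_mult mult_left_mono)
  qed
  then show ?thesis
    using S unfolding restricted_weak_type_at_infinity_def by (meson order_trans)
qed

lemma maps_boundedly_Linf_imp_restricted:
  assumes "maps_boundedly a k (Lp_norm \<infinity>) (weak_norm q)"
  shows "restricted_weak_type_at_infinity a k q"
proof -
  obtain C where C: "0 \<le> C" "\<And>f. f \<in> borel_measurable dA \<Longrightarrow> Lp_norm \<infinity> f < \<infinity> \<Longrightarrow>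
      weak_norm q (int_op a k f) \<le> ennreal C * Lp_norm \<infinity> f"
    using assms unfolding maps_boundedly_def by blast
  have "weak_norm q (int_op a k (indicator E)) \<le> ennreal C" if E: "E \<in> sets dA" for E
  proof -
    have ind[measurable]: "(indicator E :: complex \<Rightarrow> complex) \<in> borel_measurable dA"
      by (rule borel_measurable_indicator[OF E])
    have le: "Lp_norm \<infinity> (indicator E) \<le> 1"
    proof -
      have "esssup dA (\<lambda>z. ennreal (cmod (indicator E z))) \<le> 1"
      proof (rule esssup_I)
        show "AE z in dA. ennreal (cmod (indicator E z)) \<le> 1" by (simp add: indicator_def)
      qed measurable
      then show ?thesis by (simp add: Lp_norm_def)
    qed
    then have "weak_norm q (int_op a k (indicator E)) \<le> ennreal C * Lp_norm \<infinity> (indicator E)"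
      by (intro C(2) ind) (simp add: order_le_less_trans)
    also have "\<dots> \<le> ennreal C * 1" by (intro mult_left_mono le) simp
    finally show ?thesis by simp
  qed
  then show ?thesis using C(1) unfolding restricted_weak_type_at_infinity_def by blast
qed

text \<open>The sets \<open>E k\<close> live on disjoint dyadic annuli, and the image of \<open>indicator (E k)\<close> has a
  Fourier coefficient bounded below at the frequency \<open>2 ^ k\<close> on every circle near the boundary. A random
  union of \<open>n\<close> of them therefore has an image of size \<open>sqrt n\<close> there.\<close>

lemma restricted_weak_type_fails:
  fixes \<delta> b :: real
  assumes \<delta>: "0 < \<delta>" "\<delta> < 1" and b: "-1 < b" "b \<le> 0"
  shows "\<not> restricted_weak_type_at_infinity (- \<delta>) (T_ker b (b + 2)) (ereal (1 / \<delta>))"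
proof
  define s where "s = b + 2"
  have s: "0 < s" "s = 1 + (b + 1)" using b by (auto simp: s_def)
  assume "restricted_weak_type_at_infinity (- \<delta>) (T_ker b (b + 2)) (ereal (1 / \<delta>))"
  then obtain C where C: "0 \<le> C" "\<And>E. E \<in> sets dA \<Longrightarrow> weak_norm (ereal (1 / \<delta>)) (int_op (- \<delta>) (T_ker b s) (indicator E)) \<le> ennreal C"
    unfolding restricted_weak_type_at_infinity_def s_def by blast
  \<comment> \<open>\<open>weak_norm_imp_L1_bound\<close> asks for a positive bound, whereas C may
    be 0.\<close>
  define B where "B = C + 1"
  have B: "0 < B" "ennreal C \<le> ennreal B" using C(1) by (auto simp: B_def ennreal_leI)
  define D where "D = B / (1 - \<delta>)"
  have D: "0 < D" using B \<delta> by (simp add: D_def)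
  \<comment> \<open>1024 = 8 * 128, with 8 from \<open>sum_norm_le_subset_sums\<close> and 128 from
    the estimate \<open>lower\<close>. The argument ends with sqrt n \<le> 1024 D, which this n
    contradicts.\<close>
  obtain n where n: "(1024 * D)\<^sup>2 < real n" using reals_Archimedean2 by blast
  then have n0: "0 < n" by (metis less_nat_zero_code not_gr_zero of_nat_0 power2_less_0)
  \<comment> \<open>Starting at 2 makes 2^k a multiple of 4, as \<open>exists_correlated_set\<close>
    demands.\<close>
  define A where "A = {2..<n + 2}"
  have A: "finite A" "A \<noteq> {}" "card A = n" using n0 by (auto simp: A_def)
  define ann where "ann k = {w. 1 / 2 ^ k < defect w \<and> defect w < 2 / 2 ^ k}" for k :: nat
  have "\<exists>E. E \<in> sets dA \<and> E \<subseteq> ann k \<and> 2 powr b * real (2 ^ k) powr (- b - 1) / 16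
      \<le> cmod (\<integral> w. of_real (defect w powr b) * cnj w ^ 2 ^ k * indicator E w \<partial>dA)" if "k \<in> A" for k
  proof -
    have "2 \<le> k" using that by (simp add: A_def)
    then have "k = 2 + (k - 2)" by simp
    then have "(2::nat) ^ k = 2 ^ (2 + (k - 2))" by (rule arg_cong)
    also have "\<dots> = 4 * 2 ^ (k - 2)" by (simp add: power_add)
    finally have m: "(2::nat) ^ k = 4 * 2 ^ (k - 2)" .
    have j: "(1::nat) \<le> 2 ^ (k - 2)" by simp
    obtain E where "E \<in> sets dA" "E \<subseteq> {w. 1 / real (2 ^ k) < defect w \<and> defect w < 2 / real (2 ^ k)}"
      "2 powr b * real (2 ^ k) powr (- b - 1) / 16 \<le> cmod (\<integral> w. of_real (defect w powr b) * cnj w ^ 2 ^ k * indicator E w \<partial>dA)"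
      by (rule exists_correlated_set[OF b(2) j m]) blast
    then show ?thesis by (auto simp: ann_def)
  qed
  then have "\<exists>E. \<forall>k\<in>A. E k \<in> sets dA \<and> E k \<subseteq> ann k \<and> 2 powr b * real (2 ^ k) powr (- b - 1) / 16
      \<le> cmod (\<integral> w. of_real (defect w powr b) * cnj w ^ 2 ^ k * indicator (E k) w \<partial>dA)"
    by (intro bchoice ballI)
  then obtain E where E: "\<And>k. k \<in> A \<Longrightarrow> E k \<in> sets dA" "\<And>k. k \<in> A \<Longrightarrow> E k \<subseteq> ann k"
    "\<And>k. k \<in> A \<Longrightarrow> 2 powr b * real (2 ^ k) powr (- b - 1) / 16
      \<le> cmod (\<integral> w. of_real (defect w powr b) * cnj w ^ 2 ^ k * indicator (E k) w \<partial>dA)"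
    by blast
  have ann_disj: "ann k \<inter> ann l = {}" if "k < l" for k l
  proof -
    have "(2::real) ^ Suc k \<le> 2 ^ l" using that by (intro power_increasing) auto
    then have "2 / 2 ^ l \<le> (1::real) / 2 ^ k" by (simp add: field_simps)
    then show ?thesis by (auto simp: ann_def)
  qed
  have disj: "disjoint_family_on E A"
    unfolding disjoint_family_on_def
  proof (intro ballI impI)
    fix k l assume "k \<in> A" "l \<in> A" "k \<noteq> l"
    then show "E k \<inter> E l = {}"
      using ann_disj[of k l] ann_disj[of l k] E(2)[of k] E(2)[of l] by (cases "k < l") auto
  qed
  define T where "T F = int_op (- \<delta>) (T_ker b s) (indicator F)" for F
  have T_meas[measurable]: "T F \<in> borel_measurable dA" if "F \<in> sets dA" for F
    unfolding T_def by (rule int_op_measurable[OF _ borel_measurable_indicator[OF that]]) blast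
  have UN_sets: "(\<Union>k\<in>X. E k) \<in> sets dA" if "X \<in> Pow A" for X
    using that E(1) A(1) by (intro sets.finite_UN) (auto intro: finite_subset)
  have T_UN: "T (\<Union>k\<in>X. E k) z = (\<Sum>k\<in>X. T (E k) z)" if X: "X \<in> Pow A" and z: "cmod z < 1" for X z
  proof -
    have fin: "finite X" using X A(1) by (auto intro: finite_subset)
    have "indicator (\<Union>k\<in>X. E k) w = (\<Sum>k\<in>X. indicator (E k) w :: complex)" for w
      using disj X by (intro indicator_UN_disjoint fin) (auto simp: disjoint_family_on_def)
    then have "(\<integral> w. T_ker b s z w * indicator (\<Union>k\<in>X. E k) w \<partial>dA) = (\<integral> w. (\<Sum>k\<in>X. T_ker b s z w * indicator (E k) w) \<partial>dA)"
      by (simp add: sum_distrib_left)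
    also have "\<dots> = (\<Sum>k\<in>X. \<integral> w. T_ker b s z w * indicator (E k) w \<partial>dA)"
      using X E(1) s(1) by (intro Bochner_Integration.integral_sum integrable_T_ker_indicator[OF b(1) _ z]) auto
    finally show ?thesis by (simp add: T_def int_op_def sum_distrib_left)
  qed
  \<comment> \<open>Small enough that 2^k \<epsilon> \<le> 1 / 2 for every k in A. On the annulus F
    the factor |z|^(2m) with m = 2^k is then at least 1 / 2, so one annulus sees all n frequencies
    almost undamped.\<close>
  define \<epsilon> where "\<epsilon> = (1 / 2 ^ (n + 3) :: real)"
  have \<epsilon>: "0 < \<epsilon>" "\<epsilon> < 1" by (simp_all add: \<epsilon>_def)
  define F where "F = {z \<in> space dA. \<epsilon> / 2 < defect z \<and> defect z < \<epsilon>}"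
  have F[measurable]: "F \<in> sets dA" unfolding F_def by measurable
  have TF_meas: "(\<lambda>z. ennreal (cmod (T Q z)) * indicator F z) \<in> borel_measurable dA" if "Q \<in> sets dA" for Q
    using T_meas[OF that] F by (intro borel_measurable_times_ennreal borel_measurable_indicator) auto
  have mF: "measure dA F = \<epsilon> / 2"
    unfolding F_def using measure_dA_annulus[of "\<epsilon> / 2" \<epsilon>] \<epsilon> by simp
  have upper: "(\<integral>\<^sup>+ z. ennreal (cmod (T (\<Union>k\<in>X. E k) z)) * indicator F z \<partial>dA) \<le> ennreal (D * \<epsilon> powr (1 - \<delta>))"
    if X: "X \<in> Pow A" for X
  proof -
    have "(\<integral>\<^sup>+ z. ennreal (cmod (T (\<Union>k\<in>X. E k) z)) * indicator F z \<partial>dA) \<le> ennreal (D * measure dA F powr (1 - \<delta>))"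
      unfolding D_def
    proof (rule weak_norm_imp_L1_bound[OF \<delta> B(1) T_meas[OF UN_sets[OF X]] _ F])
      show "weak_norm (ereal (1 / \<delta>)) (T (\<Union>k\<in>X. E k)) \<le> ennreal B"
        using C(2)[OF UN_sets[OF X]] B(2) unfolding T_def by (rule order_trans)
    qed
    also have "\<dots> \<le> ennreal (D * \<epsilon> powr (1 - \<delta>))"
      using D \<delta> \<epsilon> by (intro ennreal_leI mult_left_mono powr_mono2) (auto simp: mF)
    finally show ?thesis .
  qed
  \<comment> \<open>The outer factor \<open>defect z powr - \<delta>\<close> of T, cut off to F.
    Pairing the bare integral with \<psi> amounts to testing T itself on F, while the cutoff
    supplies the gap required by \<open>T_ker_pairing\<close>.\<close>
  define \<psi> where "\<psi> r = complex_of_real (if \<epsilon> / 2 < 1 - r\<^sup>2 \<and> 1 - r\<^sup>2 < \<epsilon> then (1 - r\<^sup>2) powr - \<delta> else 0)" for r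
  have [measurable]: "\<psi> \<in> borel_measurable borel" unfolding \<psi>_def by measurable
  have \<psi>_bound: "cmod (\<psi> r) \<le> (\<epsilon> / 2) powr - \<delta>" for r
    using \<epsilon> \<delta> by (auto simp: \<psi>_def intro!: powr_mono2')
  have lower: "ennreal (\<epsilon> powr (1 - \<delta>) / 128) \<le> (\<integral>\<^sup>+ z. ennreal (cmod (T (E k) z)) * indicator F z \<partial>dA)" if k: "k \<in> A" for k
  proof -
    define m where "m = (2::nat) ^ k"
    have m: "1 \<le> m" by (simp add: m_def)
    define J where "J = (\<integral> z. \<psi> (cmod z) * z ^ m * cnj z ^ m \<partial>dA)"
    define I where "I = (\<integral> w. of_real (defect w powr b) * cnj w ^ m * indicator (E k) w \<partial>dA)"
    define H where "H = (\<lambda>z. \<psi> (cmod z) * cnj z ^ m * (\<integral> w. T_ker b s z w * indicator (E k) w \<partial>dA))"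
    have eq: "(\<integral> z. H z \<partial>dA) = of_real (bincoef s m) * J * I"
      unfolding H_def J_def I_def
      by (rule T_ker_pairing[where \<eta> = "\<epsilon> / 2" and B = "(\<epsilon> / 2) powr - \<delta>", OF _ \<psi>_bound])
        (use \<epsilon> b s E(1)[OF k] in \<open>auto simp: \<psi>_def split: if_splits\<close>)
    have "\<epsilon> powr (1 - \<delta>) / 4 \<le> cmod J"
    proof -
      have m\<epsilon>: "real m * \<epsilon> \<le> 1 / 2"
      proof -
        have "(2::real) ^ k \<le> 2 ^ (n + 2)" using k by (intro power_increasing) (auto simp: A_def)
        then show ?thesis by (simp add: m_def \<epsilon>_def power_add field_simps)
      qed
      define g where "g z = (if \<epsilon> / 2 < defect z \<and> defect z < \<epsilon> then defect z powr - \<delta> * ((cmod z)\<^sup>2) ^ m else 0)" for z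
      have [measurable]: "g \<in> borel_measurable dA" unfolding g_def by measurable
      have g_le: "g z \<le> (\<epsilon> / 2) powr - \<delta>" "0 \<le> g z" if z: "cmod z < 1" for z
      proof -
        have "defect z powr - \<delta> * ((cmod z)\<^sup>2) ^ m \<le> (\<epsilon> / 2) powr - \<delta> * 1" if "\<epsilon> / 2 < defect z"
          using that \<epsilon> \<delta> z by (intro mult_mono powr_mono2') (auto simp: power_le_one)
        then show "g z \<le> (\<epsilon> / 2) powr - \<delta>" by (simp add: g_def)
        show "0 \<le> g z" by (simp add: g_def)
      qed
      have "J = (\<integral> z. complex_of_real (g z) \<partial>dA)"
        unfolding J_def
      proof (rule Bochner_Integration.integral_cong[OF refl])
        fix z
        have "z ^ m * cnj z ^ m = complex_of_real (((cmod z)\<^sup>2) ^ m)"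
          unfolding power_mult_distrib[symmetric] complex_norm_square[symmetric] by simp
        then show "\<psi> (cmod z) * z ^ m * cnj z ^ m = complex_of_real (g z)"
          by (simp add: \<psi>_def g_def mult.assoc)
      qed
      then have J: "J = complex_of_real (\<integral> z. g z \<partial>dA)" by simp
      have "\<epsilon> powr (1 - \<delta>) / 4 = \<epsilon> powr - \<delta> / 2 * measure dA F"
        unfolding mF using \<epsilon> by (simp add: powr_diff powr_minus field_simps)
      also have "\<dots> = (\<integral> z. \<epsilon> powr - \<delta> / 2 * indicator F z \<partial>dA)"
      proof -
        have "F \<inter> ball 0 1 = F" by (auto simp: F_def)
        then show ?thesis by simp
      qed
      also have "\<dots> \<le> (\<integral> z. g z \<partial>dA)"
      proof (rule integral_mono)
        show "integrable dA g"
          by (rule dA.integrable_const_bound[of _ "(\<epsilon> / 2) powr - \<delta>"]) (use g_le in \<open>auto intro!: AE_I2\<close>)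
        fix z assume "z \<in> space dA"
        show "\<epsilon> powr - \<delta> / 2 * indicator F z \<le> g z"
        proof (cases "z \<in> F")
          case True
          then have z: "\<epsilon> / 2 < defect z" "defect z < \<epsilon>" by (auto simp: F_def)
          have "1 / 2 \<le> 1 + real m * (- \<epsilon>)" using m\<epsilon> by simp
          also have "\<dots> \<le> (1 + - \<epsilon>) ^ m" using \<epsilon> by (intro Bernoulli_inequality) simp
          also have "\<dots> \<le> ((cmod z)\<^sup>2) ^ m" using z \<epsilon> by (intro power_mono) auto
          finally have 1: "1 / 2 \<le> ((cmod z)\<^sup>2) ^ m" .
          have 2: "\<epsilon> powr - \<delta> \<le> defect z powr - \<delta>"
            using z \<epsilon> \<delta> by (intro powr_mono2') auto
          have "\<epsilon> powr - \<delta> * (1 / 2) \<le> defect z powr - \<delta> * ((cmod z)\<^sup>2) ^ m"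
            by (intro mult_mono 1 2) auto
          then show ?thesis using True z by (simp add: g_def)
        qed (use g_le(2) \<open>z \<in> space dA\<close> in auto)
      next
        show "integrable dA (\<lambda>z. \<epsilon> powr - \<delta> / 2 * indicator F z)"
          by (intro integrable_mult_right integrable_real_indicator F) (simp add: dA.emeasure_eq_measure)
      qed
      also have "\<dots> \<le> cmod J" unfolding J norm_of_real by (rule abs_ge_self)
      finally show ?thesis .
    qed
    \<comment> \<open>The growth m^(b+1) of the coefficient cancels the decay m^(-b-1) of the moment
      of E k, so the bound does not depend on k. The 32 is 16 from
      \<open>exists_correlated_set\<close> times 2 from 2^b \<ge> 1 / 2.\<close>
    moreover have "1 / 32 \<le> bincoef s m * cmod I"
    proof -
      have "real m powr (b + 1) \<le> real (Suc m) powr (b + 1)" using b by (intro powr_mono2) auto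
      also have "\<dots> \<le> bincoef s m" unfolding s(2) using b by (intro bincoef_ge) auto
      finally have 1: "real m powr (b + 1) \<le> bincoef s m" .
      have 2: "2 powr b * real m powr (- b - 1) / 16 \<le> cmod I"
        using E(3)[OF k] by (simp add: I_def m_def)
      have "real m powr (b + 1) * real m powr (- b - 1) = 1"
        using m by (simp flip: powr_add)
      then have "real m powr (b + 1) * (2 powr b * real m powr (- b - 1) / 16) = 2 powr b / 16"
        by (simp add: algebra_simps)
      moreover have "real m powr (b + 1) * (2 powr b * real m powr (- b - 1) / 16) \<le> bincoef s m * cmod I"
        using 1 2 by (intro mult_mono order_trans[OF _ 1]) auto
      moreover have "1 / 2 \<le> (2::real) powr b"
        using powr_mono[of "- 1" b 2] b by (simp add: powr_minus)
      ultimately show ?thesis by linarith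
    qed
    ultimately have "\<epsilon> powr (1 - \<delta>) / 4 * (1 / 32) \<le> cmod J * (bincoef s m * cmod I)"
      by (intro mult_mono) auto
    also have "\<dots> = cmod (\<integral> z. H z \<partial>dA)"
      unfolding eq using bincoef_nonneg[OF s(1), of m] by (simp add: norm_mult)
    finally have "ennreal (\<epsilon> powr (1 - \<delta>) / 128) \<le> ennreal (cmod (\<integral> z. H z \<partial>dA))"
      by (intro ennreal_leI) simp
    also have "\<dots> \<le> (\<integral>\<^sup>+ z. ennreal (cmod (H z)) \<partial>dA)"
      by (cases "integrable dA H")
        (simp_all add: integral_norm_bound_ennreal not_integrable_integral_eq)
    also have "\<dots> \<le> (\<integral>\<^sup>+ z. ennreal (cmod (T (E k) z)) * indicator F z \<partial>dA)"
    proof (rule nn_integral_mono)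
      fix z assume "z \<in> space dA"
      then have z: "cmod z < 1" by simp
      let ?L = "cmod (\<integral> w. T_ker b s z w * indicator (E k) w \<partial>dA)"
      have "cmod (H z) \<le> cmod (T (E k) z) * indicator F z"
      proof (cases "z \<in> F")
        case True
        then have "cmod (H z) = defect z powr - \<delta> * (cmod z ^ m * ?L)"
          by (simp add: H_def \<psi>_def F_def norm_mult norm_power)
        also have "\<dots> \<le> defect z powr - \<delta> * (1 * ?L)"
          using z by (intro mult_left_mono mult_right_mono) (auto simp: power_le_one)
        finally show ?thesis using True by (simp add: T_def int_op_def norm_mult)
      next
        case False
        then have "\<psi> (cmod z) = 0" using z by (simp add: F_def \<psi>_def)
        then show ?thesis using False by (simp add: H_def)
      qed
      then show "ennreal (cmod (H z)) \<le> ennreal (cmod (T (E k) z)) * indicator F z"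
        by (auto simp: indicator_def ennreal_leI)
    qed
    finally show ?thesis .
  qed
  define e where "e = \<epsilon> powr (1 - \<delta>)"
  have e: "0 < e" using \<epsilon> by (simp add: e_def)
  \<comment> \<open>Integrating the subset inequality over F sets n lower bounds, weighted by 2^n,
    against 8 sqrt n times the 2^n upper bounds, one for each union.\<close>
  have "ennreal (2 ^ n * (real n * (e / 128))) = ennreal (2 ^ n) * (\<Sum>k\<in>A. ennreal (e / 128))"
  proof -
    have "(\<Sum>k\<in>A. ennreal (e / 128)) = ennreal (\<Sum>k\<in>A. e / 128)" using e by (intro sum_ennreal) simp
    then show ?thesis using e A(3) by (simp flip: ennreal_mult)
  qed
  also have "\<dots> \<le> ennreal (2 ^ n) * (\<Sum>k\<in>A. \<integral>\<^sup>+ z. ennreal (cmod (T (E k) z)) * indicator F z \<partial>dA)"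
    using lower by (intro mult_left_mono sum_mono) (auto simp: e_def)
  also have "(\<Sum>k\<in>A. \<integral>\<^sup>+ z. ennreal (cmod (T (E k) z)) * indicator F z \<partial>dA) = (\<integral>\<^sup>+ z. (\<Sum>k\<in>A. ennreal (cmod (T (E k) z)) * indicator F z) \<partial>dA)"
    by (intro nn_integral_sum[symmetric] TF_meas E(1))
  also have "ennreal (2 ^ n) * \<dots> = (\<integral>\<^sup>+ z. ennreal (2 ^ n) * (\<Sum>k\<in>A. ennreal (cmod (T (E k) z)) * indicator F z) \<partial>dA)"
    by (intro nn_integral_cmult[symmetric] borel_measurable_sum TF_meas E(1))
  also have "\<dots> \<le> (\<integral>\<^sup>+ z. ennreal (8 * sqrt n) * (\<Sum>X\<in>Pow A. ennreal (cmod (T (\<Union>k\<in>X. E k) z)) * indicator F z) \<partial>dA)"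
  proof (rule nn_integral_mono)
    fix z assume "z \<in> space dA"
    then have z: "cmod z < 1" by simp
    have "2 ^ n * (\<Sum>k\<in>A. cmod (T (E k) z)) \<le> 8 * sqrt n * (\<Sum>X\<in>Pow A. cmod (T (\<Union>k\<in>X. E k) z))"
      using sum_norm_le_subset_sums[OF A(1,2), of "\<lambda>k. T (E k) z"] T_UN[OF _ z] by (simp add: A(3))
    then have "ennreal (2 ^ n * (\<Sum>k\<in>A. cmod (T (E k) z))) \<le> ennreal (8 * sqrt n * (\<Sum>X\<in>Pow A. cmod (T (\<Union>k\<in>X. E k) z)))"
      by (rule ennreal_leI)
    then have "ennreal (2 ^ n) * (\<Sum>k\<in>A. ennreal (cmod (T (E k) z))) \<le> ennreal (8 * sqrt n) * (\<Sum>X\<in>Pow A. ennreal (cmod (T (\<Union>k\<in>X. E k) z)))"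
      by (simp add: ennreal_mult sum_nonneg sum_ennreal)
    then have "ennreal (2 ^ n) * (\<Sum>k\<in>A. ennreal (cmod (T (E k) z))) * indicator F z \<le> ennreal (8 * sqrt n) * (\<Sum>X\<in>Pow A. ennreal (cmod (T (\<Union>k\<in>X. E k) z))) * indicator F z"
      by (rule mult_right_mono) simp
    then show "ennreal (2 ^ n) * (\<Sum>k\<in>A. ennreal (cmod (T (E k) z)) * indicator F z) \<le> ennreal (8 * sqrt n) * (\<Sum>X\<in>Pow A. ennreal (cmod (T (\<Union>k\<in>X. E k) z)) * indicator F z)"
      by (simp only: sum_distrib_right mult.assoc)
  qed
  also have "\<dots> = ennreal (8 * sqrt n) * (\<integral>\<^sup>+ z. (\<Sum>X\<in>Pow A. ennreal (cmod (T (\<Union>k\<in>X. E k) z)) * indicator F z) \<partial>dA)"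
    by (intro nn_integral_cmult borel_measurable_sum TF_meas UN_sets)
  also have "(\<integral>\<^sup>+ z. (\<Sum>X\<in>Pow A. ennreal (cmod (T (\<Union>k\<in>X. E k) z)) * indicator F z) \<partial>dA) = (\<Sum>X\<in>Pow A. \<integral>\<^sup>+ z. ennreal (cmod (T (\<Union>k\<in>X. E k) z)) * indicator F z \<partial>dA)"
    by (intro nn_integral_sum TF_meas UN_sets)
  also have "ennreal (8 * sqrt n) * \<dots> \<le> ennreal (8 * sqrt n) * (\<Sum>X\<in>Pow A. ennreal (D * e))"
    unfolding e_def by (intro mult_left_mono sum_mono upper) auto
  also have "\<dots> = ennreal (8 * sqrt n * (2 ^ n * (D * e)))"
  proof -
    have "(\<Sum>X\<in>Pow A. ennreal (D * e)) = ennreal (\<Sum>X\<in>Pow A. D * e)" using D e by (intro sum_ennreal) simp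
    then show ?thesis using D e A by (simp add: card_Pow flip: ennreal_mult)
  qed
  finally have "2 ^ n * (real n * (e / 128)) \<le> 8 * sqrt n * (2 ^ n * (D * e))"
    using D e by (subst (asm) ennreal_le_iff) auto
  then have "real n \<le> 1024 * D * sqrt n" using e by (simp add: field_simps)
  then have "sqrt n * sqrt n \<le> 1024 * D * sqrt n" by simp
  then have "sqrt n \<le> 1024 * D" using n0 by (simp only: mult_le_cancel_right) auto
  then have "(sqrt n)\<^sup>2 \<le> (1024 * D)\<^sup>2" by (intro power_mono) auto
  then show False using n by simp
qed

section \<open>Translation of the exponents and assembly of the two cases\<close>

lemma one_divide_ereal: "r \<noteq> 0 \<Longrightarrow> 1 / ereal r = ereal (1 / r)"
  by (simp add: one_ereal_def)

theorem theorem10p3: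
  fixes a b c :: real
  assumes "a > -1" and "b > -1"
    and "0 < c - a - b - 2" and "c - a - b - 2 < 1"
    and "b + 2 \<le> c" and "c < a + 2"
  shows
    "(- a \<noteq> c - a - b - 2 \<longrightarrow>
       (\<forall>p q :: ereal. 1 \<le> p \<and> 1 \<le> q \<and> 1 / q = 1 / p + ereal (c - a - b - 2) \<and>
            1 / p < ereal (b + 1) \<longrightarrow>
          maps_boundedly a (T_ker b c) (Lp_norm p) (weak_norm q) \<and>
          maps_boundedly a (S_ker b c) (Lp_norm p) (weak_norm q)) \<and>
       (\<forall>p q :: ereal. 1 \<le> p \<and> 1 \<le> q \<and>
            p = ereal (1 / (b + 1)) \<and> ereal (c - 1 - a) \<le> 1 / q \<and> 1 / q \<le> 1 \<longrightarrow>
          \<not> maps_boundedly a (T_ker b c) (Lp_norm p) (weak_norm q) \<and>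
          \<not> maps_boundedly a (S_ker b c) (Lp_norm p) (weak_norm q)) \<and>
       (\<forall>(p :: real) (q :: ereal). 1 \<le> p \<and> 1 \<le> q \<and>
            p = 1 / (b + 1) \<and> ereal (c - 1 - a) \<le> 1 / q \<and> 1 / q \<le> 1 \<longrightarrow>
          maps_boundedly a (T_ker b c) (lorentz1_norm p) (weak_norm q) \<and>
          maps_boundedly a (S_ker b c) (lorentz1_norm p) (weak_norm q)))
     \<and>
     (- a = c - a - b - 2 \<longrightarrow>
       (\<forall>p q :: ereal. 1 \<le> p \<and> 1 \<le> q \<and> 1 / q = 1 / p + ereal (c - a - b - 2) \<and>
            1 / p < ereal (b + 1) \<and> p \<noteq> \<infinity> \<longrightarrow>
          maps_boundedly a (T_ker b c) (Lp_norm p) (weak_norm q) \<and>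
          maps_boundedly a (S_ker b c) (Lp_norm p) (weak_norm q)) \<and>
       (\<forall>p q :: ereal. 1 \<le> p \<and> 1 \<le> q \<and>
            (p = \<infinity> \<and> q = ereal (1 / (c - a - b - 2)) \<or>
             p = ereal (1 / (b + 1)) \<and> ereal (c - 1 - a) \<le> 1 / q \<and> 1 / q \<le> 1) \<longrightarrow>
          \<not> maps_boundedly a (T_ker b c) (Lp_norm p) (weak_norm q) \<and>
          \<not> maps_boundedly a (S_ker b c) (Lp_norm p) (weak_norm q)) \<and>
       (\<forall>(p :: real) (q :: ereal). 1 \<le> p \<and> 1 \<le> q \<and>
            p = 1 / (b + 1) \<and> ereal (c - 1 - a) \<le> 1 / q \<and> 1 / q \<le> 1 \<longrightarrow>
          maps_boundedly a (T_ker b c) (lorentz1_norm p) (weak_norm q) \<and>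
          maps_boundedly a (S_ker b c) (lorentz1_norm p) (weak_norm q)) \<and>
       \<not> restricted_weak_type_at_infinity a (T_ker b c) (ereal (1 / (c - a - b - 2))) \<and>
       \<not> restricted_weak_type_at_infinity a (S_ker b c) (ereal (1 / (c - a - b - 2))))"
proof -
  define \<delta> where "\<delta> = c - a - b - 2"
  have c: "c = a + b + 2 + \<delta>" by (simp add: \<delta>_def)
  have \<delta>: "0 < \<delta>" "\<delta> < 1" "0 \<le> a + \<delta>" and b: "-1 < b" "b < 0" "b + \<delta> < 0" and c0: "0 \<le> c"
    using assms by (auto simp: \<delta>_def)
  have strong: "maps_boundedly a k (Lp_norm p) (weak_norm q)"
    if k: "k = T_ker b c \<or> k = S_ker b c"
      and pq: "1 \<le> p" "1 \<le> q" "1 / q = 1 / p + ereal \<delta>" "1 / p < ereal (b + 1)"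
      and fin: "p = \<infinity> \<longrightarrow> 0 < a + \<delta>" for k and p q :: ereal
  proof (cases p)
    case (real r)
    have r: "1 \<le> r" using pq(1) real by (simp add: one_ereal_def)
    have q_inv: "1 / q = ereal (1 / r + \<delta>)" using pq(3) r by (simp add: real one_divide_ereal)
    have r1: "1 < r * (b + 1)" using pq(4) r by (simp add: real one_divide_ereal field_simps)
    \<comment> \<open>Since 1 / q is positive and 1 / \<infinity> = 0, the exponent q is
      finite.\<close>
    obtain t where t: "q = ereal t" "1 \<le> t"
      using pq(2) q_inv r \<delta> by (cases q) (auto simp: one_ereal_def add_nonneg_eq_0_iff)
    have "1 / t = 1 / r + \<delta>" using q_inv t by (simp add: one_divide_ereal)
    then have "t * (1 + r * \<delta>) = r" using t(2) r by (simp add: field_simps)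
    moreover have "1 + r * \<delta> \<noteq> 0" using r \<delta>(1) by (simp add: add_nonneg_eq_0_iff)
    ultimately have "t = r / (1 + r * \<delta>)" by (simp add: eq_divide_eq)
    then show ?thesis
      unfolding real t using maps_boundedly_Lp[OF k c b(1,2) \<delta>(1,3) _ r1] r by simp
  next
    case PInf
    have q_inv: "1 / q = ereal \<delta>" using pq(3) by (simp add: PInf)
    obtain t where t: "q = ereal t" "1 \<le> t"
      using pq(2) q_inv \<delta> by (cases q) (auto simp: one_ereal_def)
    have "1 / t = \<delta>" using q_inv t by (simp add: one_divide_ereal)
    then have "t = 1 / \<delta>" using t by auto
    then show ?thesis
      unfolding PInf t using maps_boundedly_Linf[OF k c b(1) \<delta>(1)] fin PInf by simp
  qed (use pq(1) in auto)
  \<comment> \<open>Absolute convergence already fails at this p, which excludes every q at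
    once.\<close>
  have unbounded: "\<not> maps_boundedly a k (Lp_norm (ereal (1 / (b + 1)))) (weak_norm q)"
    if "k = T_ker b c \<or> k = S_ker b c" for k q
    by (rule not_maps_boundedly_endpoint[OF that b(1,2) c0])
  have lorentz: "maps_boundedly a k (lorentz1_norm (1 / (b + 1))) (weak_norm q)"
    if k: "k = T_ker b c \<or> k = S_ker b c" and q: "1 \<le> q" "ereal (c - 1 - a) \<le> 1 / q" for k and q :: ereal
  proof -
    \<comment> \<open>Again q is finite: c - 1 - a = b + 1 + \<delta> is positive, so 1 / q cannot
      be 0.\<close>
    obtain t where t: "q = ereal t" "1 \<le> t"
      using q \<delta> b by (cases q) (auto simp: one_ereal_def c)
    have "b + 1 + \<delta> \<le> 1 / t" using q(2) t by (simp add: one_divide_ereal c algebra_simps)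
    then show ?thesis
      unfolding t(1) using t(2) by (intro maps_boundedly_lorentz[OF k c b(1,2) \<delta>(1,3)]) auto
  qed
  have restricted: "\<not> restricted_weak_type_at_infinity a k (ereal (1 / \<delta>))"
    if k: "k = T_ker b c \<or> k = S_ker b c" and a: "- a = \<delta>" for k
  proof -
    have "a = - \<delta>" "c = b + 2" using a c by auto
    then have "\<not> restricted_weak_type_at_infinity a (T_ker b c) (ereal (1 / \<delta>))"
      using restricted_weak_type_fails[OF \<delta>(1,2) b(1)] b by simp
    then show ?thesis
      using k restricted_weak_type_S_imp_T[OF _ b(1) c0, of a "1 / \<delta>"] \<delta> by auto
  qed
  have unbounded_inf: "\<not> maps_boundedly a k (Lp_norm \<infinity>) (weak_norm (ereal (1 / \<delta>)))"
    if "k = T_ker b c \<or> k = S_ker b c" "- a = \<delta>" for k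
    using restricted[OF that] maps_boundedly_Linf_imp_restricted by blast
  have T: "T_ker b c = T_ker b c \<or> T_ker b c = S_ker b c" and S: "S_ker b c = T_ker b c \<or> S_ker b c = S_ker b c"
    by simp_all
  have a: "0 < a + \<delta>" if "- a \<noteq> \<delta>" using that \<delta>(3) by linarith
  show ?thesis
    unfolding \<delta>_def[symmetric]
    by (intro conjI impI allI; (elim conjE)?; (elim disjE conjE)?; (simp only:)?;
      (rule strong[OF T] strong[OF S] unbounded[OF T] unbounded[OF S] lorentz[OF T] lorentz[OF S]
        restricted[OF T] restricted[OF S] unbounded_inf[OF T] unbounded_inf[OF S])?; (simp add: a)?)
qed

end
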